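(* Let $K$ be a finite extension of $\mathbb Q_p$ with ring of integers $\mathcal O_K$, let $f\in\mathcal O_K(x)$ be a rational map of degree $d$ with $2\le d<p$ and good reduction, and let $\alpha_0\in K$. If the arboreal representation of $f$ with base point $\alpha_0$ is infinitely ramified, then one of its branch representations is infinitely ramified.
   Context: The arboreal representation with base point $\alpha_0$ is the action of $\Gamma_K=\operatorname{Gal}(\bar K/K)$ on the tree of all iterated preimages $\bigcup_n f^{-n}(\alpha_0)$. A branch is a sequence $(\alpha_n)_{n\in\mathbb N}$ with $f(\alpha_{n+1})=\alpha_n$ starting at $\alpha_0$; its branch representation is the action of $\Gamma_K$ on the tree formed by the Galois orbit of the branch. A representation of $\Gamma_K$ is infinitely ramified if there is no finite extension $L/K$ such that its restriction to $\operatorname{Gal}(\bar K/L)$ is unramified (trivial on inertia). *)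

theory Defs
  imports "HOL-Computational_Algebra.Polynomial" "HOL-Library.Extended_Real"
    "HOL-Combinatorics.Permutations"
begin

text \<open>Ambient setting: the type 'a plays the role of an algebraic closure of K.
  Points of the projective line over it are 'a option (None = infinity).\<close>

definition is_valuation :: "('a::field \<Rightarrow> ereal) \<Rightarrow> bool" where
  "is_valuation v \<longleftrightarrow>
     (\<forall>x. v x = \<infinity> \<longleftrightarrow> x = 0) \<and> (\<forall>x. v x \<noteq> -\<infinity>) \<and>
     (\<forall>x y. v (x * y) = v x + v y) \<and>
     (\<forall>x y. min (v x) (v y) \<le> v (x + y))"

definition is_subfield :: "'a::field set \<Rightarrow> bool" where
  "is_subfield K \<longleftrightarrow> 0 \<in> K \<and> 1 \<in> K \<and>
     (\<forall>x\<in>K. \<forall>y\<in>K. x + y \<in> K \<and> x * y \<in> K) \<and>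
     (\<forall>x\<in>K. - x \<in> K \<and> inverse x \<in> K)"

definition algebraically_closed_type :: "'a::field itself \<Rightarrow> bool" where
  "algebraically_closed_type _ \<longleftrightarrow> (\<forall>p::'a poly. degree p \<ge> 1 \<longrightarrow> (\<exists>x. poly p x = 0))"

definition algebraic_over :: "'a::field set \<Rightarrow> bool" where
  "algebraic_over K \<longleftrightarrow>
     (\<forall>x::'a. \<exists>p. p \<noteq> 0 \<and> (\<forall>i. coeff p i \<in> K) \<and> poly p x = 0)"

definition finite_dim_over :: "'a::field set \<Rightarrow> 'a set \<Rightarrow> bool" where
  "finite_dim_over F L \<longleftrightarrow> F \<subseteq> L \<and>
     (\<exists>B. finite B \<and> B \<subseteq> L \<and> L = {\<Sum>b\<in>B. c b * b | c. \<forall>b\<in>B. c b \<in> F})"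

definition finite_extension :: "'a::field set \<Rightarrow> 'a set \<Rightarrow> bool" where
  "finite_extension K L \<longleftrightarrow> is_subfield L \<and> finite_dim_over K L"

definition complete_wrt :: "('a::field \<Rightarrow> ereal) \<Rightarrow> 'a set \<Rightarrow> bool" where
  "complete_wrt v K \<longleftrightarrow>
     (\<forall>x::nat \<Rightarrow> 'a. (\<forall>n. x n \<in> K) \<longrightarrow>
        (\<forall>M::real. \<exists>N. \<forall>m\<ge>N. \<forall>n\<ge>N. v (x m - x n) > ereal M) \<longrightarrow>
        (\<exists>y\<in>K. \<forall>M::real. \<exists>N. \<forall>n\<ge>N. v (x n - y) > ereal M))"

text \<open>The closure of the prime field \<rat> with respect to v; when v(p) > 0 and
  K is complete, this is the copy of \<rat>_p inside K.\<close>
definition rat_closure :: "('a::field_char_0 \<Rightarrow> ereal) \<Rightarrow> 'a set" where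
  "rat_closure v = {y. \<forall>M::real. \<exists>q::rat. v (y - of_rat q) > ereal M}"

definition finite_ext_Qp :: "('a::field_char_0 \<Rightarrow> ereal) \<Rightarrow> nat \<Rightarrow> 'a set \<Rightarrow> bool" where
  "finite_ext_Qp v p K \<longleftrightarrow> prime p \<and> is_valuation v \<and> 0 < v (of_nat p) \<and>
     is_subfield K \<and> complete_wrt v K \<and> finite_extension (rat_closure v) K"

definition ring_of_integers :: "('a::field \<Rightarrow> ereal) \<Rightarrow> 'a set \<Rightarrow> 'a set" where
  "ring_of_integers v K = {x\<in>K. v x \<ge> 0}"

definition galois_group :: "'a::field set \<Rightarrow> ('a \<Rightarrow> 'a) set" where
  "galois_group K = {\<sigma>. bij \<sigma> \<and> (\<forall>x y. \<sigma> (x + y) = \<sigma> x + \<sigma> y) \<and>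
      (\<forall>x y. \<sigma> (x * y) = \<sigma> x * \<sigma> y) \<and> (\<forall>x\<in>K. \<sigma> x = x)}"

definition inertia :: "('a::field \<Rightarrow> ereal) \<Rightarrow> ('a \<Rightarrow> 'a) set" where
  "inertia v = {\<sigma>. \<forall>x. v x \<ge> 0 \<longrightarrow> v (\<sigma> x - x) > 0}"

text \<open>The action of the Galois group on a Galois-stable set of points S of
  the projective line (the vertices of a tree) is infinitely ramified: there
  is no finite extension L/K such that the inertia subgroup of Gal(Kbar/L)
  acts trivially.\<close>
definition infinitely_ramified ::
    "('a::field \<Rightarrow> ereal) \<Rightarrow> 'a set \<Rightarrow> 'a option set \<Rightarrow> bool" where
  "infinitely_ramified v K S \<longleftrightarrow>
     \<not> (\<exists>L. finite_extension K L \<and>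
          (\<forall>\<sigma>\<in>galois_group L \<inter> inertia v. \<forall>\<beta>\<in>S. map_option \<sigma> \<beta> = \<beta>))"

definition rat_map :: "'a::field poly \<Rightarrow> 'a poly \<Rightarrow> 'a option \<Rightarrow> 'a option" where
  "rat_map P Q z = (let d = max (degree P) (degree Q) in
     case z of
       Some x \<Rightarrow> (if poly Q x = 0 then None else Some (poly P x / poly Q x))
     | None \<Rightarrow> (if coeff Q d = 0 then None else Some (coeff P d / coeff Q d)))"

text \<open>Sylvester matrix of the degree-d homogenisations of P and Q, and the
  homogeneous resultant Res(F,G) as its determinant (Leibniz formula).\<close>
definition sylvester_hom :: "nat \<Rightarrow> 'a::comm_ring_1 poly \<Rightarrow> 'a poly \<Rightarrow> nat \<Rightarrow> nat \<Rightarrow> 'a" where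
  "sylvester_hom d P Q r c =
     (if r < d then (if r \<le> c \<and> c - r \<le> d then coeff P (d - (c - r)) else 0)
      else (if r - d \<le> c \<and> c - (r - d) \<le> d then coeff Q (d - (c - (r - d))) else 0))"

definition hom_resultant :: "nat \<Rightarrow> 'a::comm_ring_1 poly \<Rightarrow> 'a poly \<Rightarrow> 'a" where
  "hom_resultant d P Q =
     (\<Sum>\<pi> | \<pi> permutes {..<2*d}. of_int (sign \<pi>) * (\<Prod>i<2*d. sylvester_hom d P Q i (\<pi> i)))"

text \<open>f = P/Q with coefficients in O_K has good reduction: Res(F,G) is a unit of O_K.\<close>
definition good_reduction :: "('a::field \<Rightarrow> ereal) \<Rightarrow> 'a poly \<Rightarrow> 'a poly \<Rightarrow> bool" where
  "good_reduction v P Q \<longleftrightarrow> v (hom_resultant (max (degree P) (degree Q)) P Q) = 0"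

definition arboreal_tree :: "('a option \<Rightarrow> 'a option) \<Rightarrow> 'a \<Rightarrow> 'a option set" where
  "arboreal_tree f a0 = {\<beta>. \<exists>n. (f ^^ n) \<beta> = Some a0}"

definition is_branch :: "('a option \<Rightarrow> 'a option) \<Rightarrow> 'a \<Rightarrow> (nat \<Rightarrow> 'a option) \<Rightarrow> bool" where
  "is_branch f a0 \<alpha> \<longleftrightarrow> \<alpha> 0 = Some a0 \<and> (\<forall>n. f (\<alpha> (Suc n)) = \<alpha> n)"

definition branch_orbit_tree :: "'a::field set \<Rightarrow> (nat \<Rightarrow> 'a option) \<Rightarrow> 'a option set" where
  "branch_orbit_tree K \<alpha> = {map_option \<tau> (\<alpha> n) | \<tau> n. \<tau> \<in> galois_group K}"

end

theory Submission
  imports "Jordan_Normal_Form.Determinant" "HOL-Number_Theory.Residues" Defs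
begin

hide_const (open) up_ring.coeff up_ring.monom

text \<open>
  Inertia preserves the residue classes of the projective line. Call a residue class bad if the
  reduction of \<open>f\<close> is ramified there; outside bad classes inertia fixing \<open>f z\<close> fixes \<open>z\<close>,
  and as \<open>d < p\<close> the Wronskian of the reduction is nonzero, so only finitely many classes are bad.

  If a path in the tree meets a bad class twice, that class is periodic and the path extends to a
  branch running through the cycle. If the branch \<open>\<alpha>\<close> is not itself periodic of period \<open>n\<close>, the
  distances of \<open>\<alpha> m\<close> and \<open>\<alpha> (m + n)\<close> increase strictly at every passage through a bad class while
  staying below 1. But if inertia over some finite extension fixed the branch, these distances
  would lie in a discrete group. Hence, if no branch is infinitely ramified, the branch is periodic
  and consists of \<open>K\<close>-rational points. So on every path the number of bad points that are not
  \<open>K\<close>-rational is at most the number of bad classes. Each of them enlarges the value group by a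
  bounded index, so the values of differences of siblings lie in a group \<open>(1/E) v(p) \<int>\<close>
  independent of the path, and by tameness inertia over \<open>K(p^(1/E))\<close> acts trivially on the tree.

  Discreteness of the values on the fixed field of inertia over \<open>L\<close> comes from the ring spanned by
  \<open>L\<close> and all roots of unity of order prime to \<open>p\<close>: its residue field is algebraically closed, so
  every automorphism fixing it is inert.
\<close>

section \<open>Non-archimedean absolute values and integral polynomials\<close>

text \<open>The difficulty is uniformity: one finite extension must serve paths of every length. The
  fixed field of inertia over \<open>L\<close> is infinite over \<open>L\<close>, so discreteness of
  its values is not automatic; it comes from counting generators of the span of \<open>L\<close>
  over a ring whose nonzero values are powers of \<open>N p\<close>. Intermediate fields are
  replaced by subgroups \<open>J\<close> of inertia, and only exponents \<open>e\<close> such that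
  \<open>N x ^ e\<close> is a power of \<open>N p\<close> are tracked. At a bad non-rational point,
  \<open>J\<close> shrinks to the pointwise stabilizer of a fibre with at most \<open>d\<close>
  finite points; conjugates are told apart by self-maps of the fibre, at most \<open>d ^ d\<close>
  of them. This gives one factor \<open>fact (d ^ d)\<close> per such point and
  \<open>E = e * fact (d ^ d) ^ card S\<close> in total, \<open>S\<close> representing the bad
  classes. The bound \<open>d < p\<close> does two jobs: degrees of distinct reduced degree at most
  \<open>d\<close> differ by a unit, which makes the Wronskian nonzero, and inertia orbits in a
  fibre have length prime to \<open>p\<close>, so that means can be formed. A branch with
  \<open>\<alpha> m = \<alpha> (m + n)\<close> for all \<open>m\<close> returns to
  \<open>a0\<close>, hence consists of forward iterates of \<open>a0\<close>; this is why its points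
  are rational.\<close>

locale nonarch =
  fixes N :: "'a::field_char_0 \<Rightarrow> real"
  assumes N_0 [simp]: "N 0 = 0"
    and N_pos: "x \<noteq> 0 \<Longrightarrow> 0 < N x"
    and N_mult: "N (x * y) = N x * N y"
    and N_ultra: "N (x + y) \<le> max (N x) (N y)"
begin

lemma N_nonneg [simp]: "0 \<le> N x"
  using N_pos[of x] by (cases "x = 0") auto

lemma N_eq_0 [simp]: "N x = 0 \<longleftrightarrow> x = 0"
  using N_pos[of x] by (cases "x = 0") auto

lemma N_1 [simp]: "N 1 = 1"
  using N_mult[of 1 1] N_pos[of 1] by simp

lemma N_power: "N (x ^ n) = N x ^ n"
  by (induction n) (auto simp: N_mult)

lemma N_minus_1 [simp]: "N (- 1) = 1"
proof -
  have "N (- 1) ^ 2 = 1"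
    by (subst N_power[symmetric]) simp
  then show ?thesis
    using N_nonneg[of "-1"] by (simp add: power2_eq_1_iff)
qed

lemma N_minus [simp]: "N (- x) = N x"
  using N_mult[of "-1" x] by simp

lemma N_minus_commute: "N (x - y) = N (y - x)"
  using N_minus[of "x - y"] by simp

lemma N_diff: "N (x - y) \<le> max (N x) (N y)"
  using N_ultra[of x "-y"] by simp

lemma N_inverse: "N (inverse x) = inverse (N x)"
proof (cases "x = 0")
  case False
  then have "N (inverse x) * N x = 1"
    by (simp flip: N_mult)
  then show ?thesis
    by (metis inverse_unique mult.commute)
qed auto

lemma N_divide: "N (x / y) = N x / N y"
  by (simp add: divide_inverse N_mult N_inverse)

lemma N_add_le: "N x \<le> c \<Longrightarrow> N y \<le> c \<Longrightarrow> N (x + y) \<le> c"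
  using N_ultra[of x y] by auto

lemma N_add_less: "N x < c \<Longrightarrow> N y < c \<Longrightarrow> N (x + y) < c"
  using N_ultra[of x y] by auto

lemma N_diff_le: "N x \<le> c \<Longrightarrow> N y \<le> c \<Longrightarrow> N (x - y) \<le> c"
  using N_diff[of x y] by auto

lemma N_diff_less: "N x < c \<Longrightarrow> N y < c \<Longrightarrow> N (x - y) < c"
  using N_diff[of x y] by auto

lemma N_dominant: "N y < N x \<Longrightarrow> N (x + y) = N x"
  using N_ultra[of x y] N_diff[of "x + y" y] by auto

lemma N_eqI: "N (x - y) < N y \<Longrightarrow> N x = N y"
  using N_dominant[of "x - y" y] by simp

lemma N_mult_le1: "N x \<le> 1 \<Longrightarrow> N y \<le> 1 \<Longrightarrow> N (x * y) \<le> 1"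
  by (simp add: N_mult mult_le_one)

lemma N_mult_less1: "N x \<le> 1 \<Longrightarrow> N y < 1 \<Longrightarrow> N (x * y) < 1"
  unfolding N_mult using mult_left_le_one_le[of "N y" "N x"] by auto

lemma N_mult_less1': "N x < 1 \<Longrightarrow> N y \<le> 1 \<Longrightarrow> N (x * y) < 1"
  using N_mult_less1[of y x] by (simp add: mult.commute)

lemma N_power_le1: "N x \<le> 1 \<Longrightarrow> N (x ^ n) \<le> 1"
  by (simp add: N_power power_le_one)

lemma N_sum_le: "0 \<le> c \<Longrightarrow> (\<And>i. i \<in> A \<Longrightarrow> N (f i) \<le> c) \<Longrightarrow> N (sum f A) \<le> c"
  by (induction A rule: infinite_finite_induct) (auto intro!: N_add_le)

lemma N_sum_less: "0 < c \<Longrightarrow> (\<And>i. i \<in> A \<Longrightarrow> N (f i) < c) \<Longrightarrow> N (sum f A) < c"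
  by (induction A rule: infinite_finite_induct) (auto intro!: N_add_less)

lemma N_prod: "N (prod f A) = (\<Prod>i\<in>A. N (f i))"
  by (induction A rule: infinite_finite_induct) (auto simp: N_mult)

lemma N_of_nat: "N (of_nat n) \<le> 1"
  by (induction n) (auto intro!: N_add_le)

lemma N_of_int: "N (of_int n) \<le> 1"
  by (cases n rule: int_cases2) (auto simp: N_of_nat)

section \<open>Polynomials with integral coefficients\<close>

definition intpoly :: "'a poly \<Rightarrow> bool" where
  "intpoly w \<longleftrightarrow> (\<forall>i. N (coeff w i) \<le> 1)"

lemma intpolyD: "intpoly w \<Longrightarrow> N (coeff w i) \<le> 1"
  by (simp add: intpoly_def)

lemma intpoly_pCons [simp]: "intpoly (pCons a w) \<longleftrightarrow> N a \<le> 1 \<and> intpoly w"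
proof
  assume h: "intpoly (pCons a w)"
  have "N (coeff w i) \<le> 1" for i
    using intpolyD[OF h, of "Suc i"] by simp
  then show "N a \<le> 1 \<and> intpoly w"
    using intpolyD[OF h, of 0] by (simp add: intpoly_def)
qed (auto simp: intpoly_def coeff_pCons split: nat.split)

lemma intpoly_0 [simp]: "intpoly 0"
  by (simp add: intpoly_def)

lemma intpoly_diff: "intpoly u \<Longrightarrow> intpoly w \<Longrightarrow> intpoly (u - w)"
  by (auto simp: intpoly_def intro!: N_diff_le)

lemma intpoly_mult: "intpoly u \<Longrightarrow> intpoly w \<Longrightarrow> intpoly (u * w)"
  by (auto simp: intpoly_def coeff_mult intro!: N_sum_le N_mult_le1)

lemma intpoly_smult: "N c \<le> 1 \<Longrightarrow> intpoly w \<Longrightarrow> intpoly (smult c w)"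
  by (auto simp: intpoly_def intro!: N_mult_le1)

lemma intpoly_pderiv: "intpoly w \<Longrightarrow> intpoly (pderiv w)"
  unfolding intpoly_def coeff_pderiv
  by (metis N_mult_le1 N_of_nat)

lemma N_poly_le1: "intpoly w \<Longrightarrow> N x \<le> 1 \<Longrightarrow> N (poly w x) \<le> 1"
  by (induction w) (auto intro!: N_add_le N_mult_le1)

text \<open>\<open>y - x\<close> divides \<open>poly w y - poly w x\<close> with a quotient integral
  in both variables; the Horner recursion makes this visible.\<close>

lemma N_poly_diff: "intpoly w \<Longrightarrow> N x \<le> 1 \<Longrightarrow> N y \<le> 1 \<Longrightarrow> N (poly w y - poly w x) \<le> N (y - x)"
proof (induction w)
  case (pCons a w)
  have eq: "poly (pCons a w) y - poly (pCons a w) x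
      = y * (poly w y - poly w x) + (y - x) * poly w x"
    by (simp add: algebra_simps)
  have "N (poly w y - poly w x) \<le> N (y - x)" "N (poly w x) \<le> 1"
    using pCons by (auto intro: N_poly_le1)
  then have "N (y * (poly w y - poly w x)) \<le> N (y - x)"
    and "N ((y - x) * poly w x) \<le> N (y - x)"
    using pCons.prems(3) by (simp_all add: N_mult mult_left_le mult_mono[of _ 1 _ "N (y - x)", simplified])
  then show ?case
    unfolding eq by (rule N_add_le)
qed auto

text \<open>The remainder is \<open>(y - x) ^ 2\<close> times an integral expression. The Horner
  recursion yields it without dividing a second derivative by 2.\<close>

lemma N_poly_taylor:
  assumes "intpoly w" "N x \<le> 1" "N y \<le> 1"
  shows "N (poly w y - poly w x - (y - x) * poly (pderiv w) x) \<le> N (y - x) ^ 2"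
  using assms(1)
proof (induction w)
  case (pCons a w)
  have eq: "poly (pCons a w) y - poly (pCons a w) x - (y - x) * poly (pderiv (pCons a w)) x
      = x * (poly w y - poly w x - (y - x) * poly (pderiv w) x) + (y - x) * (poly w y - poly w x)"
    by (simp add: algebra_simps pderiv_pCons)
  have "N (x * (poly w y - poly w x - (y - x) * poly (pderiv w) x)) \<le> N (y - x) ^ 2"
    using mult_mono[OF assms(2) pCons.IH] pCons.prems by (simp add: N_mult)
  moreover have "N ((y - x) * (poly w y - poly w x)) \<le> N (y - x) ^ 2"
    using N_poly_diff[of w x y] pCons.prems assms
    by (simp add: N_mult power2_eq_square mult_left_mono)
  ultimately show ?case
    unfolding eq by (rule N_add_le)
qed auto

text \<open>Roots are split off one at a time. From \<open>N x \<le> 1 \<le> N (x - r)\<close> also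
  \<open>N r \<le> N (x - r)\<close>, so the factor \<open>[:- r, 1:]\<close> enlarges the
  coefficients by at most the factor by which it enlarges the value at \<open>x\<close>.\<close>

lemma coeff_le_poly_of_far_roots:
  assumes ac: "algebraically_closed_type TYPE('a)" and x: "N x \<le> 1"
    and "\<And>r. poly w r = 0 \<Longrightarrow> 1 \<le> N (x - r)" and "w \<noteq> 0"
  shows "N (coeff w i) \<le> N (poly w x)"
  using assms(3,4)
proof (induction "degree w" arbitrary: w i)
  case 0
  then obtain c where "w = [:c:]"
    by (metis degree_eq_zeroE)
  then show ?case
    by (cases i) auto
next
  case (Suc n)
  then obtain r where r: "poly w r = 0"
    using ac by (metis algebraically_closed_type_def le_add1 plus_1_eq_Suc)
  then obtain k where k: "w = [:-r, 1:] * k"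
    by (metis dvd_def poly_eq_0_iff_dvd)
  with Suc.prems(2) have "k \<noteq> 0"
    by auto
  then have "degree w = Suc (degree k)"
    unfolding k by (subst degree_mult_eq) auto
  moreover have "1 \<le> N (x - s)" if "poly k s = 0" for s
    using that Suc.prems(1)[of s] by (simp add: k)
  ultimately have IH: "N (coeff k j) \<le> N (poly k x)" for j
    using Suc.hyps \<open>k \<noteq> 0\<close> by auto
  have far: "1 \<le> N (x - r)"
    using Suc.prems(1) r by blast
  have "N r \<le> N (x - r)"
    using far x N_ultra[of "x - r" "- x"] N_minus[of r] by auto
  then have 1: "N (r * coeff k i) \<le> N (x - r) * N (poly k x)"
    by (simp add: N_mult mult_mono IH)
  have 2: "N (coeff (pCons 0 k) i) \<le> N (x - r) * N (poly k x)"
    using mult_mono[OF far IH[of "i - 1"]] by (cases i) auto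
  have "coeff w i = coeff (pCons 0 k) i - r * coeff k i"
    unfolding k by (simp add: coeff_pCons)
  moreover have "poly w x = (x - r) * poly k x"
    by (simp add: k algebra_simps)
  ultimately show ?case
    using N_diff_le[OF 2 1] by (simp add: N_mult)
qed

text \<open>Contrapositive of the preceding bound. It plays the role of Hensel's lemma and lifts
  multiple roots of the reduction as well, because the field is algebraically closed.\<close>

lemma root_near:
  assumes "algebraically_closed_type TYPE('a)" "N x \<le> 1"
    and "N (coeff w i) \<ge> 1" "N (poly w x) < 1"
  obtains r where "poly w r = 0" "N (x - r) < 1"
proof -
  have "w \<noteq> 0"
    using assms(3) by auto
  then show thesis
    using coeff_le_poly_of_far_roots[OF assms(1,2), of w i] assms(3,4) that by force
qed

end

section \<open>Spans over subrings and finite extensions\<close>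

definition is_subring :: "'a::comm_ring_1 set \<Rightarrow> bool" where
  "is_subring S \<longleftrightarrow> 0 \<in> S \<and> 1 \<in> S \<and>
     (\<forall>x\<in>S. \<forall>y\<in>S. x + y \<in> S \<and> x * y \<in> S) \<and> (\<forall>x\<in>S. - x \<in> S)"

lemma is_subringD:
  assumes "is_subring S"
  shows "0 \<in> S" "1 \<in> S" "x \<in> S \<Longrightarrow> y \<in> S \<Longrightarrow> x + y \<in> S"
    "x \<in> S \<Longrightarrow> y \<in> S \<Longrightarrow> x * y \<in> S" "x \<in> S \<Longrightarrow> - x \<in> S"
  using assms by (auto simp: is_subring_def)

lemma is_subring_diff: "is_subring S \<Longrightarrow> x \<in> S \<Longrightarrow> y \<in> S \<Longrightarrow> x - y \<in> S"
  using is_subringD(3,5)[of S] by (metis diff_conv_add_uminus)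

lemma is_subring_power: "is_subring S \<Longrightarrow> x \<in> S \<Longrightarrow> x ^ n \<in> S"
  by (induction n) (auto intro: is_subringD)

lemma is_subring_sum: "is_subring S \<Longrightarrow> (\<And>i. i \<in> A \<Longrightarrow> f i \<in> S) \<Longrightarrow> sum f A \<in> S"
  by (induction A rule: infinite_finite_induct) (auto intro: is_subringD)

lemma is_subring_of_nat: "is_subring S \<Longrightarrow> of_nat n \<in> S"
  by (induction n) (auto intro: is_subringD)

lemma is_subring_of_int: "is_subring S \<Longrightarrow> of_int n \<in> S"
  by (cases n rule: int_cases2) (auto intro: is_subringD is_subring_of_nat)

lemma is_subfield_imp_subring: "is_subfield K \<Longrightarrow> is_subring K"
  by (auto simp: is_subfield_def is_subring_def)

text \<open>Scalars form only a ring and \<open>B\<close> is a generating set, not a basis: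
  \<open>rat_hull\<close> and \<open>witt_frac\<close> will be used as scalars through their ring
  structure alone.\<close>

definition lspan :: "'a::comm_ring_1 set \<Rightarrow> 'a set \<Rightarrow> 'a set" where
  "lspan S B = {\<Sum>b\<in>B. c b * b | c. \<forall>b\<in>B. c b \<in> S}"

lemma lspanI: "x = (\<Sum>b\<in>B. c b * b) \<Longrightarrow> (\<And>b. b \<in> B \<Longrightarrow> c b \<in> S) \<Longrightarrow> x \<in> lspan S B"
  unfolding lspan_def by blast

lemma lspanE:
  assumes "x \<in> lspan S B"
  obtains c where "x = (\<Sum>b\<in>B. c b * b)" "\<And>b. b \<in> B \<Longrightarrow> c b \<in> S"
  using assms unfolding lspan_def by blast

lemma lspan_mono: "S \<subseteq> S' \<Longrightarrow> lspan S B \<subseteq> lspan S' B"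
  unfolding lspan_def by blast

lemma lspan_0: "is_subring S \<Longrightarrow> 0 \<in> lspan S B"
  by (rule lspanI[where c = "\<lambda>_. 0"]) (auto intro: is_subringD)

lemma lspan_add:
  assumes "is_subring S" "x \<in> lspan S B" "y \<in> lspan S B"
  shows "x + y \<in> lspan S B"
proof -
  obtain c where c: "x = (\<Sum>b\<in>B. c b * b)" "\<And>b. b \<in> B \<Longrightarrow> c b \<in> S"
    using assms(2) by (metis lspanE)
  obtain e where e: "y = (\<Sum>b\<in>B. e b * b)" "\<And>b. b \<in> B \<Longrightarrow> e b \<in> S"
    using assms(3) by (metis lspanE)
  have "x + y = (\<Sum>b\<in>B. (c b + e b) * b)"
    by (simp add: c(1) e(1) sum.distrib distrib_right)
  then show ?thesis
    by (rule lspanI) (intro is_subringD(3)[OF assms(1)] c(2) e(2))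
qed

lemma lspan_scale:
  assumes "is_subring S" "s \<in> S" "x \<in> lspan S B"
  shows "s * x \<in> lspan S B"
proof -
  obtain c where c: "x = (\<Sum>b\<in>B. c b * b)" "\<And>b. b \<in> B \<Longrightarrow> c b \<in> S"
    using assms(3) by (metis lspanE)
  have "s * x = (\<Sum>b\<in>B. (s * c b) * b)"
    by (simp add: c(1) sum_distrib_left mult.assoc)
  then show ?thesis
    by (rule lspanI) (intro is_subringD(4)[OF assms(1)] c(2) assms(2))
qed

lemma lspan_minus: "is_subring S \<Longrightarrow> x \<in> lspan S B \<Longrightarrow> - x \<in> lspan S B"
  using lspan_scale[of S "-1" x B] by (simp add: is_subringD)

lemma lspan_sum: "is_subring S \<Longrightarrow> (\<And>i. i \<in> A \<Longrightarrow> f i \<in> lspan S B) \<Longrightarrow> sum f A \<in> lspan S B"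
  by (induction A rule: infinite_finite_induct) (auto intro: lspan_0 lspan_add)

lemma lspan_base:
  assumes "is_subring S" "finite B" "b \<in> B"
  shows "b \<in> lspan S B"
  by (rule lspanI[where c = "\<lambda>x. if x = b then 1 else 0"])
    (use assms in \<open>auto simp: if_distrib[of "\<lambda>x. x * _"] sum.delta cong: if_cong intro: is_subringD\<close>)

lemma lspan_mult_closed:
  assumes "is_subring S" "\<And>b. b \<in> B \<Longrightarrow> y * b \<in> lspan S B" "x \<in> lspan S B"
  shows "y * x \<in> lspan S B"
proof -
  obtain c where c: "x = (\<Sum>b\<in>B. c b * b)" "\<And>b. b \<in> B \<Longrightarrow> c b \<in> S"
    using assms(3) by (metis lspanE)
  have "y * x = (\<Sum>b\<in>B. c b * (y * b))"
    by (simp add: c sum_distrib_left mult_ac)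
  also have "\<dots> \<in> lspan S B"
    by (intro lspan_sum lspan_scale c(2) assms(1,2))
  finally show ?thesis .
qed

lemma is_subring_lspan:
  assumes S: "is_subring S" and one: "1 \<in> lspan S B"
    and B: "\<And>b c. b \<in> B \<Longrightarrow> c \<in> B \<Longrightarrow> b * c \<in> lspan S B"
  shows "is_subring (lspan S B)"
proof -
  have "x * y \<in> lspan S B" if "x \<in> lspan S B" "y \<in> lspan S B" for x y
  proof (rule lspan_mult_closed[OF S _ that(2)])
    fix b assume "b \<in> B"
    then have "b * x \<in> lspan S B"
      using lspan_mult_closed[OF S _ that(1)] B by blast
    then show "x * b \<in> lspan S B"
      by (simp add: mult.commute)
  qed
  then show ?thesis
    unfolding is_subring_def using one by (blast intro: lspan_0[OF S] lspan_add[OF S] lspan_minus[OF S])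
qed

lemma lspan_trans:
  assumes S: "is_subring S" and fin: "finite B" "finite C"
    and L: "L \<subseteq> lspan K B" and K: "K \<subseteq> lspan S C"
  shows "L \<subseteq> lspan S ((\<lambda>(b, c). b * c) ` (B \<times> C))"
proof
  let ?D = "(\<lambda>(b, c). b * c) ` (B \<times> C)"
  fix x assume "x \<in> L"
  with L have "x \<in> lspan K B"
    by blast
  then obtain c where c: "x = (\<Sum>b\<in>B. c b * b)" "\<And>b. b \<in> B \<Longrightarrow> c b \<in> K"
    by (metis lspanE)
  have kb: "k * b \<in> lspan S ?D" if "k \<in> K" "b \<in> B" for k b
  proof -
    from that K have "k \<in> lspan S C"
      by blast
    then obtain e where e: "k = (\<Sum>b\<in>C. e b * b)" "\<And>b. b \<in> C \<Longrightarrow> e b \<in> S"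
      by (metis lspanE)
    have "k * b = (\<Sum>c\<in>C. e c * (b * c))"
      unfolding e(1) sum_distrib_right by (intro sum.cong) (simp_all add: mult_ac)
    also have "\<dots> \<in> lspan S ?D"
      using that fin by (intro lspan_sum lspan_scale S e lspan_base) auto
    finally show ?thesis .
  qed
  show "x \<in> lspan S ?D"
    unfolding c(1) by (intro lspan_sum[OF S] kb c(2))
qed

text \<open>Fraction-free Gaussian elimination by induction on the equations \<open>B\<close>, with
  unknowns indexed by \<open>I\<close>: rows are cross-multiplied, since elements of
  \<open>S\<close> cannot be inverted inside \<open>S\<close>.\<close>

lemma homogeneous_system_solvable:
  fixes m :: "'i \<Rightarrow> 'b \<Rightarrow> 'a::idom"
  assumes S: "is_subring S" and "finite B" "finite I" "card B < card I"
    and "\<And>i b. i \<in> I \<Longrightarrow> b \<in> B \<Longrightarrow> m i b \<in> S"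
  shows "\<exists>w. (\<forall>i\<in>I. w i \<in> S) \<and> (\<exists>i\<in>I. w i \<noteq> 0) \<and> (\<forall>b\<in>B. (\<Sum>i\<in>I. w i * m i b) = 0)"
  using assms(2-)
proof (induction B arbitrary: I m rule: finite_induct)
  case empty
  then have "I \<noteq> {}"
    by auto
  then show ?case
    by (intro exI[of _ "\<lambda>_. 1"]) (auto intro: is_subringD[OF S])
next
  case (insert b B)
  show ?case
  proof (cases "\<forall>i\<in>I. m i b = 0")
    case True
    obtain w where "\<forall>i\<in>I. w i \<in> S" "\<exists>i\<in>I. w i \<noteq> 0" "\<forall>b\<in>B. (\<Sum>i\<in>I. w i * m i b) = 0"
      using insert.IH[of I m] insert.prems insert.hyps by auto
    then show ?thesis
      using True by (intro exI[of _ w]) auto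
  next
    case False
    then obtain j where j: "j \<in> I" "m j b \<noteq> 0"
      by blast
    define m' where "m' = (\<lambda>i c. m j b * m i c - m i b * m j c)"
    have "\<exists>w. (\<forall>i\<in>I - {j}. w i \<in> S) \<and> (\<exists>i\<in>I - {j}. w i \<noteq> 0)
        \<and> (\<forall>c\<in>B. (\<Sum>i\<in>I - {j}. w i * m' i c) = 0)"
    proof (rule insert.IH)
      show "m' i c \<in> S" if "i \<in> I - {j}" "c \<in> B" for i c
        unfolding m'_def using that insert.prems j
        by (intro is_subring_diff is_subringD(4) S) auto
    qed (use insert.prems insert.hyps j in auto)
    then obtain w where w: "\<forall>i\<in>I - {j}. w i \<in> S" "\<exists>i\<in>I - {j}. w i \<noteq> 0"
      and ws: "\<forall>c\<in>B. (\<Sum>i\<in>I - {j}. w i * m' i c) = 0"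
      by blast
    \<comment> \<open>The other unknowns are scaled by the pivot \<open>m j b\<close>, and the value
      at \<open>j\<close> is chosen so that equation \<open>b\<close> holds identically.\<close>
    define u where "u = (\<lambda>i. if i = j then - (\<Sum>i\<in>I - {j}. w i * m i b) else w i * m j b)"
    have sum_u: "(\<Sum>i\<in>I. u i * f i)
        = (\<Sum>i\<in>I - {j}. w i * (m j b * f i - m i b * f j))" for f
    proof -
      have "(\<Sum>i\<in>I. u i * f i) = u j * f j + (\<Sum>i\<in>I - {j}. u i * f i)"
        using insert.prems j by (simp add: sum.remove)
      also have "(\<Sum>i\<in>I - {j}. u i * f i) = (\<Sum>i\<in>I - {j}. w i * m j b * f i)"
        by (intro sum.cong) (auto simp: u_def)
      also have "u j * f j = - (\<Sum>i\<in>I - {j}. w i * m i b * f j)"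
        by (simp add: u_def sum_distrib_right)
      also have "\<dots> + (\<Sum>i\<in>I - {j}. w i * m j b * f i)
          = (\<Sum>i\<in>I - {j}. w i * m j b * f i - w i * m i b * f j)"
        by (simp add: sum_subtractf)
      finally show ?thesis
        by (simp add: algebra_simps)
    qed
    have "u i \<in> S" if "i \<in> I" for i
      using that w(1) insert.prems j
      by (auto simp: u_def intro!: is_subringD(4,5)[OF S] is_subring_sum S)
    moreover have "\<exists>i\<in>I. u i \<noteq> 0"
      using w(2) j by (auto simp: u_def)
    moreover have "(\<Sum>i\<in>I. u i * m i c) = 0" if "c \<in> insert b B" for c
      unfolding sum_u using that ws by (auto simp: m'_def algebra_simps)
    ultimately show ?thesis
      by blast
  qed
qed

text \<open>Source of all algebraic relations below: it is applied to the powers of one element and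
  to the monomials in two elements.\<close>

lemma lspan_dependent:
  fixes x :: "'i \<Rightarrow> 'a::idom"
  assumes S: "is_subring S" and fin: "finite B" "finite I" "card B < card I"
    and x: "\<And>i. i \<in> I \<Longrightarrow> x i \<in> lspan S B"
  obtains w where "\<And>i. i \<in> I \<Longrightarrow> w i \<in> S" "\<exists>i\<in>I. w i \<noteq> 0" "(\<Sum>i\<in>I. w i * x i) = 0"
proof -
  have "\<forall>i\<in>I. \<exists>c. x i = (\<Sum>b\<in>B. c b * b) \<and> (\<forall>b\<in>B. c b \<in> S)"
    using x by (metis lspanE)
  then obtain m where m: "\<And>i. i \<in> I \<Longrightarrow> x i = (\<Sum>b\<in>B. m i b * b)"
      "\<And>i b. i \<in> I \<Longrightarrow> b \<in> B \<Longrightarrow> m i b \<in> S"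
    by metis
  obtain w where w: "\<forall>i\<in>I. w i \<in> S" "\<exists>i\<in>I. w i \<noteq> 0"
      "\<forall>b\<in>B. (\<Sum>i\<in>I. w i * m i b) = 0"
    using homogeneous_system_solvable[OF S fin, of m] m(2) by blast
  have "(\<Sum>i\<in>I. w i * x i) = (\<Sum>i\<in>I. \<Sum>b\<in>B. w i * m i b * b)"
    by (intro sum.cong) (auto simp: m(1) sum_distrib_left mult.assoc)
  also have "\<dots> = (\<Sum>b\<in>B. (\<Sum>i\<in>I. w i * m i b) * b)"
    by (subst sum.swap) (simp add: sum_distrib_right)
  also have "\<dots> = 0"
    using w(3) by simp
  finally show thesis
    using that w by blast
qed

text \<open>The powers of \<open>y\<close> up to \<open>card B\<close> are dependent over
  \<open>K\<close>; after cancelling the lowest occurring power, the relation has an invertible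
  constant term and displays \<open>inverse y\<close>.\<close>

lemma is_subfield_lspan:
  fixes K :: "'a::field set"
  assumes K: "is_subfield K" and fin: "finite B" and ring: "is_subring (lspan K B)"
    and KL: "K \<subseteq> lspan K B"
  shows "is_subfield (lspan K B)"
proof -
  let ?L = "lspan K B"
  have Kr: "is_subring K"
    by (rule is_subfield_imp_subring[OF K])
  have "inverse y \<in> ?L" if y: "y \<in> ?L" "y \<noteq> 0" for y
  proof -
    obtain w where w: "\<And>i. i \<in> {..card B} \<Longrightarrow> w i \<in> K" "\<exists>i\<in>{..card B}. w i \<noteq> 0"
      and ws: "(\<Sum>i\<in>{..card B}. w i * y ^ i) = 0"
      by (rule lspan_dependent[OF Kr fin, of "{..card B}" "\<lambda>i. y ^ i"])
        (use is_subring_power[OF ring y(1)] in auto)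
    \<comment> \<open>Taking the lowest nonzero coefficient allows the factor \<open>y ^ j\<close>
      to be cancelled.\<close>
    define j where "j = (LEAST i. i \<le> card B \<and> w i \<noteq> 0)"
    have j: "j \<le> card B \<and> w j \<noteq> 0"
      unfolding j_def by (rule LeastI_ex) (use w(2) in auto)
    have less: "w i = 0" if "i < j" for i
      using that not_less_Least[of i "\<lambda>i. i \<le> card B \<and> w i \<noteq> 0"] j unfolding j_def by auto
    define s where "s = (\<Sum>i\<in>{Suc j..card B}. w i * y ^ (i - Suc j))"
    have "(\<Sum>i\<in>{..card B}. w i * y ^ i) = (\<Sum>i\<in>{j..card B}. w i * y ^ i)"
      by (rule sum.mono_neutral_right) (auto simp: less)
    also have "\<dots> = w j * y ^ j + (\<Sum>i\<in>{Suc j..card B}. w i * y ^ i)"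
      using j by (simp add: sum.atLeast_Suc_atMost)
    also have "(\<Sum>i\<in>{Suc j..card B}. w i * y ^ i)
        = (\<Sum>i\<in>{Suc j..card B}. y ^ j * y * (w i * y ^ (i - Suc j)))"
    proof (intro sum.cong refl)
      fix i assume "i \<in> {Suc j..card B}"
      then have "y ^ i = y ^ (j + 1 + (i - Suc j))"
        by simp
      also have "\<dots> = y ^ j * y * y ^ (i - Suc j)"
        by (simp only: power_add power_one_right)
      finally show "w i * y ^ i = y ^ j * y * (w i * y ^ (i - Suc j))"
        by simp
    qed
    also have "\<dots> = y ^ j * y * s"
      by (simp only: s_def sum_distrib_left)
    finally have "y ^ j * (w j + y * s) = 0"
      using ws by (simp add: algebra_simps)
    then have eq: "w j + y * s = 0"
      using y by simp
    have "inverse y = - inverse (w j) * s"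
    proof (rule inverse_unique)
      have "y * (- inverse (w j) * s) = - inverse (w j) * (y * s)"
        by (simp add: mult_ac)
      also have "y * s = - w j"
        using eq by (simp add: add_eq_0_iff)
      finally show "y * (- inverse (w j) * s) = 1"
        using j by simp
    qed
    moreover have "- inverse (w j) \<in> K"
      using K w(1) j unfolding is_subfield_def by auto
    moreover have "s \<in> ?L"
      unfolding s_def by (intro lspan_sum lspan_scale Kr w is_subring_power ring y) auto
    ultimately show ?thesis
      using lspan_scale[OF Kr, of "- inverse (w j)" s B] by (simp add: K)
  qed
  then have "\<forall>y\<in>?L. inverse y \<in> ?L"
    using is_subringD(1)[OF ring] by (metis inverse_zero)
  then show ?thesis
    using ring by (auto simp: is_subfield_def is_subring_def)
qed

lemma power_in_lspan_powers:
  assumes S: "is_subring S" and n: "r ^ n \<in> lspan S ((\<lambda>i. r ^ i) ` {..<n})" "0 < n"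
  shows "r ^ k \<in> lspan S ((\<lambda>i. r ^ i) ` {..<n})"
proof (induction k)
  case 0
  show ?case
    using n by (intro lspan_base S) (auto intro!: image_eqI[of _ _ 0])
next
  case (Suc k)
  show ?case
    unfolding power_Suc
  proof (rule lspan_mult_closed[OF S _ Suc.IH])
    fix b assume "b \<in> (\<lambda>i. r ^ i) ` {..<n}"
    then obtain i where "i < n" "b = r ^ i"
      by auto
    then show "r * b \<in> lspan S ((\<lambda>i. r ^ i) ` {..<n})"
      using n S by (cases "Suc i = n") (auto intro!: lspan_base imageI simp flip: power_Suc)
  qed
qed

lemma finite_extension_adjoin:
  fixes K :: "'a::field set"
  assumes K: "is_subfield K" and n: "r ^ n \<in> lspan K ((\<lambda>i. r ^ i) ` {..<n})" "0 < n"
  shows "finite_extension K (lspan K ((\<lambda>i. r ^ i) ` {..<n}))"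
proof -
  let ?B = "(\<lambda>i. r ^ i) ` {..<n}" and ?L = "lspan K ((\<lambda>i. r ^ i) ` {..<n})"
  have Kr: "is_subring K"
    by (rule is_subfield_imp_subring[OF K])
  have pow: "r ^ k \<in> ?L" for k
    by (rule power_in_lspan_powers[OF Kr n])
  have ring: "is_subring ?L"
    by (rule is_subring_lspan[OF Kr]) (use pow[of 0] pow in \<open>auto simp flip: power_add\<close>)
  have KL: "K \<subseteq> ?L"
    using lspan_scale[OF Kr _ pow[of 0]] by auto
  have "is_subfield ?L"
    by (rule is_subfield_lspan[OF K _ ring KL]) auto
  moreover have "?B \<subseteq> ?L"
    using pow by auto
  then have "finite_dim_over K ?L"
    unfolding finite_dim_over_def using KL by (intro conjI exI[of _ ?B]) (auto simp: lspan_def)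
  ultimately show ?thesis
    by (simp add: finite_extension_def)
qed

lemma finite_extensionE:
  assumes "finite_extension F L"
  obtains B where "finite B" "L = lspan F B" "F \<subseteq> L" "is_subfield L"
  using assms unfolding finite_extension_def finite_dim_over_def lspan_def by blast

lemma algebraic_power_in_lspan:
  fixes K :: "'a::field set"
  assumes K: "is_subfield K" and q: "q \<noteq> 0" "\<And>i. coeff q i \<in> K" "poly q x = 0"
  obtains n where "0 < n" "x ^ n \<in> lspan K ((\<lambda>i. x ^ i) ` {..<n})"
proof
  have Kr: "is_subring K"
    by (rule is_subfield_imp_subring[OF K])
  let ?n = "degree q"
  show pos: "0 < ?n"
    using q(1,3) by (cases "degree q = 0") (auto elim!: degree_eq_zeroE)
  let ?c = "\<lambda>i. - inverse (lead_coeff q) * coeff q i"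
  have c: "?c i \<in> K" for i
    using K q(2) by (auto simp: is_subfield_def)
  have "0 = (\<Sum>i\<le>?n. coeff q i * x ^ i)"
    using q(3) by (simp add: poly_altdef)
  also have "\<dots> = (\<Sum>i<?n. coeff q i * x ^ i) + lead_coeff q * x ^ ?n"
    by (simp add: lessThan_Suc_atMost[symmetric])
  finally have "x ^ ?n = - inverse (lead_coeff q) * (\<Sum>i<?n. coeff q i * x ^ i)"
    using q(1) by (simp add: field_simps eq_neg_iff_add_eq_0)
  also have "\<dots> = (\<Sum>i<?n. ?c i * x ^ i)"
    by (simp add: sum_distrib_left mult.assoc)
  also have "\<dots> \<in> lspan K ((\<lambda>i. x ^ i) ` {..<?n})"
    by (intro lspan_sum lspan_scale Kr c lspan_base) auto
  finally show "x ^ ?n \<in> lspan K ((\<lambda>i. x ^ i) ` {..<?n})" .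
qed

section \<open>Extending partial isomorphisms to automorphisms\<close>

text \<open>An isomorphism between two subrings, given by its graph. Requiring only
  \<open>a = 0 \<longleftrightarrow> b = 0\<close> on a subring of the product makes the graph functional and injective
  and keeps the notion symmetric in the two factors.\<close>

definition partial_iso :: "('a::field \<times> 'a) set \<Rightarrow> bool" where
  "partial_iso G \<longleftrightarrow> (0, 0) \<in> G \<and> (1, 1) \<in> G \<and>
     (\<forall>a b c e. (a, b) \<in> G \<longrightarrow> (c, e) \<in> G \<longrightarrow> (a + c, b + e) \<in> G \<and> (a * c, b * e) \<in> G) \<and>
     (\<forall>a b. (a, b) \<in> G \<longrightarrow> (- a, - b) \<in> G) \<and>
     (\<forall>a b. (a, b) \<in> G \<longrightarrow> (a = 0 \<longleftrightarrow> b = 0))"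

definition poly_pair :: "('a::field \<times> 'a) set \<Rightarrow> 'a poly \<Rightarrow> 'a poly \<Rightarrow> bool" where
  "poly_pair G p q \<longleftrightarrow> (\<forall>i. (coeff p i, coeff q i) \<in> G)"

text \<open>Graph of the candidate extension sending \<open>x\<close> to \<open>y\<close>. As a
  relation it can be written down before it is known to be functional.\<close>

definition adjoin :: "('a::field \<times> 'a) set \<Rightarrow> 'a \<Rightarrow> 'a \<Rightarrow> ('a \<times> 'a) set" where
  "adjoin G x y = {(poly p x, poly q y) | p q. poly_pair G p q}"

lemma partial_isoD:
  assumes "partial_iso G"
  shows "(0, 0) \<in> G" "(1, 1) \<in> G"
    "(a, b) \<in> G \<Longrightarrow> (c, e) \<in> G \<Longrightarrow> (a + c, b + e) \<in> G"
    "(a, b) \<in> G \<Longrightarrow> (c, e) \<in> G \<Longrightarrow> (a * c, b * e) \<in> G"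
    "(a, b) \<in> G \<Longrightarrow> (- a, - b) \<in> G"
    "(a, b) \<in> G \<Longrightarrow> a = 0 \<longleftrightarrow> b = 0"
proof -
  note h = assms[unfolded partial_iso_def]
  show "(0, 0) \<in> G" "(1, 1) \<in> G"
    by (rule h[THEN conjunct1], rule h[THEN conjunct2, THEN conjunct1])
  show "(a, b) \<in> G \<Longrightarrow> (c, e) \<in> G \<Longrightarrow> (a + c, b + e) \<in> G"
    by (rule h[THEN conjunct2, THEN conjunct2, THEN conjunct1, rule_format, THEN conjunct1])
  show "(a, b) \<in> G \<Longrightarrow> (c, e) \<in> G \<Longrightarrow> (a * c, b * e) \<in> G"
    by (rule h[THEN conjunct2, THEN conjunct2, THEN conjunct1, rule_format, THEN conjunct2])
  show "(a, b) \<in> G \<Longrightarrow> (- a, - b) \<in> G"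
    by (rule h[THEN conjunct2, THEN conjunct2, THEN conjunct2, THEN conjunct1, rule_format])
  show "(a, b) \<in> G \<Longrightarrow> a = 0 \<longleftrightarrow> b = 0"
    by (rule h[THEN conjunct2, THEN conjunct2, THEN conjunct2, THEN conjunct2, rule_format])
qed

lemma partial_isoI:
  assumes "(0, 0) \<in> G" "(1, 1) \<in> G"
    and "\<And>a b c e. (a, b) \<in> G \<Longrightarrow> (c, e) \<in> G \<Longrightarrow> (a + c, b + e) \<in> G"
    and "\<And>a b c e. (a, b) \<in> G \<Longrightarrow> (c, e) \<in> G \<Longrightarrow> (a * c, b * e) \<in> G"
    and "\<And>a b. (a, b) \<in> G \<Longrightarrow> (- a, - b) \<in> G"
    and "\<And>a b. (a, b) \<in> G \<Longrightarrow> a = 0 \<longleftrightarrow> b = 0"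
  shows "partial_iso G"
  unfolding partial_iso_def
  by (intro conjI allI impI, rule assms(1), rule assms(2), erule (1) assms(3),
      erule (1) assms(4), erule assms(5), erule assms(6))

lemma adjoinI: "poly_pair G p q \<Longrightarrow> a = poly p x \<Longrightarrow> b = poly q y \<Longrightarrow> (a, b) \<in> adjoin G x y"
  unfolding adjoin_def by blast

lemma adjoinE:
  assumes "(a, b) \<in> adjoin G x y"
  obtains p q where "poly_pair G p q" "a = poly p x" "b = poly q y"
  using assms unfolding adjoin_def by blast

lemma partial_iso_diff:
  "partial_iso G \<Longrightarrow> (a, b) \<in> G \<Longrightarrow> (c, e) \<in> G \<Longrightarrow> (a - c, b - e) \<in> G"
  using partial_isoD(3)[of G a b "- c" "- e"] partial_isoD(5)[of G c e] by simp

lemma partial_iso_converse: "partial_iso G \<Longrightarrow> partial_iso (G\<inverse>)"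
  unfolding partial_iso_def by auto

lemma poly_pair_converse: "poly_pair (G\<inverse>) q p \<longleftrightarrow> poly_pair G p q"
  by (simp add: poly_pair_def)

section \<open>Division with remainder along a partial isomorphism\<close>

context
  fixes G :: "('a::field \<times> 'a) set"
  assumes G: "partial_iso G"
begin

lemma poly_pair_eq_0: "poly_pair G p q \<Longrightarrow> p = 0 \<longleftrightarrow> q = 0"
  unfolding poly_pair_def poly_eq_iff using partial_isoD(6)[OF G] by fastforce

lemma poly_pair_degree:
  assumes "poly_pair G p q"
  shows "degree p = degree q"
proof -
  have "coeff p i = 0 \<longleftrightarrow> coeff q i = 0" for i
    using assms partial_isoD(6)[OF G] by (simp add: poly_pair_def)
  then show ?thesis
    by (simp add: degree_def)
qed

lemma poly_pair_0: "poly_pair G 0 0"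
  by (simp add: poly_pair_def partial_isoD[OF G])

lemma poly_pair_add: "poly_pair G p q \<Longrightarrow> poly_pair G p' q' \<Longrightarrow> poly_pair G (p + p') (q + q')"
  by (simp add: poly_pair_def partial_isoD(3)[OF G])

lemma poly_pair_minus: "poly_pair G p q \<Longrightarrow> poly_pair G (- p) (- q)"
  by (simp add: poly_pair_def partial_isoD(5)[OF G])

lemma poly_pair_diff: "poly_pair G p q \<Longrightarrow> poly_pair G p' q' \<Longrightarrow> poly_pair G (p - p') (q - q')"
  by (simp add: poly_pair_def partial_iso_diff[OF G])

lemma poly_pair_smult: "(a, b) \<in> G \<Longrightarrow> poly_pair G p q \<Longrightarrow> poly_pair G (smult a p) (smult b q)"
  by (simp add: poly_pair_def partial_isoD(4)[OF G])

lemma partial_iso_sum: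
  "(\<And>i. i \<in> A \<Longrightarrow> (f i, g i) \<in> G) \<Longrightarrow> (sum f A, sum g A) \<in> G"
  by (induction A rule: infinite_finite_induct) (auto intro: partial_isoD[OF G])

lemma poly_pair_mult: "poly_pair G p q \<Longrightarrow> poly_pair G p' q' \<Longrightarrow> poly_pair G (p * p') (q * q')"
  unfolding poly_pair_def coeff_mult
  by (intro allI partial_iso_sum partial_isoD(4)[OF G]) auto

lemma poly_pair_monom: "(a, b) \<in> G \<Longrightarrow> poly_pair G (monom a n) (monom b n)"
  by (simp add: poly_pair_def partial_isoD[OF G])

text \<open>The division runs on both sides of the isomorphism in parallel. Coefficients lie in a
  ring, so each step multiplies by the leading coefficient of the divisor, and these factors
  accumulate in \<open>c\<close> and \<open>c'\<close>.\<close>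

lemma poly_pair_pseudo_divide:
  assumes "poly_pair G p q" and gh: "poly_pair G g h" "g \<noteq> 0"
  shows "\<exists>c c' s s' r r'. (c, c') \<in> G \<and> c \<noteq> 0 \<and> poly_pair G s s' \<and> poly_pair G r r' \<and>
    smult c p = s * g + r \<and> smult c' q = s' * h + r' \<and> (r = 0 \<or> degree r < degree g)"
  using assms(1)
\<comment> \<open>The measure separates 0 from nonzero constants, which have the same
  \<open>degree\<close>; a constant divisor needs one more step to reach remainder 0.\<close>
proof (induction "if p = 0 then 0 else Suc (degree p)" arbitrary: p q rule: less_induct)
  case less
  show ?case
  proof (cases "p = 0 \<or> degree p < degree g")
    case True
    then show ?thesis
      using less.prems
      by (intro exI[of _ 1] exI[of _ 0] exI[of _ p] exI[of _ q])
        (auto simp: poly_pair_0 partial_isoD[OF G])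
  next
    case False
    define n where "n = degree p - degree g"
    define p1 where "p1 = smult (lead_coeff g) p - monom (lead_coeff p) n * g"
    define q1 where "q1 = smult (lead_coeff h) q - monom (lead_coeff q) n * h"
    have lg: "(lead_coeff g, lead_coeff h) \<in> G" and lp: "(lead_coeff p, lead_coeff q) \<in> G"
      using less.prems gh(1) poly_pair_degree by (auto simp: poly_pair_def)
    have pair1: "poly_pair G p1 q1"
      unfolding p1_def q1_def
      by (intro poly_pair_diff poly_pair_smult poly_pair_mult poly_pair_monom lg lp less.prems gh)
    have "degree (monom (lead_coeff p) n * g) = degree p"
      using False gh(2) by (subst degree_mult_eq) (auto simp: n_def degree_monom_eq)
    then have "degree p1 \<le> degree p"
      unfolding p1_def by (intro degree_diff_le) auto
    moreover have "coeff p1 (degree p) = 0"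
      using False by (simp add: p1_def n_def coeff_monom_mult)
    ultimately have small: "p1 = 0 \<or> degree p1 < degree p"
      by (metis leading_coeff_0_iff le_neq_implies_less)
    have "(if p1 = 0 then 0 else Suc (degree p1)) < (if p = 0 then 0 else Suc (degree p))"
      using small False by auto
    from less.hyps[OF this pair1]
    obtain c c' s s' r r' where *: "(c, c') \<in> G" "c \<noteq> 0" "poly_pair G s s'" "poly_pair G r r'"
      "smult c p1 = s * g + r" "smult c' q1 = s' * h + r'" "r = 0 \<or> degree r < degree g"
      by blast
    let ?s = "s + monom (c * lead_coeff p) n" and ?s' = "s' + monom (c' * lead_coeff q) n"
    have "smult (c * lead_coeff g) p = smult c p1 + monom (c * lead_coeff p) n * g"
      by (simp add: p1_def smult_diff_right smult_monom flip: mult_smult_left)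
    then have "smult (c * lead_coeff g) p = ?s * g + r"
      by (simp add: * algebra_simps)
    moreover have "smult (c' * lead_coeff h) q = smult c' q1 + monom (c' * lead_coeff q) n * h"
      by (simp add: q1_def smult_diff_right smult_monom flip: mult_smult_left)
    then have "smult (c' * lead_coeff h) q = ?s' * h + r'"
      by (simp add: * algebra_simps)
    moreover have "(c * lead_coeff g, c' * lead_coeff h) \<in> G" "c * lead_coeff g \<noteq> 0"
      using *(1,2) lg gh(2) partial_isoD(4)[OF G] by auto
    moreover have "poly_pair G ?s ?s'"
      by (intro poly_pair_add poly_pair_monom * partial_isoD(4)[OF G] lp)
    ultimately show ?thesis
      using *(4,7) by blast
  qed
qed

text \<open>By minimality \<open>g\<close> divides \<open>p\<close> up to a nonzero scalar. The
  remainder vanishes on both sides at once, so \<open>h\<close> divides \<open>q\<close> up to a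
  scalar.\<close>

lemma poly_pair_root_transfer:
  assumes gh: "poly_pair G g h" "g \<noteq> 0" "poly g x = 0" "poly h y = 0"
    and min: "\<And>p q. poly_pair G p q \<Longrightarrow> p \<noteq> 0 \<Longrightarrow> poly p x = 0 \<Longrightarrow> degree g \<le> degree p"
    and pq: "poly_pair G p q" "poly p x = 0"
  shows "poly q y = 0"
proof -
  obtain c c' s s' r r' where *: "(c, c') \<in> G" "c \<noteq> 0" "poly_pair G s s'" "poly_pair G r r'"
    "smult c p = s * g + r" "smult c' q = s' * h + r'" "r = 0 \<or> degree r < degree g"
    using poly_pair_pseudo_divide[OF pq(1) gh(1,2)] by blast
  have "poly (smult c p) x = poly (s * g + r) x"
    by (simp only: *)
  then have "poly r x = 0"
    using pq gh by simp
  then have "r = 0"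
    using min[OF *(4)] *(7) by force
  then have "r' = 0"
    using poly_pair_eq_0[OF *(4)] by simp
  then have "poly (smult c' q) y = 0"
    using gh by (simp add: *)
  then show ?thesis
    using *(1,2) partial_isoD(6)[OF G] by auto
qed

text \<open>Needed to transfer roots backwards. A polynomial \<open>q0\<close> of least degree
  vanishing at \<open>y\<close> divides \<open>h\<close> up to a scalar; on the other side
  \<open>g\<close> factors, up to a scalar, as \<open>s * p0\<close>, and one factor vanishes at
  \<open>x\<close>. Minimality of \<open>g\<close> excludes \<open>s\<close>, because
  \<open>p0\<close> is not constant.\<close>

lemma poly_pair_minimal_transfer:
  assumes gh: "poly_pair G g h" "g \<noteq> 0" "poly g x = 0" "poly h y = 0"
    and min: "\<And>p q. poly_pair G p q \<Longrightarrow> p \<noteq> 0 \<Longrightarrow> poly p x = 0 \<Longrightarrow> degree g \<le> degree p"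
    and pq: "poly_pair G p q" "q \<noteq> 0" "poly q y = 0"
  shows "degree h \<le> degree q"
proof -
  define P where "P = (\<lambda>n. \<exists>p q. poly_pair G p q \<and> q \<noteq> 0 \<and> poly q y = 0 \<and> degree q = n)"
  have "P (degree q)"
    using pq by (auto simp: P_def)
  then have "P (LEAST n. P n)" and least: "(LEAST n. P n) \<le> degree q"
    by (rule LeastI, rule Least_le)
  then obtain p0 q0 where 0: "poly_pair G p0 q0" "q0 \<noteq> 0" "poly q0 y = 0"
    "degree q0 = (LEAST n. P n)"
    by (auto simp: P_def)
  have p0: "p0 \<noteq> 0"
    using poly_pair_eq_0[OF 0(1)] 0(2) by simp
  obtain c c' s s' r r' where *: "(c, c') \<in> G" "c \<noteq> 0" "poly_pair G s s'" "poly_pair G r r'"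
    "smult c g = s * p0 + r" "smult c' h = s' * q0 + r'" "r = 0 \<or> degree r < degree p0"
    using poly_pair_pseudo_divide[OF gh(1) 0(1) p0] by blast
  have "poly (smult c' h) y = poly (s' * q0 + r') y"
    by (simp only: *)
  then have "poly r' y = 0"
    using 0 gh by simp
  then have "r' = 0 \<or> P (degree r')"
    using *(4) by (auto simp: P_def)
  then have "r = 0"
    using *(7) 0(4) Least_le[of P "degree r'"] poly_pair_eq_0[OF *(4)]
      poly_pair_degree[OF *(4)] poly_pair_degree[OF 0(1)] by auto
  then have eq: "smult c g = s * p0"
    using * by simp
  then have s: "s \<noteq> 0"
    using gh(2) *(2) by auto
  have "degree g = degree s + degree p0"
    using arg_cong[OF eq, of degree] s p0 *(2) by (simp add: degree_mult_eq)
  moreover have "poly s x * poly p0 x = 0"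
    using arg_cong[OF eq, of "\<lambda>u. poly u x"] gh by simp
  then have "degree g \<le> degree p0 \<or> degree g \<le> degree s"
    using min[OF 0(1) p0] min[OF *(3) s] by auto
  moreover have "degree p0 \<noteq> 0"
  proof
    assume "degree p0 = 0"
    then obtain c where "q0 = [:c:]"
      using poly_pair_degree[OF 0(1)] by (metis degree_eq_zeroE)
    then show False
      using 0(2,3) by simp
  qed
  ultimately have "degree g \<le> degree p0"
    by auto
  then show ?thesis
    using least 0(4) poly_pair_degree[OF 0(1)] poly_pair_degree[OF gh(1)] by simp
qed

end

text \<open>Only the zero test needs an argument: one direction is the root transfer for
  \<open>G\<close>, the other the root transfer for the converse of \<open>G\<close>.\<close>

lemma partial_iso_adjoin:
  assumes G: "partial_iso G"
    and gh: "poly_pair G g h" "g \<noteq> 0" "poly g x = 0" "poly h y = 0"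
    and min: "\<And>p q. poly_pair G p q \<Longrightarrow> p \<noteq> 0 \<Longrightarrow> poly p x = 0 \<Longrightarrow> degree g \<le> degree p"
  shows "partial_iso (adjoin G x y)"
proof -
  have G': "partial_iso (G\<inverse>)"
    by (rule partial_iso_converse[OF G])
  have zero: "poly p x = 0 \<longleftrightarrow> poly q y = 0" if "poly_pair G p q" for p q
  proof
    show "poly q y = 0" if "poly p x = 0"
      by (rule poly_pair_root_transfer[OF G gh min \<open>poly_pair G p q\<close> that])
    show "poly p x = 0" if "poly q y = 0"
    proof (rule poly_pair_root_transfer[OF G', of h g y x q p])
      show "degree h \<le> degree p'" if "poly_pair (G\<inverse>) p' q'" "p' \<noteq> 0" "poly p' y = 0" for p' q'
        using poly_pair_minimal_transfer[OF G gh min, where p = q' and q = p'] that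
        by (simp add: poly_pair_converse)
    qed (use gh that \<open>poly_pair G p q\<close> poly_pair_eq_0[OF G gh(1)] in \<open>simp_all add: poly_pair_converse\<close>)
  qed
  show ?thesis
  proof (rule partial_isoI)
    show "(0, 0) \<in> adjoin G x y"
      by (rule adjoinI[OF poly_pair_0[OF G]]) auto
    show "(1, 1) \<in> adjoin G x y"
      by (rule adjoinI[OF poly_pair_monom[OF G partial_isoD(2)[OF G], of 0]]) (auto simp: poly_monom)
  next
    fix a b c e assume ab: "(a, b) \<in> adjoin G x y" and ce: "(c, e) \<in> adjoin G x y"
    obtain p q where pq: "poly_pair G p q" "a = poly p x" "b = poly q y"
      by (rule adjoinE[OF ab])
    obtain p' q' where pq': "poly_pair G p' q'" "c = poly p' x" "e = poly q' y"
      by (rule adjoinE[OF ce])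
    show "(a + c, b + e) \<in> adjoin G x y"
      by (rule adjoinI[OF poly_pair_add[OF G pq(1) pq'(1)]]) (auto simp: pq pq')
    show "(a * c, b * e) \<in> adjoin G x y"
      by (rule adjoinI[OF poly_pair_mult[OF G pq(1) pq'(1)]]) (auto simp: pq pq')
  next
    fix a b assume ab: "(a, b) \<in> adjoin G x y"
    obtain p q where pq: "poly_pair G p q" "a = poly p x" "b = poly q y"
      by (rule adjoinE[OF ab])
    show "(- a, - b) \<in> adjoin G x y"
      by (rule adjoinI[OF poly_pair_minus[OF G pq(1)]]) (auto simp: pq)
    show "a = 0 \<longleftrightarrow> b = 0"
      using zero[OF pq(1)] pq(2,3) by simp
  qed
qed

lemma adjoin_superset:
  assumes G: "partial_iso G"
  shows "G \<subseteq> adjoin G x y"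
proof
  fix z assume "z \<in> G"
  then have "poly_pair G (monom (fst z) 0) (monom (snd z) 0)"
    by (intro poly_pair_monom[OF G]) simp
  then show "z \<in> adjoin G x y"
    by (cases z) (auto simp: poly_monom intro: adjoinI)
qed

lemma adjoin_generator:
  assumes "partial_iso G"
  shows "(x, y) \<in> adjoin G x y"
  by (rule adjoinI[OF poly_pair_monom[OF assms partial_isoD(2)[OF assms], of 1]])
    (auto simp: poly_monom)

lemma minimal_poly_pair:
  assumes "algebraic_over K" "\<And>k. k \<in> K \<Longrightarrow> (k, k) \<in> G"
  shows "\<exists>g h. poly_pair G g h \<and> g \<noteq> 0 \<and> poly g x = 0 \<and>
    (\<forall>p q. poly_pair G p q \<longrightarrow> p \<noteq> 0 \<longrightarrow> poly p x = 0 \<longrightarrow> degree g \<le> degree p)"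
proof -
  define P where "P = (\<lambda>n. \<exists>p q. poly_pair G p q \<and> p \<noteq> 0 \<and> poly p x = 0 \<and> degree p = n)"
  obtain p where p: "p \<noteq> 0" "\<forall>i. coeff p i \<in> K" "poly p x = 0"
    using assms(1) unfolding algebraic_over_def by blast
  then have "P (degree p)"
    unfolding P_def using assms(2) by (auto simp: poly_pair_def)
  then have "P (LEAST n. P n)"
    by (rule LeastI)
  then obtain g h where "poly_pair G g h" "g \<noteq> 0" "poly g x = 0" "degree g = (LEAST n. P n)"
    unfolding P_def by blast
  moreover have "(LEAST n. P n) \<le> degree p" if "poly_pair G p q" "p \<noteq> 0" "poly p x = 0" for p q
    by (rule Least_le) (use that in \<open>auto simp: P_def\<close>)
  ultimately show ?thesis
    by metis
qed

lemma partial_iso_maximal_Domain: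
  fixes G :: "('a::field \<times> 'a) set"
  assumes ac: "algebraically_closed_type TYPE('a)"
    and K: "algebraic_over K" "\<And>k. k \<in> K \<Longrightarrow> (k, k) \<in> G"
    and G: "partial_iso G" and max: "\<And>G'. partial_iso G' \<Longrightarrow> G \<subseteq> G' \<Longrightarrow> G' = G"
  shows "x \<in> Domain G"
proof -
  obtain g h where gh: "poly_pair G g h" "g \<noteq> 0" "poly g x = 0"
    and min: "\<And>p q. poly_pair G p q \<Longrightarrow> p \<noteq> 0 \<Longrightarrow> poly p x = 0 \<Longrightarrow> degree g \<le> degree p"
    using minimal_poly_pair[OF K, of x] by blast
  have "degree g \<noteq> 0"
  proof
    assume "degree g = 0"
    then obtain c where "g = [:c:]"
      by (metis degree_eq_zeroE)
    then show False
      using gh(2,3) by simp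
  qed
  then obtain y where y: "poly h y = 0"
    using ac poly_pair_degree[OF G gh(1)] unfolding algebraically_closed_type_def
    by (metis One_nat_def Suc_leI bot_nat_0.not_eq_extremum)
  have "partial_iso (adjoin G x y)"
    by (rule partial_iso_adjoin[OF G gh y min])
  then have "adjoin G x y = G"
    using max adjoin_superset[OF G] by blast
  then show ?thesis
    using adjoin_generator[OF G] by blast
qed

text \<open>Zorn's lemma gives a maximal extension \<open>M\<close>, which is total because a new
  element could otherwise be adjoined. The converse of \<open>M\<close> is maximal too, and its
  totality is surjectivity of \<open>M\<close>.\<close>

lemma partial_iso_extension:
  fixes G :: "('a::field \<times> 'a) set"
  assumes ac: "algebraically_closed_type TYPE('a)"
    and K: "algebraic_over K" "\<And>k. k \<in> K \<Longrightarrow> (k, k) \<in> G"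
    and G: "partial_iso G"
  obtains G' where "partial_iso G'" "G \<subseteq> G'" "Domain G' = UNIV" "Range G' = UNIV"
proof -
  define A where "A = {G'. partial_iso G' \<and> G \<subseteq> G'}"
  have "\<exists>M\<in>A. \<forall>X\<in>A. M \<subseteq> X \<longrightarrow> X = M"
  proof (rule subset_Zorn_nonempty)
    show "A \<noteq> {}"
      using G by (auto simp: A_def)
    fix C assume C: "C \<noteq> {}" "subset.chain A C"
    then have iso: "partial_iso X" "G \<subseteq> X" if "X \<in> C" for X
      using that by (auto simp: A_def subset.chain_def)
    have two: "\<exists>X\<in>C. a \<in> X \<and> b \<in> X" if "a \<in> \<Union>C" "b \<in> \<Union>C" for a b
    proof -
      obtain X Y where XY: "X \<in> C" "a \<in> X" "Y \<in> C" "b \<in> Y"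
        using \<open>a \<in> \<Union>C\<close> \<open>b \<in> \<Union>C\<close> by (elim UnionE)
      then have "X \<subseteq> Y \<or> Y \<subseteq> X"
        using C(2) by (simp add: subset_chain_def)
      with XY show ?thesis
        by (elim disjE) (auto intro: bexI[of _ X] bexI[of _ Y])
    qed
    have "partial_iso (\<Union>C)"
    proof (rule partial_isoI)
      obtain X where X: "X \<in> C"
        using C(1) by auto
      show "(0, 0) \<in> \<Union>C" "(1, 1) \<in> \<Union>C"
        by (rule UnionI[OF X], rule partial_isoD[OF iso(1)[OF X]])+
    next
      fix a b c e assume ab: "(a, b) \<in> \<Union>C" "(c, e) \<in> \<Union>C"
      obtain X where X: "X \<in> C" "(a, b) \<in> X" "(c, e) \<in> X"
        using two[OF ab] by (elim bexE conjE)
      show "(a + c, b + e) \<in> \<Union>C"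
        by (rule UnionI[OF X(1)], rule partial_isoD(3)[OF iso(1)[OF X(1)] X(2,3)])
      show "(a * c, b * e) \<in> \<Union>C"
        by (rule UnionI[OF X(1)], rule partial_isoD(4)[OF iso(1)[OF X(1)] X(2,3)])
    next
      fix a b assume ab: "(a, b) \<in> \<Union>C"
      obtain X where X: "X \<in> C" "(a, b) \<in> X"
        using ab by (elim UnionE)
      show "(- a, - b) \<in> \<Union>C"
        by (rule UnionI[OF X(1)], rule partial_isoD(5)[OF iso(1)[OF X(1)] X(2)])
      show "a = 0 \<longleftrightarrow> b = 0"
        by (rule partial_isoD(6)[OF iso(1)[OF X(1)] X(2)])
    qed
    then show "\<Union>C \<in> A"
      using iso(2) C(1) by (auto simp: A_def)
  qed
  then obtain M where MA: "M \<in> A" and maxA: "\<forall>X\<in>A. M \<subseteq> X \<longrightarrow> X = M"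
    by (elim bexE)
  then have M: "partial_iso M" "G \<subseteq> M"
    by (simp_all add: A_def)
  have max: "X = M" if "partial_iso X" "M \<subseteq> X" for X
    using maxA that order_trans[OF M(2) that(2)] by (simp add: A_def)
  have KM: "(k, k) \<in> M" if "k \<in> K" for k
    using K(2)[OF that] M(2) by (rule subsetD[rotated])
  have "x \<in> Domain M" for x
    by (rule partial_iso_maximal_Domain[OF ac K(1) KM M(1) max])
  moreover have "x \<in> Domain (M\<inverse>)" for x
  proof (rule partial_iso_maximal_Domain[OF ac K(1)])
    show "(k, k) \<in> M\<inverse>" if "k \<in> K" for k
      using KM[OF that] by simp
    show "X = M\<inverse>" if X: "partial_iso X" "M\<inverse> \<subseteq> X" for X
    proof -
      have "M \<subseteq> X\<inverse>"
        using X(2) by auto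
      then have "X\<inverse> = M"
        by (rule max[OF partial_iso_converse[OF X(1)]])
      then show ?thesis
        by auto
    qed
  qed (rule partial_iso_converse[OF M(1)])
  ultimately have "Domain M = UNIV" "Range M = UNIV"
    unfolding Domain_converse by blast+
  then show thesis
    by (rule that[OF M])
qed

lemma automorphism_of_partial_iso:
  assumes G: "partial_iso G" and dom: "Domain G = UNIV" and ran: "Range G = UNIV"
    and K: "\<And>k. k \<in> K \<Longrightarrow> (k, k) \<in> G"
  shows "\<exists>\<sigma>\<in>galois_group K. \<forall>a b. (a, b) \<in> G \<longrightarrow> \<sigma> a = b"
proof -
  have fn: "b = c" if "(a, b) \<in> G" "(a, c) \<in> G" for a b c
    using partial_isoD(6)[OF G partial_iso_diff[OF G that]] by simp
  have inj: "a = c" if "(a, b) \<in> G" "(c, b) \<in> G" for a b c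
    using partial_isoD(6)[OF G partial_iso_diff[OF G that]] by simp
  have "\<forall>x. \<exists>y. (x, y) \<in> G"
    using dom by blast
  then obtain \<sigma> where s: "\<And>x. (x, \<sigma> x) \<in> G"
    by metis
  have eq: "\<sigma> a = b" if "(a, b) \<in> G" for a b
    using fn s that by blast
  have "bij \<sigma>"
  proof (rule bijI)
    show "inj \<sigma>"
    proof (rule injI)
      fix x y assume "\<sigma> x = \<sigma> y"
      then show "x = y"
        using inj[OF s[of x]] s[of y] by simp
    qed
    show "surj \<sigma>"
    proof (rule surjI)
      fix y
      have "y \<in> Range G"
        using ran by simp
      then show "\<sigma> (SOME x. (x, y) \<in> G) = y"
        by (intro eq) (metis Range_iff someI_ex)
    qed
  qed
  moreover have "\<sigma> (x + y) = \<sigma> x + \<sigma> y" "\<sigma> (x * y) = \<sigma> x * \<sigma> y" for x y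
    by (rule eq[OF partial_isoD(3)[OF G s s]], rule eq[OF partial_isoD(4)[OF G s s]])
  ultimately have "\<sigma> \<in> galois_group K"
    using eq[OF K] by (simp add: galois_group_def)
  then show ?thesis
    using eq by (intro bexI[of _ \<sigma>]) simp_all
qed

text \<open>Outside the fraction field of \<open>M\<close> the minimal polynomial has degree at
  least 2 and, in characteristic 0, a second root \<open>y\<close>; the map sending \<open>x\<close>
  to \<open>y\<close> extends to an automorphism.\<close>

lemma exists_automorphism_moving:
  fixes M :: "'a::field_char_0 set"
  assumes ac: "algebraically_closed_type TYPE('a)"
    and K: "algebraic_over K" "K \<subseteq> M" and M: "is_subring M"
    and x: "\<And>m n. m \<in> M \<Longrightarrow> n \<in> M \<Longrightarrow> n \<noteq> 0 \<Longrightarrow> x \<noteq> m / n"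
  obtains \<sigma> where "\<sigma> \<in> galois_group M" "\<sigma> x \<noteq> x"
proof -
  define G where "G = Id_on M"
  have G: "partial_iso G"
    using M by (auto simp: G_def partial_iso_def is_subring_def)
  have pp: "poly_pair G p q \<longleftrightarrow> p = q \<and> (\<forall>i. coeff p i \<in> M)" for p q
    by (auto simp: poly_pair_def G_def Id_on_iff poly_eq_iff)
  obtain g h where gh: "poly_pair G g h" "g \<noteq> 0" "poly g x = 0"
    and min: "\<And>p q. poly_pair G p q \<Longrightarrow> p \<noteq> 0 \<Longrightarrow> poly p x = 0 \<Longrightarrow> degree g \<le> degree p"
  proof -
    have "(k, k) \<in> G" if "k \<in> K" for k
      using that K(2) by (auto simp: G_def)
    then show thesis
      using minimal_poly_pair[OF K(1), of G x] that by blast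
  qed
  have h: "h = g" and gM: "\<And>i. coeff g i \<in> M"
    using gh(1) by (auto simp: pp)
  obtain k where k: "g = [:- x, 1:] * k"
    using gh(3) by (metis dvd_def poly_eq_0_iff_dvd)
  have "k \<noteq> 0"
    using k gh(2) by auto
  have deg: "degree g = Suc (degree k)"
    unfolding k using \<open>k \<noteq> 0\<close> by (subst degree_mult_eq) auto
  \<comment> \<open>A linear \<open>g\<close> would exhibit \<open>x\<close> as a quotient of
    elements of \<open>M\<close>.\<close>
  have "degree k \<noteq> 0"
  proof
    assume "degree k = 0"
    then obtain c where "k = [:c:]"
      by (metis degree_eq_zeroE)
    then have "g = [:- x * c, c:]" "c \<noteq> 0"
      using k \<open>k \<noteq> 0\<close> by auto
    then have "x = - coeff g 0 / coeff g 1" "coeff g 1 \<noteq> 0"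
      by auto
    then show False
      using x[OF is_subringD(5)[OF M gM[of 0]] gM[of 1]] by simp
  qed
  then obtain y where y: "poly k y = 0"
    using ac unfolding algebraically_closed_type_def
    by (metis One_nat_def Suc_leI bot_nat_0.not_eq_extremum)
  \<comment> \<open>A double root would be a root of \<open>pderiv g\<close>, whose degree is
    smaller.\<close>
  have "poly k x \<noteq> 0"
  proof
    assume "poly k x = 0"
    then have "poly (pderiv g) x = 0"
      unfolding k pderiv_mult by (simp add: pderiv_pCons)
    moreover have "poly_pair G (pderiv g) (pderiv g)"
      unfolding pp coeff_pderiv
      by (intro conjI refl allI is_subringD(4)[OF M] is_subring_of_nat[OF M] gM)
    moreover have "pderiv g \<noteq> 0"
      using deg by (simp add: pderiv_eq_0_iff)
    ultimately show False
      using min[of "pderiv g" "pderiv g"] deg by (simp add: degree_pderiv)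
  qed
  then have "y \<noteq> x"
    using y by auto
  have "poly h y = 0"
    using y by (simp add: h k)
  then have ad: "partial_iso (adjoin G x y)"
    by (rule partial_iso_adjoin[OF G gh _ min])
  have sub: "(m, m) \<in> adjoin G x y" if "m \<in> M" for m
    using that adjoin_superset[OF G] by (auto simp: G_def)
  obtain G' where G': "partial_iso G'" "adjoin G x y \<subseteq> G'" "Domain G' = UNIV" "Range G' = UNIV"
    by (rule partial_iso_extension[OF ac K(1) sub[OF subsetD[OF K(2)]] ad])
  obtain \<sigma> where "\<sigma> \<in> galois_group M" "\<forall>a b. (a, b) \<in> G' \<longrightarrow> \<sigma> a = b"
    using automorphism_of_partial_iso[OF G'(1,3,4) subsetD[OF G'(2) sub], of M] by blast
  moreover have "(x, y) \<in> G'"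
    using adjoin_generator[OF G] G'(2) by (rule subsetD[rotated])
  ultimately show thesis
    using that \<open>y \<noteq> x\<close> by metis
qed

section \<open>Invariance of the absolute value under automorphisms\<close>

lemma galois_groupD:
  assumes "\<sigma> \<in> galois_group K"
  shows "bij \<sigma>" "\<sigma> (x + y) = \<sigma> x + \<sigma> y" "\<sigma> (x * y) = \<sigma> x * \<sigma> y" "z \<in> K \<Longrightarrow> \<sigma> z = z"
  using assms by (simp_all add: galois_group_def)

lemma galois_group_antimono: "K \<subseteq> L \<Longrightarrow> galois_group L \<subseteq> galois_group K"
  by (auto simp: galois_group_def)

context
  fixes \<sigma> :: "'a::field \<Rightarrow> 'a" and K
  assumes \<sigma>: "\<sigma> \<in> galois_group K"
begin

lemma galois_inj: "\<sigma> x = \<sigma> y \<longleftrightarrow> x = y"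
  using galois_groupD(1)[OF \<sigma>] by (metis bij_pointE)

lemma galois_0 [simp]: "\<sigma> 0 = 0"
  using galois_groupD(2)[OF \<sigma>, of 0 0] by (metis add.right_neutral add_left_cancel)

lemma galois_eq_0 [simp]: "\<sigma> x = 0 \<longleftrightarrow> x = 0"
  using galois_inj[of x 0] by simp

lemma galois_1 [simp]: "\<sigma> 1 = 1"
  using galois_groupD(3)[OF \<sigma>, of 1 1] by simp

lemma galois_minus: "\<sigma> (- x) = - \<sigma> x"
  using galois_groupD(2)[OF \<sigma>, of x "- x"] by (simp add: eq_neg_iff_add_eq_0 add.commute)

lemma galois_diff: "\<sigma> (x - y) = \<sigma> x - \<sigma> y"
  using galois_groupD(2)[OF \<sigma>, of x "- y"] by (simp add: galois_minus)

lemma galois_power: "\<sigma> (x ^ n) = \<sigma> x ^ n"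
  by (induction n) (simp_all add: galois_groupD(3)[OF \<sigma>])

lemma galois_sum: "\<sigma> (sum f A) = (\<Sum>i\<in>A. \<sigma> (f i))"
  by (induction A rule: infinite_finite_induct) (simp_all add: galois_groupD(2)[OF \<sigma>])

lemma galois_prod: "\<sigma> (prod f A) = (\<Prod>i\<in>A. \<sigma> (f i))"
  by (induction A rule: infinite_finite_induct) (simp_all add: galois_groupD(3)[OF \<sigma>])

lemma galois_of_nat [simp]: "\<sigma> (of_nat n) = of_nat n"
  by (induction n) (simp_all add: galois_groupD(2)[OF \<sigma>])

lemma galois_inverse: "\<sigma> (inverse x) = inverse (\<sigma> x)"
proof (cases "x = 0")
  case False
  then have "\<sigma> x * \<sigma> (inverse x) = 1"
    by (simp flip: galois_groupD(3)[OF \<sigma>])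
  then show ?thesis
    by (metis inverse_unique)
qed simp

lemma galois_divide: "\<sigma> (x / y) = \<sigma> x / \<sigma> y"
  by (simp add: divide_inverse galois_groupD(3)[OF \<sigma>] galois_inverse)

lemma galois_poly: "(\<And>i. coeff w i \<in> K) \<Longrightarrow> \<sigma> (poly w x) = poly w (\<sigma> x)"
  by (simp add: poly_altdef galois_sum galois_groupD(3,4)[OF \<sigma>] galois_power)

lemma galois_inv: "inv_into UNIV \<sigma> \<in> galois_group K"
proof -
  have bij: "bij \<sigma>"
    by (rule galois_groupD(1)[OF \<sigma>])
  have s: "\<sigma> (inv_into UNIV \<sigma> x) = x" for x
    using bij by (simp add: bij_is_surj surj_f_inv_f)
  have "inv_into UNIV \<sigma> (x + y) = inv_into UNIV \<sigma> x + inv_into UNIV \<sigma> y" for x y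
    using galois_inj[of "inv_into UNIV \<sigma> (x + y)" "inv_into UNIV \<sigma> x + inv_into UNIV \<sigma> y"]
    by (simp add: s galois_groupD(2)[OF \<sigma>])
  moreover have "inv_into UNIV \<sigma> (x * y) = inv_into UNIV \<sigma> x * inv_into UNIV \<sigma> y" for x y
    using galois_inj[of "inv_into UNIV \<sigma> (x * y)" "inv_into UNIV \<sigma> x * inv_into UNIV \<sigma> y"]
    by (simp add: s galois_groupD(3)[OF \<sigma>])
  moreover have "inv_into UNIV \<sigma> x = x" if "x \<in> K" for x
    using galois_inj[of "inv_into UNIV \<sigma> x" x] that by (simp add: s galois_groupD(4)[OF \<sigma>])
  ultimately show ?thesis
    using bij by (simp add: galois_group_def bij_imp_bij_inv)
qed

end

lemma galois_comp: "\<sigma> \<in> galois_group K \<Longrightarrow> \<tau> \<in> galois_group K \<Longrightarrow> \<sigma> \<circ> \<tau> \<in> galois_group K"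
  by (auto simp: galois_group_def intro: bij_comp)

section \<open>Boundedness of coordinates over a complete field and uniqueness of the absolute
  value\<close>

context nonarch
begin

definition complete_abs :: "'a set \<Rightarrow> bool" where
  "complete_abs K \<longleftrightarrow> (\<forall>x. (\<forall>n. x n \<in> K) \<longrightarrow>
     (\<forall>e>0. \<exists>M. \<forall>m\<ge>M. \<forall>n\<ge>M. N (x m - x n) < e) \<longrightarrow>
     (\<exists>y\<in>K. (\<lambda>n::nat. N (x n - y)) \<longlonglongrightarrow> 0))"

lemma N_triangle: "N (x + y) \<le> N x + N y"
  using N_ultra[of x y] N_nonneg[of x] N_nonneg[of y] by linarith

lemma N_sum_triangle: "N (sum f A) \<le> (\<Sum>i\<in>A. N (f i))"
  by (induction A rule: infinite_finite_induct) (auto intro: order_trans[OF N_triangle])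

text \<open>Coordinates can be chosen bounded, so summing the coordinates of the increments of a
  sequence turns convergence in the span into convergence of the coordinates.\<close>

lemma lspan_closed:
  assumes K: "is_subfield K" "complete_abs K" and fin: "finite B" and C: "0 < C"
    and coords: "\<And>y. y \<in> lspan K B \<Longrightarrow>
      \<exists>c. (\<forall>b\<in>B. c b \<in> K) \<and> y = (\<Sum>b\<in>B. c b * b) \<and> (\<forall>b\<in>B. N (c b) \<le> C * N y)"
    and lim: "\<And>n. s n \<in> lspan K B" "\<And>n. N (y - s n) < inverse (real (Suc n))"
  shows "y \<in> lspan K B"
proof -
  have Kr: "is_subring K"
    by (rule is_subfield_imp_subring[OF K(1)])
  define u where "u = (\<lambda>n. if n = 0 then s 0 else s n - s (n - 1))"
  have "u n \<in> lspan K B" for n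
    using lspan_add[OF Kr lim(1) lspan_minus[OF Kr lim(1)], of n "n - 1"] lim(1)
    by (auto simp: u_def)
  then have "\<forall>n. \<exists>c. (\<forall>b\<in>B. c b \<in> K) \<and> u n = (\<Sum>b\<in>B. c b * b) \<and> (\<forall>b\<in>B. N (c b) \<le> C * N (u n))"
    using coords by blast
  then obtain e where e: "\<And>n b. b \<in> B \<Longrightarrow> e n b \<in> K" "\<And>n. u n = (\<Sum>b\<in>B. e n b * b)"
      "\<And>n b. b \<in> B \<Longrightarrow> N (e n b) \<le> C * N (u n)"
    by metis
  have Nu: "N (u (Suc n)) < inverse (real (Suc n))" for n
  proof -
    have "inverse (real (Suc (Suc n))) \<le> inverse (real (Suc n))"
      by (intro le_imp_inverse_le) auto
    then have "N (y - s (Suc n)) < inverse (real (Suc n))"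
      using lim(2)[of "Suc n"] by linarith
    then have "N ((y - s n) - (y - s (Suc n))) < inverse (real (Suc n))"
      by (rule N_diff_less[OF lim(2)])
    then show ?thesis
      by (simp add: u_def)
  qed
  define c where "c = (\<lambda>n b. \<Sum>k\<le>n. e k b)"
  have cK: "c n b \<in> K" if "b \<in> B" for n b
    unfolding c_def using e(1)[OF that] by (rule is_subring_sum[OF Kr])
  have sc: "s n = (\<Sum>b\<in>B. c n b * b)" for n
  proof -
    have "s n = (\<Sum>k\<le>n. u k)"
      by (induction n) (auto simp: u_def)
    also have "\<dots> = (\<Sum>k\<le>n. \<Sum>b\<in>B. e k b * b)"
      by (simp add: e(2))
    also have "\<dots> = (\<Sum>b\<in>B. c n b * b)"
      by (subst sum.swap) (simp add: c_def sum_distrib_right)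
    finally show ?thesis .
  qed
  have tail: "N (c m b - c n b) \<le> C * inverse (real (Suc n))" if "b \<in> B" "n \<le> m" for m n b
  proof -
    have "c m b = c n b + (\<Sum>k\<in>{Suc n..m}. e k b)"
      using \<open>n \<le> m\<close> by (induction m rule: dec_induct) (auto simp: c_def)
    then have "c m b - c n b = (\<Sum>k\<in>{Suc n..m}. e k b)"
      by simp
    also have "N \<dots> \<le> C * inverse (real (Suc n))"
    proof (rule N_sum_le)
      fix k assume k: "k \<in> {Suc n..m}"
      then obtain j where j: "k = Suc j" "n \<le> j"
        by (cases k) auto
      have "N (e k b) \<le> C * N (u k)"
        by (rule e(3)[OF \<open>b \<in> B\<close>])
      also have "\<dots> \<le> C * inverse (real (Suc j))"
        using Nu[of j] C by (simp add: j)
      also have "\<dots> \<le> C * inverse (real (Suc n))"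
        using C j by (intro mult_left_mono le_imp_inverse_le) auto
      finally show "N (e k b) \<le> C * inverse (real (Suc n))" .
    qed (use C in simp)
    finally show ?thesis .
  qed
  have "\<exists>l\<in>K. (\<lambda>n. N (c n b - l)) \<longlonglongrightarrow> 0" if b: "b \<in> B" for b
  proof -
    have "\<exists>M. \<forall>m\<ge>M. \<forall>n\<ge>M. N (c m b - c n b) < \<epsilon>" if "0 < \<epsilon>" for \<epsilon> :: real
    proof -
      obtain M where M: "inverse (real (Suc M)) < \<epsilon> / C"
        using reals_Archimedean[of "\<epsilon> / C"] \<open>0 < \<epsilon>\<close> C by auto
      have "N (c m b - c n b) < \<epsilon>" if "M \<le> m" "M \<le> n" for m n
      proof -
        have "N ((c m b - c M b) - (c n b - c M b)) \<le> C * inverse (real (Suc M))"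
          by (intro N_diff_le tail b that)
        moreover have "C * inverse (real (Suc M)) < \<epsilon>"
          using M C by (simp only: pos_less_divide_eq mult.commute)
        ultimately show ?thesis
          by simp
      qed
      then show ?thesis
        by blast
    qed
    then show ?thesis
      using K(2)[unfolded complete_abs_def, rule_format, of "\<lambda>n. c n b"] cK[OF b] by blast
  qed
  then obtain l where l: "\<And>b. b \<in> B \<Longrightarrow> l b \<in> K" "\<And>b. b \<in> B \<Longrightarrow> (\<lambda>n. N (c n b - l b)) \<longlonglongrightarrow> 0"
    by metis
  define z where "z = (\<Sum>b\<in>B. l b * b)"
  have "N (y - z) \<le> inverse (real (Suc n)) + (\<Sum>b\<in>B. N (c n b - l b) * N b)" for n
  proof -
    have "y - z = (y - s n) + (\<Sum>b\<in>B. (c n b - l b) * b)"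
      by (simp add: z_def sc left_diff_distrib sum_subtractf)
    then have "N (y - z) \<le> N (y - s n) + N (\<Sum>b\<in>B. (c n b - l b) * b)"
      by (metis N_triangle)
    also have "\<dots> \<le> inverse (real (Suc n)) + (\<Sum>b\<in>B. N ((c n b - l b) * b))"
      using lim(2)[of n] by (intro add_mono N_sum_triangle) simp
    finally show ?thesis
      by (simp add: N_mult)
  qed
  moreover have "(\<lambda>n. inverse (real (Suc n)) + (\<Sum>b\<in>B. N (c n b - l b) * N b)) \<longlonglongrightarrow> 0 + (\<Sum>b\<in>B. 0 * N b)"
    by (intro tendsto_add LIMSEQ_inverse_real_of_nat tendsto_sum tendsto_mult l(2) tendsto_const)
  ultimately have "N (y - z) \<le> 0"
    by (intro LIMSEQ_le_const[where X = "\<lambda>n. inverse (real (Suc n)) + (\<Sum>b\<in>B. N (c n b - l b) * N b)"]) auto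
  then have "y = z"
    using N_pos[of "y - z"] by force
  then show ?thesis
    unfolding z_def by (rule lspanI) (rule l(1))
qed

text \<open>Equivalence of norms on a finite-dimensional space, by induction on the generators.
  Coordinates are not unique, so only the existence of a bounded choice is claimed; a generator
  already in the span of the others receives coordinate 0.\<close>

lemma bounded_coordinates:
  assumes K: "is_subfield K" "complete_abs K" and "finite B"
  shows "\<exists>C>0. \<forall>y\<in>lspan K B. \<exists>c. (\<forall>b\<in>B. c b \<in> K) \<and> y = (\<Sum>b\<in>B. c b * b) \<and>
    (\<forall>b\<in>B. N (c b) \<le> C * N y)"
  using assms(3)
proof (induction B rule: finite_induct)
  case empty
  show ?case
    by (intro exI[of _ 1]) (auto simp: lspan_def)
next
  case (insert b B)
  have Kr: "is_subring K"
    by (rule is_subfield_imp_subring[OF K(1)])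
  obtain C where C: "0 < C" and coords: "\<And>y. y \<in> lspan K B \<Longrightarrow>
      \<exists>c. (\<forall>b\<in>B. c b \<in> K) \<and> y = (\<Sum>b\<in>B. c b * b) \<and> (\<forall>b\<in>B. N (c b) \<le> C * N y)"
    using insert.IH by blast
  have split: "\<exists>k\<in>K. \<exists>s\<in>lspan K B. y = k * b + s" if "y \<in> lspan K (insert b B)" for y
  proof -
    obtain c where c: "y = (\<Sum>b\<in>insert b B. c b * b)" "\<And>x. x \<in> insert b B \<Longrightarrow> c x \<in> K"
      using \<open>y \<in> lspan K (insert b B)\<close> by (metis lspanE)
    have "(\<Sum>b\<in>B. c b * b) \<in> lspan K B"
      using c(2) by (intro lspanI[OF refl]) auto
    then show ?thesis
      using c insert.hyps by (intro bexI[of _ "c b"] bexI[of _ "\<Sum>b\<in>B. c b * b"]) auto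
  qed
  show ?case
  proof (cases "b \<in> lspan K B")
    case True
    have "\<exists>c. (\<forall>x\<in>insert b B. c x \<in> K) \<and> y = (\<Sum>x\<in>insert b B. c x * x) \<and>
        (\<forall>x\<in>insert b B. N (c x) \<le> C * N y)" if "y \<in> lspan K (insert b B)" for y
    proof -
      obtain k s where "k \<in> K" "s \<in> lspan K B" "y = k * b + s"
        using split[OF \<open>y \<in> lspan K (insert b B)\<close>] by blast
      then have "y \<in> lspan K B"
        using lspan_add[OF Kr lspan_scale[OF Kr _ True]] by blast
      then obtain c where c: "\<forall>b\<in>B. c b \<in> K" "y = (\<Sum>b\<in>B. c b * b)" "\<forall>b\<in>B. N (c b) \<le> C * N y"
        using coords by blast
      have "(\<Sum>x\<in>B. (if x = b then 0 else c x) * x) = (\<Sum>x\<in>B. c x * x)"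
        using insert.hyps by (intro sum.cong) auto
      then show ?thesis
        using c C insert.hyps is_subringD(1)[OF Kr]
        by (intro exI[of _ "\<lambda>x. if x = b then 0 else c x"]) auto
    qed
    then show ?thesis
      using C by blast
  next
    case False
    \<comment> \<open>A vanishing distance would put \<open>b\<close> into the span, which is closed
      by the induction hypothesis.\<close>
    have "\<exists>D>0. \<forall>s\<in>lspan K B. D \<le> N (b - s)"
    proof (rule ccontr)
      assume neg: "\<not> ?thesis"
      have "\<exists>s\<in>lspan K B. N (b - s) < inverse (real (Suc n))" for n
        using neg by (metis inverse_positive_iff_positive not_le of_nat_0_less_iff zero_less_Suc)
      then obtain s where "\<And>n. s n \<in> lspan K B" "\<And>n. N (b - s n) < inverse (real (Suc n))"
        by metis
      then show False
        using lspan_closed[OF K insert.hyps(1) C coords] False by blast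
    qed
    then obtain D where D: "0 < D" "\<And>s. s \<in> lspan K B \<Longrightarrow> D \<le> N (b - s)"
      by blast
    \<comment> \<open>The first summand bounds the coordinate of \<open>b\<close>, the second those
      along \<open>B\<close>, via \<open>N s \<le> max 1 (N b / D) * N y\<close>.\<close>
    define C' where "C' = 1 / D + C * max 1 (N b / D)"
    have C': "0 < C'" "1 / D \<le> C'" "C * max 1 (N b / D) \<le> C'"
      using C D(1) by (auto simp: C'_def intro!: add_pos_nonneg)
    have "\<exists>c. (\<forall>x\<in>insert b B. c x \<in> K) \<and> y = (\<Sum>x\<in>insert b B. c x * x) \<and>
        (\<forall>x\<in>insert b B. N (c x) \<le> C' * N y)" if "y \<in> lspan K (insert b B)" for y
    proof -
      obtain k s where ks: "k \<in> K" "s \<in> lspan K B" "y = k * b + s"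
        using split[OF \<open>y \<in> lspan K (insert b B)\<close>] by blast
      have k: "D * N k \<le> N y"
      proof (cases "k = 0")
        case False
        have "- inverse k \<in> K"
          using K(1) ks(1) by (auto simp: is_subfield_def)
        then have "- inverse k * s \<in> lspan K B"
          by (rule lspan_scale[OF Kr _ ks(2)])
        then have "D \<le> N (b - - inverse k * s)"
          by (rule D(2))
        then have "D * N k \<le> N (b - - inverse k * s) * N k"
          by (intro mult_right_mono) auto
        also have "\<dots> = N ((b - - inverse k * s) * k)"
          by (simp add: N_mult)
        also have "(b - - inverse k * s) * k = y"
          using False by (simp add: ks(3) field_simps)
        finally show ?thesis .
      qed auto
      have "N s \<le> max 1 (N b / D) * N y"
      proof -
        have "N (k * b) \<le> N b / D * N y"
          using mult_right_mono[OF k, of "N b / D"] D(1) by (simp add: N_mult field_simps)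
        also have "\<dots> \<le> max 1 (N b / D) * N y"
          by (intro mult_right_mono) auto
        finally have "N (y - k * b) \<le> max 1 (N b / D) * N y"
          using mult_right_mono[of 1 "max 1 (N b / D)" "N y"] by (intro N_diff_le) simp_all
        then show ?thesis
          by (simp add: ks(3))
      qed
      obtain c where c: "\<forall>b\<in>B. c b \<in> K" "s = (\<Sum>b\<in>B. c b * b)" "\<forall>b\<in>B. N (c b) \<le> C * N s"
        using coords[OF ks(2)] by blast
      have "N (c x) \<le> C' * N y" if "x \<in> B" for x
      proof -
        have "N (c x) \<le> C * N s"
          using c(3) that by blast
        also have "\<dots> \<le> C * (max 1 (N b / D) * N y)"
          using C \<open>N s \<le> _\<close> by (intro mult_left_mono) auto
        also have "\<dots> \<le> C' * N y"
          using mult_right_mono[OF C'(3), of "N y"] by (simp add: mult.assoc)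
        finally show ?thesis .
      qed
      moreover have "N k \<le> C' * N y"
      proof -
        have "N k \<le> 1 / D * N y"
          using k D(1) by (simp add: field_simps)
        also have "\<dots> \<le> C' * N y"
          by (intro mult_right_mono C') auto
        finally show ?thesis .
      qed
      moreover have "(\<Sum>x\<in>B. (if x = b then k else c x) * x) = s"
        unfolding c(2) using insert.hyps by (intro sum.cong) auto
      ultimately show ?thesis
        using c(1) ks insert.hyps
        by (intro exI[of _ "\<lambda>x. if x = b then k else c x"]) auto
    qed
    then show ?thesis
      using C'(1) by blast
  qed
qed

text \<open>Coordinates of \<open>x ^ k\<close> in the powers of \<open>x\<close> are bounded by
  \<open>C * N x ^ k\<close> and fixed by \<open>\<sigma>\<close>. Hence
  \<open>N (\<sigma> x) ^ k \<le> E * N x ^ k\<close> with \<open>E\<close> independent of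
  \<open>k\<close>, which forces the inequality of the bases.\<close>

lemma N_galois_le:
  assumes K: "is_subfield K" "complete_abs K" "algebraic_over K" and \<sigma>: "\<sigma> \<in> galois_group K"
  shows "N (\<sigma> x) \<le> N x"
proof (rule ccontr)
  assume "\<not> N (\<sigma> x) \<le> N x"
  then have gt: "N x < N (\<sigma> x)"
    by simp
  then have "x \<noteq> 0"
    using galois_0[OF \<sigma>] by auto
  have Kr: "is_subring K"
    by (rule is_subfield_imp_subring[OF K(1)])
  obtain q where "q \<noteq> 0" "\<forall>i. coeff q i \<in> K" "poly q x = 0"
    using K(3) unfolding algebraic_over_def by blast
  then obtain n where n: "0 < n" "x ^ n \<in> lspan K ((\<lambda>i. x ^ i) ` {..<n})"
    using algebraic_power_in_lspan[OF K(1)] by metis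
  define B where "B = (\<lambda>i. x ^ i) ` {..<n}"
  have "finite B"
    by (simp add: B_def)
  have pow: "x ^ k \<in> lspan K B" for k
    unfolding B_def by (rule power_in_lspan_powers[OF Kr n(2,1)])
  obtain C where C: "0 < C" "\<And>y. y \<in> lspan K B \<Longrightarrow>
      \<exists>c. (\<forall>b\<in>B. c b \<in> K) \<and> y = (\<Sum>b\<in>B. c b * b) \<and> (\<forall>b\<in>B. N (c b) \<le> C * N y)"
    using bounded_coordinates[OF K(1,2) \<open>finite B\<close>] by blast
  define E where "E = C * (\<Sum>b\<in>B. N (\<sigma> b))"
  have bound: "N (\<sigma> x) ^ k \<le> E * N x ^ k" for k
  proof -
    obtain c where c: "\<forall>b\<in>B. c b \<in> K" "x ^ k = (\<Sum>b\<in>B. c b * b)" "\<forall>b\<in>B. N (c b) \<le> C * N (x ^ k)"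
      using C(2)[OF pow[of k]] by blast
    have "\<sigma> x ^ k = (\<Sum>b\<in>B. c b * \<sigma> b)"
      unfolding galois_power[OF \<sigma>, symmetric] c(2) galois_sum[OF \<sigma>]
      using c(1) by (intro sum.cong) (auto simp: galois_groupD(3,4)[OF \<sigma>])
    then have "N (\<sigma> x) ^ k \<le> (\<Sum>b\<in>B. N (c b * \<sigma> b))"
      by (simp add: N_sum_triangle flip: N_power)
    also have "\<dots> \<le> (\<Sum>b\<in>B. C * N (x ^ k) * N (\<sigma> b))"
      unfolding N_mult using c(3) by (intro sum_mono mult_right_mono) auto
    also have "\<dots> = E * N x ^ k"
      by (simp add: E_def N_power sum_distrib_left mult_ac)
    finally show ?thesis .
  qed
  have "1 < N (\<sigma> x) / N x"
    using gt N_pos[OF \<open>x \<noteq> 0\<close>] by simp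
  then obtain k where "E < (N (\<sigma> x) / N x) ^ k"
    using real_arch_pow by blast
  then show False
    using bound[of k] N_pos[OF \<open>x \<noteq> 0\<close>] by (simp add: field_simps)
qed

lemma N_galois:
  assumes "is_subfield K" "complete_abs K" "algebraic_over K" "\<sigma> \<in> galois_group K"
  shows "N (\<sigma> x) = N x"
proof (rule antisym)
  show "N (\<sigma> x) \<le> N x"
    by (rule N_galois_le[OF assms])
  have "N (inv_into UNIV \<sigma> (\<sigma> x)) \<le> N (\<sigma> x)"
    by (rule N_galois_le[OF assms(1-3) galois_inv[OF assms(4)]])
  then show "N x \<le> N (\<sigma> x)"
    using galois_groupD(1)[OF assms(4)] by (simp add: bij_is_inj)
qed

end

section \<open>Roots of unity of order prime to p and the maximal unramified ring\<close>

lemma frobenius_add: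
  fixes x y :: "'a::comm_ring_1"
  assumes S: "is_subring S" and p: "prime (p::nat)" and xy: "x \<in> S" "y \<in> S"
  obtains c where "c \<in> S" "(x + y) ^ p = x ^ p + y ^ p + of_nat p * c"
proof
  let ?c = "\<Sum>k\<in>{1..<p}. of_nat ((p choose k) div p) * (x ^ k * y ^ (p - k))"
  show "?c \<in> S"
    by (intro is_subring_sum S is_subringD(4)[OF S] is_subring_of_nat is_subring_power xy)
  have p0: "0 < p"
    using p by (simp add: prime_gt_0_nat)
  have "(x + y) ^ p = (\<Sum>k\<le>p. of_nat (p choose k) * (x ^ k * y ^ (p - k)))"
    by (simp add: binomial_ring mult.assoc)
  also have "{..p} = insert 0 (insert p {1..<p})"
    by auto
  also have "(\<Sum>k\<in>\<dots>. of_nat (p choose k) * (x ^ k * y ^ (p - k)))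
      = x ^ p + y ^ p + (\<Sum>k\<in>{1..<p}. of_nat (p choose k) * (x ^ k * y ^ (p - k)))"
    using p0 by (simp add: algebra_simps)
  also have "(\<Sum>k\<in>{1..<p}. of_nat (p choose k) * (x ^ k * y ^ (p - k))) = of_nat p * ?c"
    unfolding sum_distrib_left
  proof (intro sum.cong refl)
    fix k assume "k \<in> {1..<p}"
    then have "p dvd (p choose k)"
      using p by (intro dvd_choose_prime) auto
    then have "(of_nat (p choose k) :: 'a) = of_nat p * of_nat ((p choose k) div p)"
      by (metis dvd_mult_div_cancel of_nat_mult)
    then show "of_nat (p choose k) * (x ^ k * y ^ (p - k))
        = (of_nat p :: 'a) * (of_nat ((p choose k) div p) * (x ^ k * y ^ (p - k)))"
      by (simp add: mult.assoc)
  qed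
  finally show "(x + y) ^ p = x ^ p + y ^ p + of_nat p * ?c" .
qed

lemma frobenius_sum_list:
  fixes ts :: "'a::comm_ring_1 list"
  assumes S: "is_subring S" and p: "prime (p::nat)" and "set ts \<subseteq> S"
  shows "\<exists>c\<in>S. sum_list ts ^ p = (\<Sum>t\<leftarrow>ts. t ^ p) + of_nat p * c"
  using assms(3)
proof (induction ts)
  case Nil
  show ?case
    using prime_gt_0_nat[OF p] is_subringD(1)[OF S] by (intro bexI[of _ 0]) (auto simp: zero_power)
next
  case (Cons t ts)
  obtain c where c: "c \<in> S" "sum_list ts ^ p = (\<Sum>t\<leftarrow>ts. t ^ p) + of_nat p * c"
    using Cons by auto
  have "sum_list ts \<in> S"
    using Cons.prems by (induction ts) (auto intro: is_subringD[OF S])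
  then obtain c' where c': "c' \<in> S" "(t + sum_list ts) ^ p = t ^ p + sum_list ts ^ p + of_nat p * c'"
    using frobenius_add[OF S p, of t "sum_list ts"] Cons.prems by auto
  show ?case
    using c c' by (intro bexI[of _ "c + c'"]) (auto simp: algebra_simps intro: is_subringD(3)[OF S])
qed

lemma frobenius_sum_list_iterate:
  fixes ts :: "'a::comm_ring_1 list"
  assumes S: "is_subring S" and p: "prime (p::nat)" and ts: "set ts \<subseteq> S"
  shows "\<exists>c\<in>S. sum_list ts ^ (p ^ m) = (\<Sum>t\<leftarrow>ts. t ^ (p ^ m)) + of_nat p * c"
proof (induction m)
  case 0
  show ?case
    using is_subringD(1)[OF S] by (intro bexI[of _ 0]) auto
next
  case (Suc m)
  define us where "us = map (\<lambda>t. t ^ (p ^ m)) ts"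
  have us: "set us \<subseteq> S"
    using ts by (auto simp: us_def intro: is_subring_power[OF S])
  have "sum_list us \<in> S"
    using us by (induction us) (auto intro: is_subringD[OF S])
  obtain c where c: "c \<in> S" "sum_list ts ^ (p ^ m) = sum_list us + of_nat p * c"
    using Suc by (auto simp: us_def)
  obtain c' where c': "c' \<in> S"
      "(sum_list us + of_nat p * c) ^ p = sum_list us ^ p + (of_nat p * c) ^ p + of_nat p * c'"
    by (rule frobenius_add[OF S p \<open>sum_list us \<in> S\<close>, of "of_nat p * c"])
      (auto intro: is_subringD(4)[OF S] is_subring_of_nat[OF S] c(1))
  obtain c'' where c'': "c'' \<in> S" "sum_list us ^ p = (\<Sum>t\<leftarrow>us. t ^ p) + of_nat p * c''"
    using frobenius_sum_list[OF S p us] by blast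
  have "(of_nat p * c) ^ p = of_nat p * (of_nat p ^ (p - 1) * c ^ p)"
    using prime_gt_0_nat[OF p] by (cases p) (simp_all add: power_mult_distrib mult.assoc)
  moreover have "(\<Sum>t\<leftarrow>us. t ^ p) = (\<Sum>t\<leftarrow>ts. t ^ (p ^ Suc m))"
    unfolding us_def map_map o_def power_mult[symmetric] by (simp only: power_Suc2)
  moreover have "sum_list ts ^ (p ^ Suc m) = (sum_list ts ^ (p ^ m)) ^ p"
    by (simp only: power_mult[symmetric] power_Suc2)
  ultimately have "sum_list ts ^ (p ^ Suc m) = (\<Sum>t\<leftarrow>ts. t ^ (p ^ Suc m)) + of_nat p * c''
      + of_nat p * (of_nat p ^ (p - 1) * c ^ p) + of_nat p * c'"
    by (simp only: c(2) c'(2) c''(2))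
  then have "sum_list ts ^ (p ^ Suc m)
      = (\<Sum>t\<leftarrow>ts. t ^ (p ^ Suc m)) + of_nat p * (of_nat p ^ (p - 1) * c ^ p + c' + c'')"
    by (simp only: distrib_left add_ac)
  moreover have "of_nat p ^ (p - 1) * c ^ p + c' + c'' \<in> S"
    by (intro is_subringD(3,4)[OF S] is_subring_power is_subring_of_nat S c c' c'')
  ultimately show ?case
    by blast
qed

text \<open>In the application \<open>2 < p\<close> follows from \<open>2 \<le> d < p\<close>; an
  odd \<open>p\<close> makes \<open>- 1\<close> a root of unity of order prime to
  \<open>p\<close>.\<close>

locale nonarch_p = nonarch N for N :: "'a::field_char_0 \<Rightarrow> real" +
  fixes p :: nat
  assumes p: "prime p" "2 < p" and Np: "N (of_nat p) < 1"
    and ac: "algebraically_closed_type TYPE('a)"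
begin

lemma Np_pos: "0 < N (of_nat p)"
  using p by (intro N_pos) auto

lemma p_pos [simp]: "0 < p"
  using p(2) by simp

lemma small_power: "0 < e \<Longrightarrow> \<exists>k. N (of_nat p) ^ k < e"
  using real_arch_pow_inv[OF _ Np] by blast

lemma N_of_int_unit:
  assumes "\<not> int p dvd m"
  shows "N (of_int m) = 1"
proof (rule ccontr)
  assume "N (of_int m) \<noteq> 1"
  then have less: "N (of_int m) < 1"
    using N_of_int[of m] by simp
  have "coprime m (int p)"
    using assms p(1) by (metis coprime_commute prime_imp_coprime prime_nat_int_transfer)
  then obtain a b where "a * m + b * int p = 1"
    using bezout_int[of m "int p"] by (auto simp: coprime_iff_gcd_eq_1)
  then have eq: "(of_int a * of_int m + of_int b * of_nat p :: 'a) = 1"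
    by (metis of_int_1 of_int_add of_int_mult of_int_of_nat_eq)
  have "N (of_int a * of_int m + of_int b * of_nat p) < 1"
    by (intro N_add_less N_mult_less1 N_of_int less Np)
  then show False
    by (simp add: eq)
qed

lemma N_of_nat_unit: "0 < m \<Longrightarrow> m < p \<Longrightarrow> N (of_nat m) = 1"
  using N_of_int_unit[of "int m"] by (simp add: nat_dvd_not_less)

lemma N_of_int_multiple: "int p dvd m \<Longrightarrow> N (of_int m) < 1"
  by (elim dvdE) (auto intro: N_mult_less1' Np N_of_int)

text \<open>Teichmueller representatives: 0 and the roots of unity of order prime to
  \<open>p\<close>.\<close>

definition teich :: "'a set" where
  "teich = {t. t = 0 \<or> (\<exists>n>0. \<not> p dvd n \<and> t ^ n = 1)}"

text \<open>Since \<open>teich\<close> is closed under products and negation, finite sums already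
  form a ring; repetitions are allowed, hence lists.\<close>

definition teich_ring :: "'a set" where
  "teich_ring = {sum_list ts | ts. set ts \<subseteq> teich}"

text \<open>This closure in the topology of \<open>N\<close> plays the role of the ring of integers
  of the maximal unramified extension of the \<open>p\<close>-adic numbers. Passing to the closure
  brings in the integral elements of \<open>rat_hull\<close>.\<close>

definition witt :: "'a set" where
  "witt = {x. \<forall>e>0. \<exists>a\<in>teich_ring. N (x - a) < e}"

definition witt_frac :: "'a set" where
  "witt_frac = {x. \<exists>k. of_nat p ^ k * x \<in> witt}"

text \<open>The same set as \<open>rat_closure\<close>, expressed through the absolute
  value.\<close>

definition rat_hull :: "'a set" where
  "rat_hull = {y. \<forall>e>0. \<exists>q. N (y - of_rat q) < e}"

section \<open>The ring of Teichmueller sums and its closure\<close>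

lemma teich_mult:
  assumes "s \<in> teich" "t \<in> teich"
  shows "s * t \<in> teich"
proof (cases "s = 0 \<or> t = 0")
  case False
  then obtain m n where "m > 0" "\<not> p dvd m" "s ^ m = 1" "n > 0" "\<not> p dvd n" "t ^ n = 1"
    using assms by (auto simp: teich_def)
  then have "m * n > 0" "\<not> p dvd m * n" "(s * t) ^ (m * n) = 1"
    using p(1) by (simp_all add: prime_dvd_mult_iff power_mult_distrib power_mult)
      (metis mult.commute power_mult power_one)
  then show ?thesis
    unfolding teich_def by blast
qed (auto simp: teich_def)

lemma teich_1: "1 \<in> teich" and teich_minus_1: "- 1 \<in> teich"
proof -
  have "\<not> p dvd 1" "\<not> p dvd 2"
    using p(2) by (auto dest: dvd_imp_le)
  then show "1 \<in> teich" "- 1 \<in> teich"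
    unfolding teich_def by (auto intro!: exI[of _ 1] exI[of _ 2])
qed

lemma teich_minus: "t \<in> teich \<Longrightarrow> - t \<in> teich"
  using teich_mult[OF teich_minus_1] by simp

lemma N_teich: "t \<in> teich \<Longrightarrow> N t \<le> 1"
proof -
  assume "t \<in> teich"
  then consider "t = 0" | n where "n > 0" "t ^ n = 1"
    by (auto simp: teich_def)
  then show "N t \<le> 1"
  proof cases
    case 2
    then have "N t ^ n = 1"
      by (simp flip: N_power)
    with 2 show ?thesis
      using one_less_power[of "N t" n] by fastforce
  qed simp
qed

lemma teich_ringI: "set ts \<subseteq> teich \<Longrightarrow> x = sum_list ts \<Longrightarrow> x \<in> teich_ring"
  unfolding teich_ring_def by blast

lemma is_subring_teich_ring: "is_subring teich_ring"
  unfolding is_subring_def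
proof (intro conjI ballI)
  show "0 \<in> teich_ring"
    by (rule teich_ringI[of "[]"]) auto
  show "1 \<in> teich_ring"
    by (rule teich_ringI[of "[1]"]) (auto intro: teich_1)
next
  fix x y assume "x \<in> teich_ring" "y \<in> teich_ring"
  then obtain ts us where *: "set ts \<subseteq> teich" "x = sum_list ts" "set us \<subseteq> teich" "y = sum_list us"
    by (auto simp: teich_ring_def)
  show "x + y \<in> teich_ring"
    by (rule teich_ringI[of "ts @ us"]) (use * in auto)
  have "x * y = (\<Sum>t\<leftarrow>ts. \<Sum>u\<leftarrow>us. t * u)"
    by (simp add: * sum_list_const_mult sum_list_mult_const)
  also have "\<dots> = sum_list (concat (map (\<lambda>t. map (\<lambda>u. t * u) us) ts))"
    by (induction ts) auto
  finally show "x * y \<in> teich_ring"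
    by (rule teich_ringI[rotated]) (use * teich_mult in auto)
next
  fix x assume "x \<in> teich_ring"
  then obtain ts where *: "set ts \<subseteq> teich" "x = sum_list ts"
    by (auto simp: teich_ring_def)
  have "- x = sum_list (map uminus ts)"
    unfolding *(2) by (induction ts) auto
  then show "- x \<in> teich_ring"
    by (rule teich_ringI[rotated]) (use * teich_minus in auto)
qed

lemma N_teich_ring: "x \<in> teich_ring \<Longrightarrow> N x \<le> 1"
proof -
  assume "x \<in> teich_ring"
  then obtain ts where "set ts \<subseteq> teich" "x = sum_list ts"
    by (auto simp: teich_ring_def)
  then show "N x \<le> 1"
    by (induction ts arbitrary: x) (auto intro: N_add_le N_teich)
qed

text \<open>If \<open>p^m\<close> is 1 modulo the orders of the roots of unity occurring in \<open>a\<close>, then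
  \<open>a^(p^m) = a + p * c\<close>, and the left-hand side tends to 0 with growing \<open>m\<close>.\<close>

lemma teich_ring_divide_p:
  assumes a: "a \<in> teich_ring" "N a < 1" and e: "0 < e"
  shows "\<exists>c\<in>teich_ring. N (a / of_nat p - c) < e"
proof -
  obtain ts where ts: "set ts \<subseteq> teich" "a = sum_list ts"
    using a(1) by (auto simp: teich_ring_def)
  have "\<exists>n>0. \<not> p dvd n \<and> (\<forall>t\<in>set ts. t = 0 \<or> t ^ n = 1)"
    using ts(1)
  proof (induction ts)
    case Nil
    show ?case
      using p(2) by (intro exI[of _ 1]) auto
  next
    case (Cons t ts)
    then obtain n where n: "n > 0" "\<not> p dvd n" "\<forall>t\<in>set ts. t = 0 \<or> t ^ n = 1"
      by auto
    show ?case
    proof (cases "t = 0")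
      case False
      then obtain k where k: "k > 0" "\<not> p dvd k" "t ^ k = 1"
        using Cons.prems by (auto simp: teich_def)
      have "t ^ (k * n) = 1"
        by (simp add: k power_mult)
      moreover have "s ^ (k * n) = 1" if "s \<in> set ts" "s \<noteq> 0" for s
        using n(3) that by (metis mult.commute power_mult power_one)
      ultimately show ?thesis
        using n(1,2) k(1,2) p(1) by (intro exI[of _ "k * n"]) (auto simp: prime_dvd_mult_iff)
    qed (use n in auto)
  qed
  then obtain n where n: "n > 0" "\<not> p dvd n" "\<And>t. t \<in> set ts \<Longrightarrow> t = 0 \<or> t ^ n = 1"
    by blast
  have cop: "coprime p n"
    using p(1) n(2) by (simp add: prime_imp_coprime)
  have "0 < e * N (of_nat p)"
    using e Np_pos by simp
  then obtain l where l: "N a ^ l < e * N (of_nat p)"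
    using real_arch_pow_inv[OF _ a(2)] by blast
  \<comment> \<open>The factor \<open>totient n\<close> makes \<open>p ^ m\<close> congruent to 1
    modulo \<open>n\<close>; the factor \<open>l\<close> makes \<open>p ^ m\<close> at least
    \<open>l\<close>, so that \<open>N a ^ (p ^ m)\<close> stays small even after division by
    \<open>p\<close>.\<close>
  define m where "m = totient n * l"
  have "[p ^ m = 1] (mod n)"
    using cong_pow[OF euler_theorem[OF cop], of l] by (simp add: m_def power_mult)
  have "1 \<le> p ^ m"
    using p(2) by simp
  then obtain j where j: "p ^ m = 1 + n * j"
    using \<open>[p ^ m = 1] (mod n)\<close> by (metis cong_le_nat cong_sym le_add_diff_inverse mult.commute add.commute)
  have "t ^ (p ^ m) = t" if "t \<in> set ts" for t
    using n(3)[OF that]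
  proof
    assume "t = 0"
    then show ?thesis
      using p(2) by simp
  next
    assume "t ^ n = 1"
    then show ?thesis
      unfolding j power_add power_mult by simp
  qed
  then have "(\<Sum>t\<leftarrow>ts. t ^ (p ^ m)) = a"
    unfolding ts(2) by (simp add: map_idI)
  moreover have "set ts \<subseteq> teich_ring"
    using ts(1) by (auto intro!: teich_ringI[of "[_]"])
  ultimately obtain c where c: "c \<in> teich_ring" "a ^ (p ^ m) = a + of_nat p * c"
    using frobenius_sum_list_iterate[OF is_subring_teich_ring p(1), of ts m] ts(2) by auto
  have p0: "(of_nat p :: 'a) \<noteq> 0"
    using p(2) by simp
  have "0 < totient n"
    using n(1) by simp
  then have "l \<le> m"
    using mult_le_mono1[of 1 "totient n" l] by (simp add: m_def Suc_leI)
  also have "m \<le> p ^ m"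
    using p(2) by (simp add: less_imp_le power_gt_expt)
  finally have "N a ^ (p ^ m) \<le> N a ^ l"
    using a(2) by (intro power_decreasing) auto
  moreover have "a / of_nat p - - c = a ^ (p ^ m) / of_nat p"
    using p0 by (simp add: c(2) field_simps)
  ultimately have "N (a / of_nat p - - c) * N (of_nat p) < e * N (of_nat p)"
    using l Np_pos by (simp only: N_divide N_power) simp
  then have "N (a / of_nat p - - c) < e"
    using Np_pos by (simp only: mult_less_cancel_right_pos)
  then show ?thesis
    using is_subringD(5)[OF is_subring_teich_ring c(1)] by blast
qed

lemma wittD: "x \<in> witt \<Longrightarrow> 0 < e \<Longrightarrow> \<exists>a\<in>teich_ring. N (x - a) < e"
  by (simp add: witt_def)

lemma wittI: "(\<And>e. 0 < e \<Longrightarrow> \<exists>a\<in>teich_ring. N (x - a) < e) \<Longrightarrow> x \<in> witt"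
  by (simp add: witt_def)

lemma teich_ring_subset_witt: "teich_ring \<subseteq> witt"
  by (force intro!: wittI)

lemma N_witt:
  assumes "x \<in> witt"
  shows "N x \<le> 1"
proof -
  obtain a where "a \<in> teich_ring" "N (x - a) < 1"
    using wittD[OF assms, of 1] by auto
  then show ?thesis
    using N_add_le[of "x - a" 1 a] N_teich_ring by simp
qed

lemma is_subring_witt: "is_subring witt"
  unfolding is_subring_def
proof (intro conjI ballI)
  note A = is_subring_teich_ring
  show "0 \<in> witt" "1 \<in> witt"
    using teich_ring_subset_witt is_subringD(1,2)[OF A] by auto
  fix x assume x: "x \<in> witt"
  show "- x \<in> witt"
  proof (rule wittI)
    fix e :: real assume "0 < e"
    then obtain a where "a \<in> teich_ring" "N (x - a) < e"
      using wittD[OF x] by blast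
    then show "\<exists>a\<in>teich_ring. N (- x - a) < e"
      using N_minus[of "x - a"] by (intro bexI[of _ "- a"] is_subringD(5)[OF A]) (simp_all add: N_minus_commute)
  qed
  fix y assume y: "y \<in> witt"
  show "x + y \<in> witt"
  proof (rule wittI)
    fix e :: real assume "0 < e"
    then obtain a b where "a \<in> teich_ring" "N (x - a) < e" "b \<in> teich_ring" "N (y - b) < e"
      using wittD[OF x] wittD[OF y] by blast
    then show "\<exists>a\<in>teich_ring. N (x + y - a) < e"
      using N_add_less[of "x - a" e "y - b"]
      by (intro bexI[of _ "a + b"] is_subringD(3)[OF A]) (simp_all add: algebra_simps)
  qed
  show "x * y \<in> witt"
  proof (rule wittI)
    fix e :: real assume "0 < e"
    then obtain a b where ab: "a \<in> teich_ring" "N (x - a) < e" "b \<in> teich_ring" "N (y - b) < e"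
      using wittD[OF x] wittD[OF y] by blast
    have "N (x * (y - b)) < e"
      using N_witt[OF x] ab(4) mult_left_le_one_le[of "N (y - b)" "N x"] by (simp add: N_mult)
    moreover have "N (b * (x - a)) < e"
      using N_teich_ring[OF ab(3)] ab(2) mult_left_le_one_le[of "N (x - a)" "N b"] by (simp add: N_mult)
    ultimately have "N (x * (y - b) + b * (x - a)) < e"
      by (rule N_add_less)
    then have "N (x * y - a * b) < e"
      by (simp add: algebra_simps)
    then show "\<exists>a\<in>teich_ring. N (x * y - a) < e"
      using is_subringD(4)[OF A ab(1,3)] by blast
  qed
qed

text \<open>Thus \<open>p\<close> generates the maximal ideal of \<open>witt\<close>, and this makes
  the values discrete.\<close>

lemma witt_divide_p:
  assumes x: "x \<in> witt" "N x < 1"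
  shows "x / of_nat p \<in> witt"
proof (rule wittI)
  fix e :: real assume e: "0 < e"
  \<comment> \<open>The bound 1 ensures \<open>N a < 1\<close> for the approximation
    \<open>a\<close>; the other bound becomes \<open>e\<close> after division by
    \<open>p\<close>.\<close>
  then have "0 < min 1 (e * N (of_nat p))"
    using Np_pos by simp
  then obtain a where a: "a \<in> teich_ring" "N (x - a) < min 1 (e * N (of_nat p))"
    using wittD[OF x(1)] by blast
  then have "N a < 1"
    using N_diff_less[of x 1 "x - a"] x(2) by simp
  then obtain c where c: "c \<in> teich_ring" "N (a / of_nat p - c) < e"
    using teich_ring_divide_p[OF a(1) _ e] by blast
  have "N ((x - a) / of_nat p) < e"
    using a(2) Np_pos by (simp add: N_divide field_simps)
  then have "N ((x - a) / of_nat p + (a / of_nat p - c)) < e"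
    using c(2) by (rule N_add_less)
  then have "N (x / of_nat p - c) < e"
    by (simp add: diff_divide_distrib)
  then show "\<exists>a\<in>teich_ring. N (x / of_nat p - a) < e"
    using c(1) by blast
qed

text \<open>Divide by \<open>p\<close> until a unit is reached; an \<open>n\<close> with
  \<open>N p ^ n < N x\<close> bounds the number of divisions.\<close>

lemma N_witt_value:
  assumes "x \<in> witt" "x \<noteq> 0"
  shows "\<exists>k. N x = N (of_nat p) ^ k"
proof -
  obtain n where "N (of_nat p) ^ n < N x"
    using small_power N_pos[OF assms(2)] by blast
  then show ?thesis
    using assms
  proof (induction n arbitrary: x)
    case 0
    then show ?case
      using N_witt[of x] by simp
  next
    case (Suc n)
    show ?case
    proof (cases "N x = 1")
      case True
      then show ?thesis
        by (intro exI[of _ 0]) simp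
    next
      case False
      then have "N x < 1"
        using N_witt[OF Suc.prems(2)] by simp
      then have "x / of_nat p \<in> witt"
        by (rule witt_divide_p[OF Suc.prems(2)])
      moreover have "N (of_nat p) ^ n < N (x / of_nat p)"
        using Suc.prems(1) Np_pos by (simp add: N_divide field_simps)
      moreover have "x / of_nat p \<noteq> 0"
        using Suc.prems(3) p(2) by simp
      ultimately obtain k where "N (x / of_nat p) = N (of_nat p) ^ k"
        using Suc.IH by blast
      then have "N x = N (of_nat p) ^ Suc k"
        using Np_pos by (simp add: N_divide field_simps)
      then show ?thesis
        by blast
    qed
  qed
qed

lemma p_power_in_witt: "of_nat p ^ k \<in> witt"
  by (intro is_subring_power is_subring_of_nat is_subring_witt)

lemma is_subring_witt_frac: "is_subring witt_frac"
  unfolding is_subring_def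
proof (intro conjI ballI)
  note W = is_subring_witt
  show "0 \<in> witt_frac" "1 \<in> witt_frac"
    using is_subringD(1,2)[OF W] by (auto simp: witt_frac_def intro!: exI[of _ 0])
  fix x assume "x \<in> witt_frac"
  then obtain k where k: "of_nat p ^ k * x \<in> witt"
    by (auto simp: witt_frac_def)
  show "- x \<in> witt_frac"
    using is_subringD(5)[OF W k] by (auto simp: witt_frac_def)
  fix y assume "y \<in> witt_frac"
  then obtain l where l: "of_nat p ^ l * y \<in> witt"
    by (auto simp: witt_frac_def)
  have "of_nat p ^ l * (of_nat p ^ k * x) + of_nat p ^ k * (of_nat p ^ l * y) \<in> witt"
    by (intro is_subringD(3,4)[OF W] k l p_power_in_witt)
  then have "of_nat p ^ (k + l) * (x + y) \<in> witt"
    by (simp add: algebra_simps power_add)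
  then show "x + y \<in> witt_frac"
    by (auto simp: witt_frac_def)
  have "(of_nat p ^ k * x) * (of_nat p ^ l * y) \<in> witt"
    by (intro is_subringD(4)[OF W] k l)
  then have "of_nat p ^ (k + l) * (x * y) \<in> witt"
    by (simp add: power_add mult_ac)
  then show "x * y \<in> witt_frac"
    by (auto simp: witt_frac_def)
qed

lemma witt_subset_witt_frac: "witt \<subseteq> witt_frac"
  by (force simp: witt_frac_def intro!: exI[of _ 0])

lemma teich_subset_witt_frac: "teich \<subseteq> witt_frac"
  using teich_ring_subset_witt witt_subset_witt_frac
  by (auto intro!: teich_ringI[of "[_]"] dest!: subsetD)

lemma N_witt_frac_value:
  assumes "x \<in> witt_frac" "x \<noteq> 0"
  shows "\<exists>k. N x = N (of_nat p) powi k"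
proof -
  obtain k where k: "of_nat p ^ k * x \<in> witt"
    using assms(1) by (auto simp: witt_frac_def)
  have p0: "(of_nat p :: 'a) \<noteq> 0"
    using p(2) by simp
  obtain l where "N (of_nat p ^ k * x) = N (of_nat p) ^ l"
    using N_witt_value[OF k] assms(2) p0 by auto
  then have "N x = N (of_nat p) powi (int l - int k)"
    using Np_pos by (simp add: N_mult N_power power_int_diff field_simps)
  then show ?thesis
    by blast
qed

text \<open>A \<open>p\<close>-integral rational has a denominator \<open>b\<close> prime to
  \<open>p\<close>; replacing \<open>1 / b\<close> by an inverse of \<open>b\<close> modulo
  \<open>p ^ k\<close> costs at most \<open>N p ^ k\<close>.\<close>

lemma rat_approx_int:
  assumes q: "N (of_rat q) \<le> 1" and e: "0 < e"
  shows "\<exists>m. N (of_rat q - of_int m) < e"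
proof -
  obtain a b where ab: "quotient_of q = (a, b)"
    by force
  then have b: "b > 0" "coprime a b" and qab: "q = of_int a / of_int b"
    using quotient_of_denom_pos quotient_of_coprime quotient_of_div by blast+
  have q_eq: "(of_rat q :: 'a) = of_int a / of_int b"
    by (simp add: qab of_rat_divide)
  have "\<not> int p dvd b"
  proof
    assume pb: "int p dvd b"
    then have "\<not> int p dvd a"
      using coprime_common_divisor[OF b(2) _ pb] p(2) by auto
    then have "N (of_int a) = 1"
      by (rule N_of_int_unit)
    moreover have "N (of_int b) < 1" "0 < N (of_int b)"
      using N_of_int_multiple[OF pb] b(1) by (auto intro: N_pos)
    ultimately show False
      using q by (simp add: q_eq N_divide field_simps)
  qed
  then have Nb: "N (of_int b) = 1" and cop: "coprime b (int p)"
    using p(1) N_of_int_unit by (blast, metis coprime_commute prime_imp_coprime prime_nat_int_transfer)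
  obtain k where k: "N (of_nat p) ^ k < e"
    using small_power[OF e] by blast
  have "coprime b (int p ^ k)"
    using cop by simp
  then obtain b' where "[b * b' = 1] (mod int p ^ k)"
    using cong_solve_coprime_int by blast
  then obtain z where z: "1 - b * b' = int p ^ k * z"
    by (metis cong_iff_dvd_diff cong_sym dvd_def)
  have "(of_rat q - of_int (a * b') :: 'a) = of_int a * of_int (1 - b * b') / of_int b"
    using b(1) by (simp add: q_eq field_simps)
  then have "N (of_rat q - of_int (a * b')) = N (of_int a) * N (of_int (int p ^ k * z))"
    by (simp only: z N_divide N_mult Nb div_by_1)
  also have "\<dots> = N (of_int a * of_int z) * N (of_nat p) ^ k"
    by (simp add: N_mult N_power)
  also have "\<dots> \<le> N (of_nat p) ^ k"
    using N_mult_le1[OF N_of_int N_of_int] by (intro mult_left_le_one_le) auto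
  also have "\<dots> < e"
    by (rule k)
  finally show ?thesis
    by blast
qed

lemma rat_hull_approx_int:
  assumes y: "y \<in> rat_hull" "N y \<le> 1" and e: "0 < e"
  shows "\<exists>m. N (y - of_int m) < e"
proof -
  obtain q where q: "N (y - of_rat q) < min 1 e"
    using y(1) e by (auto simp: rat_hull_def dest: spec[of _ "min 1 e"])
  then have "N (of_rat q) \<le> 1"
    using N_diff_le[of y 1 "y - of_rat q"] y(2) by simp
  then obtain m where "N (of_rat q - of_int m) < e"
    using rat_approx_int[OF _ e] by blast
  then have "N ((y - of_rat q) + (of_rat q - of_int m)) < e"
    using q by (intro N_add_less) auto
  then show ?thesis
    by auto
qed

lemma rat_hull_mult_rat:
  assumes "y \<in> rat_hull"
  shows "of_rat r * y \<in> rat_hull"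
  unfolding rat_hull_def
proof (intro CollectI allI impI)
  fix e :: real assume "0 < e"
  have pos: "0 < N (of_rat r) + 1"
    by (simp add: add_nonneg_pos)
  with \<open>0 < e\<close> have "0 < e / (N (of_rat r) + 1)"
    by simp
  then obtain q where q: "N (y - of_rat q) < e / (N (of_rat r) + 1)"
    using assms by (auto simp: rat_hull_def)
  have "N (of_rat r * y - of_rat (r * q)) = N (of_rat r) * N (y - of_rat q)"
    by (simp add: of_rat_mult right_diff_distrib flip: N_mult)
  also have "\<dots> \<le> (N (of_rat r) + 1) * N (y - of_rat q)"
    by (intro mult_right_mono) auto
  also have "\<dots> < e"
    using q by (simp only: pos_less_divide_eq[OF pos] mult.commute)
  finally show "\<exists>q. N (of_rat r * y - of_rat q) < e"
    by blast
qed

text \<open>A power of \<open>p\<close> makes \<open>y\<close> integral, and an integral element of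
  \<open>rat_hull\<close> is a limit of integers.\<close>

lemma rat_hull_subset_witt_frac: "rat_hull \<subseteq> witt_frac"
proof
  fix y assume y: "y \<in> rat_hull"
  have pos: "0 < N y + 1"
    by (simp add: add_nonneg_pos)
  then obtain k where "N (of_nat p) ^ k < 1 / (N y + 1)"
    using small_power[of "1 / (N y + 1)"] by auto
  then have "N (of_nat p) ^ k * (N y + 1) < 1"
    by (simp only: pos_less_divide_eq[OF pos])
  then have "N (of_nat p) ^ k * (N y + 1) \<le> 1"
    by simp
  moreover have "N (of_nat p) ^ k * N y \<le> N (of_nat p) ^ k * (N y + 1)"
    by (intro mult_left_mono) auto
  ultimately have "N (of_nat p ^ k * y) \<le> 1"
    by (simp add: N_mult N_power)
  moreover have "of_nat p ^ k * y \<in> rat_hull"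
    using rat_hull_mult_rat[OF y, of "of_nat p ^ k"] by (simp add: of_rat_power)
  ultimately have "of_nat p ^ k * y \<in> witt"
    using rat_hull_approx_int is_subring_of_int[OF is_subring_teich_ring]
    by (intro wittI) blast
  then show "y \<in> witt_frac"
    by (auto simp: witt_frac_def)
qed

text \<open>Modulo the maximal ideal \<open>(u - 1) ^ p\<close> equals \<open>u ^ p - 1\<close>, so
  the residue field has no nontrivial roots of unity of \<open>p\<close>-power order.\<close>

lemma residue_frobenius_inj:
  assumes "N z \<le> 1" "N (z ^ (p ^ a) - 1) < 1"
  shows "N (z - 1) < 1"
  using assms
proof (induction a arbitrary: z)
  case (Suc a)
  have S: "is_subring {x. N x \<le> 1}"
    by (auto simp: is_subring_def intro: N_add_le N_mult_le1)
  define u where "u = z ^ (p ^ a)"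
  have u: "N u \<le> 1"
    using Suc.prems(1) by (simp add: u_def N_power_le1)
  obtain c where c: "N c \<le> 1" "(u + - 1) ^ p = u ^ p + (- 1) ^ p + of_nat p * c"
    using frobenius_add[OF S p(1), of u "- 1"] u by auto
  have "odd p"
    using p prime_odd_nat by blast
  then have "(u - 1) ^ p = (u ^ p - 1) + of_nat p * c"
    using c(2) by simp
  moreover have "u ^ p = z ^ (p ^ Suc a)"
    by (simp only: u_def power_mult[symmetric] power_Suc2)
  ultimately have "N ((u - 1) ^ p) < 1"
    using Suc.prems(2) c(1) Np by (auto intro!: N_add_less N_mult_less1')
  then have "N (u - 1) < 1"
    by (metis N_power linorder_not_less one_le_power)
  then show ?case
    using Suc by (simp add: u_def)
qed simp

text \<open>The residue of \<open>y\<close> is a root of unity. The \<open>p\<close>-part of the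
  period is removed by injectivity of Frobenius, and with the remaining exponent \<open>n\<close>
  the polynomial \<open>monom 1 n - 1\<close> has a root in the class of \<open>y\<close>.\<close>

lemma teich_of_periodic:
  assumes y: "N y = 1" and kl: "N (y ^ k - y ^ l) < 1" "k < l"
  shows "\<exists>t\<in>teich. N (y - t) < 1"
proof -
  have "y ^ k - y ^ l = y ^ k * (1 - y ^ (l - k))"
    using kl(2) by (simp add: right_diff_distrib flip: power_add)
  then have per: "N (y ^ (l - k) - 1) < 1"
    using kl(1) y by (simp add: N_mult N_power N_minus_commute)
  have "l - k \<noteq> 0" "\<not> is_unit p"
    using kl(2) p(2) by auto
  then obtain n where n: "l - k = p ^ multiplicity p (l - k) * n" "\<not> p dvd n"
    using multiplicity_decompose'[of "l - k" p] by metis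
  have "N ((y ^ n) ^ (p ^ multiplicity p (l - k)) - 1) < 1"
    using per n(1) by (metis mult.commute power_mult)
  then have near: "N (y ^ n - 1) < 1"
    by (rule residue_frobenius_inj[rotated]) (simp add: N_power y)
  have n0: "n > 0"
    using n(2) by (cases n) auto
  define w :: "'a poly" where "w = monom 1 n - 1"
  have "coeff w n = 1"
    using n0 by (simp add: w_def)
  moreover have "poly w z = z ^ n - 1" for z
    by (simp add: w_def poly_monom)
  ultimately obtain r where "poly w r = 0" "N (y - r) < 1"
    using root_near[OF ac, of y w n] y near by auto
  then show ?thesis
    using n n0 by (intro bexI[of _ r]) (auto simp: teich_def w_def poly_monom)
qed

text \<open>A monic integer relation modulo the maximal ideal writes every power of \<open>y\<close>
  with \<open>n\<close> digits below \<open>p\<close>, which leaves only finitely many residues of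
  powers.\<close>

lemma powers_residue_finite:
  assumes y: "N y \<le> 1" and n: "0 < n"
    and h: "N (y ^ n - (\<Sum>i<n. of_int (h i) * y ^ i)) < 1"
  shows "\<exists>f. (\<forall>i<n. f i \<in> {0..<int p}) \<and> N (y ^ k - (\<Sum>i<n. of_int (f i) * y ^ i)) < 1"
proof -
  have reduce: "\<exists>f. (\<forall>i<n. f i \<in> {0..<int p}) \<and> N (x - (\<Sum>i<n. of_int (f i) * y ^ i)) < 1"
    if "N (x - (\<Sum>i<n. of_int (g i) * y ^ i)) < 1" for x g
  proof (intro exI[of _ "\<lambda>i. g i mod int p"] conjI allI impI)
    have "N ((of_int (g i) - of_int (g i mod int p)) * y ^ i) < 1" for i
    proof -
      have "N (of_int (g i - g i mod int p)) < 1"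
        by (rule N_of_int_multiple) (simp add: mod_eq_dvd_iff[symmetric])
      then show ?thesis
        by (intro N_mult_less1' N_power_le1 y) simp
    qed
    then have "N (\<Sum>i<n. (of_int (g i) - of_int (g i mod int p)) * y ^ i) < 1"
      by (intro N_sum_less) auto
    then have "N ((x - (\<Sum>i<n. of_int (g i) * y ^ i))
        + (\<Sum>i<n. (of_int (g i) - of_int (g i mod int p)) * y ^ i)) < 1"
      by (intro N_add_less that)
    then show "N (x - (\<Sum>i<n. of_int (g i mod int p) * y ^ i)) < 1"
      by (simp add: left_diff_distrib sum_subtractf)
  qed (use p(2) in simp)
  have "\<exists>g. N (y ^ k - (\<Sum>i<n. of_int (g i) * y ^ i)) < 1"
  proof (induction k)
    case 0
    have "(\<Sum>i<n. of_int (if i = 0 then 1 else 0) * y ^ i) = 1"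
      using n by (simp add: if_distrib[of of_int] if_distrib[of "\<lambda>x. x * _"] sum.delta cong: if_cong)
    then show ?case
      by (intro exI[of _ "\<lambda>i. if i = 0 then 1 else 0"]) simp
  next
    case (Suc k)
    then obtain g where g: "N (y ^ k - (\<Sum>i<n. of_int (g i) * y ^ i)) < 1"
      by blast
    obtain m where m: "n = Suc m"
      using n by (cases n) auto
    \<comment> \<open>Multiplication by \<open>y\<close> shifts the digits; the overflowing term
      \<open>g m * y ^ n\<close> is rewritten with the relation \<open>h\<close>.\<close>
    define g' where "g' = (\<lambda>i. (if i = 0 then 0 else g (i - 1)) + g m * h i)"
    have "(\<Sum>i<n. of_int (g' i) * y ^ i)
        = (\<Sum>i<n. of_int (if i = 0 then 0 else g (i - 1)) * y ^ i)
          + of_int (g m) * (\<Sum>i<n. of_int (h i) * y ^ i)"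
      by (simp add: g'_def distrib_right sum.distrib sum_distrib_left mult.assoc)
    also have "(\<Sum>i<n. of_int (if i = 0 then 0 else g (i - 1)) * y ^ i)
        = (\<Sum>i<m. of_int (g i) * y ^ Suc i)"
      unfolding m sum.lessThan_Suc_shift by simp
    finally have "y ^ Suc k - (\<Sum>i<n. of_int (g' i) * y ^ i)
        = y * (y ^ k - (\<Sum>i<n. of_int (g i) * y ^ i))
          + of_int (g m) * (y ^ n - (\<Sum>i<n. of_int (h i) * y ^ i))"
      by (simp add: m algebra_simps sum_distrib_left)
    moreover have "N \<dots> < 1"
      by (intro N_add_less N_mult_less1 y g h N_of_int)
    ultimately show ?case
      by metis
  qed
  then show ?thesis
    using reduce by blast
qed

text \<open>The relation is scaled to largest coefficient of absolute value 1, rounded to integer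
  coefficients and made monic modulo \<open>p\<close>. The pigeonhole principle then finds two
  powers of \<open>y\<close> with the same residue.\<close>

lemma residue_teich:
  assumes y: "N y \<le> 1"
    and c: "\<And>i. i \<le> n \<Longrightarrow> c i \<in> rat_hull" "\<exists>i\<le>n. c i \<noteq> 0" "(\<Sum>i\<le>n. c i * y ^ i) = 0"
  shows "\<exists>t\<in>teich. N (y - t) < 1"
proof (cases "N y = 1")
  case False
  then have "N (y - 0) < 1"
    using y by simp
  then show ?thesis
    by (intro bexI[of _ 0]) (auto simp: teich_def)
next
  case y1: True
  obtain j where j: "j \<le> n" "\<And>i. i \<le> n \<Longrightarrow> N (c i) \<le> N (c j)"
  proof -
    have "Max ((\<lambda>i. N (c i)) ` {..n}) \<in> (\<lambda>i. N (c i)) ` {..n}"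
      by (intro Max_in) auto
    then obtain j where j: "Max ((\<lambda>i. N (c i)) ` {..n}) = N (c j)" "j \<in> {..n}"
      by (rule imageE)
    have "N (c i) \<le> N (c j)" if "i \<le> n" for i
      unfolding j(1)[symmetric] using that by (intro Max_ge) auto
    with j(2) show thesis
      by (intro that[of j]) auto
  qed
  have "c j \<noteq> 0"
    using c(2) j by (metis N_eq_0 N_nonneg order_antisym)
  \<comment> \<open>A rational \<open>q\<close> with the absolute value of the largest coefficient:
    scaling by its inverse stays in \<open>rat_hull\<close>.\<close>
  then obtain q where q: "N (c j - of_rat q) < N (c j)"
    using c(1)[OF j(1)] N_pos[of "c j"] unfolding rat_hull_def by blast
  have Nq: "N (of_rat q) = N (c j)"
    using q N_eqI[of "of_rat q" "c j"] by (simp add: N_minus_commute)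
  then have q0: "q \<noteq> 0" "N (of_rat q) > 0"
    using N_pos[OF \<open>c j \<noteq> 0\<close>] by auto
  define c' where "c' = (\<lambda>i. of_rat (inverse q) * c i)"
  have c'_eq: "c' i = c i / of_rat q" for i
    by (simp add: c'_def of_rat_inverse divide_inverse)
  have c': "c' i \<in> rat_hull" "N (c' i) \<le> 1" if "i \<le> n" for i
  proof -
    show "c' i \<in> rat_hull"
      unfolding c'_def by (rule rat_hull_mult_rat[OF c(1)[OF that]])
    show "N (c' i) \<le> 1"
      using j(2)[OF that] q0 by (simp add: c'_eq N_divide Nq)
  qed
  have c'j: "N (c' j) = 1"
    using q0 Nq \<open>c j \<noteq> 0\<close> by (simp add: c'_eq N_divide)
  have "(\<Sum>i\<le>n. c' i * y ^ i) = of_rat (inverse q) * (\<Sum>i\<le>n. c i * y ^ i)"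
    by (simp add: c'_def sum_distrib_left mult.assoc)
  then have c'0: "(\<Sum>i\<le>n. c' i * y ^ i) = 0"
    by (simp add: c(3))
  have "\<forall>i. \<exists>m. i \<le> n \<longrightarrow> N (c' i - of_int m) < 1"
    using rat_hull_approx_int[OF c', of _ 1] by auto
  then obtain m where m: "\<And>i. i \<le> n \<Longrightarrow> N (c' i - of_int (m i)) < 1"
    by metis
  have "N (\<Sum>i\<le>n. (c' i - of_int (m i)) * y ^ i) < 1"
    by (intro N_sum_less N_mult_less1' N_power_le1 m y) auto
  then have rel: "N (\<Sum>i\<le>n. of_int (m i) * y ^ i) < 1"
    using c'0 by (simp add: left_diff_distrib sum_subtractf)
  have "\<not> int p dvd m j"
  proof
    assume "int p dvd m j"
    then have "N ((c' j - of_int (m j)) + of_int (m j)) < 1"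
      by (intro N_add_less m j(1) N_of_int_multiple)
    then show False
      using c'j by simp
  qed
  \<comment> \<open>Degree of the rounded relation modulo \<open>p\<close>; higher terms are
    absorbed into the error.\<close>
  define D where "D = Max {i. i \<le> n \<and> \<not> int p dvd m i}"
  have fin: "finite {i. i \<le> n \<and> \<not> int p dvd m i}" "{i. i \<le> n \<and> \<not> int p dvd m i} \<noteq> {}"
    using j(1) \<open>\<not> int p dvd m j\<close> by auto
  have D: "D \<le> n" "\<not> int p dvd m D"
    using Max_in[OF fin] by (auto simp: D_def)
  have above: "int p dvd m i" if "i \<le> n" "D < i" for i
  proof (rule ccontr)
    assume "\<not> int p dvd m i"
    then have "i \<le> D"
      unfolding D_def using that(1) by (intro Max_ge fin) auto
    then show False
      using that(2) by simp
  qed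
  have "{..n} = {..D} \<union> {D<..n}"
    using D(1) by auto
  then have "(\<Sum>i\<le>n. of_int (m i) * y ^ i)
      = (\<Sum>i\<le>D. of_int (m i) * y ^ i) + (\<Sum>i\<in>{D<..n}. of_int (m i) * y ^ i)"
    by (simp add: sum.union_disjoint ivl_disj_int)
  moreover have tail: "N (\<Sum>i\<in>{D<..n}. of_int (m i) * y ^ i) < 1"
    by (intro N_sum_less N_mult_less1' N_power_le1 y N_of_int_multiple above) auto
  ultimately have relD: "N (\<Sum>i\<le>D. of_int (m i) * y ^ i) < 1"
    using N_diff_less[OF rel tail] by simp
  have "D \<noteq> 0"
  proof
    assume "D = 0"
    then show False
      using relD N_of_int_unit[OF D(2)] by simp
  qed
  have "coprime (m D) (int p)"
    using D(2) p(1) by (metis coprime_commute prime_imp_coprime prime_nat_int_transfer)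
  \<comment> \<open>Inverting the leading coefficient modulo \<open>p\<close> makes the relation
    monic up to an error in the maximal ideal.\<close>
  then obtain u where "[m D * u = 1] (mod int p)"
    using cong_solve_coprime_int by blast
  then have "N (of_int (m D * u - 1)) < 1"
    by (intro N_of_int_multiple) (simp add: cong_iff_dvd_diff)
  then have mu: "N (of_int (m D * u - 1) * y ^ D) < 1"
    by (intro N_mult_less1' N_power_le1 y)
  have "N (of_int u * (\<Sum>i\<le>D. of_int (m i) * y ^ i) - of_int (m D * u - 1) * y ^ D) < 1"
    by (rule N_diff_less[OF N_mult_less1[OF N_of_int relD] mu])
  also have "of_int u * (\<Sum>i\<le>D. of_int (m i) * y ^ i) - of_int (m D * u - 1) * y ^ D
      = y ^ D - (\<Sum>i<D. of_int (- u * m i) * y ^ i)"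
    by (simp add: lessThan_Suc_atMost[symmetric] sum_distrib_left sum_negf algebra_simps)
  finally have h: "N (y ^ D - (\<Sum>i<D. of_int (- u * m i) * y ^ i)) < 1" .
  have "\<forall>k. \<exists>f. (\<forall>i<D. f i \<in> {0..<int p}) \<and> N (y ^ k - (\<Sum>i<D. of_int (f i) * y ^ i)) < 1"
    using powers_residue_finite[OF y _ h] \<open>D \<noteq> 0\<close> by auto
  then obtain f where f: "\<And>k i. i < D \<Longrightarrow> f k i \<in> {0..<int p}"
      "\<And>k. N (y ^ k - (\<Sum>i<D. of_int (f k i) * y ^ i)) < 1"
    by metis
  \<comment> \<open>Restriction makes digit sequences comparable as functions, so that they lie in a
    finite \<open>PiE\<close>.\<close>
  define g where "g = (\<lambda>k. restrict (f k) {..<D})"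
  have "range g \<subseteq> PiE {..<D} (\<lambda>_. {0..<int p})"
    using f(1) by (auto simp: g_def split: if_splits)
  then have "finite (range g)"
    by (rule finite_subset) (intro finite_PiE; simp)
  then have "\<not> inj g"
    using finite_imageD infinite_UNIV_nat by blast
  then obtain k l where kl: "k < l" "g k = g l"
    by (metis injI linorder_neqE_nat)
  have "f k i = f l i" if "i < D" for i
    using fun_cong[OF kl(2), of i] that by (simp add: g_def)
  then have "(\<Sum>i<D. of_int (f k i) * y ^ i) = (\<Sum>i<D. of_int (f l i) * y ^ i)"
    by (intro sum.cong) auto
  then have "N (y ^ k - y ^ l) < 1"
    using N_diff_less[OF f(2)[of k] f(2)[of l]] by simp
  then show ?thesis
    by (rule teich_of_periodic[OF y1 _ kl(1)])
qed

end

section \<open>Discreteness of the values fixed by inertia\<close>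

locale padic_closure = nonarch_p N p for N :: "'a::field_char_0 \<Rightarrow> real" and p +
  fixes K :: "'a set"
  assumes K_field: "is_subfield K" and K_complete: "complete_abs K"
    and K_finite: "finite_extension rat_hull K" and K_algebraic: "algebraic_over K"
begin

definition inert :: "('a \<Rightarrow> 'a) set" where
  "inert = {\<sigma>. \<forall>x. N x \<le> 1 \<longrightarrow> N (\<sigma> x - x) < 1}"

lemma is_subring_rat_hull: "is_subring rat_hull"
  unfolding is_subring_def
proof (intro conjI ballI)
  have rat: "of_rat q \<in> rat_hull" for q
    unfolding rat_hull_def by (force intro!: exI[of _ q])
  show "0 \<in> rat_hull" "1 \<in> rat_hull"
    using rat[of 0] rat[of 1] by simp_all
  fix x assume x: "x \<in> rat_hull"
  show "- x \<in> rat_hull"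
    using rat_hull_mult_rat[OF x, of "- 1"] by simp
  fix y assume y: "y \<in> rat_hull"
  show "x + y \<in> rat_hull"
    unfolding rat_hull_def
  proof (intro CollectI allI impI)
    fix e :: real assume "0 < e"
    then obtain q r where "N (x - of_rat q) < e" "N (y - of_rat r) < e"
      using x y unfolding rat_hull_def by blast
    then have "N ((x - of_rat q) + (y - of_rat r)) < e"
      by (rule N_add_less)
    then show "\<exists>q. N (x + y - of_rat q) < e"
      by (intro exI[of _ "q + r"]) (simp add: of_rat_add algebra_simps)
  qed
  show "x * y \<in> rat_hull"
    unfolding rat_hull_def
  proof (intro CollectI allI impI)
    fix e :: real assume e: "0 < e"
    have pos: "0 < N x + 1"
      by (simp add: add_nonneg_pos)
    then obtain r where r: "N (y - of_rat r) < e / (N x + 1)"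
      using y e unfolding rat_hull_def by (auto dest: spec[of _ "e / (N x + 1)"])
    have "of_rat r * x \<in> rat_hull"
      by (rule rat_hull_mult_rat[OF x])
    then obtain q where q: "N (of_rat r * x - of_rat q) < e"
      using e unfolding rat_hull_def by blast
    have "N (x * (y - of_rat r)) \<le> (N x + 1) * N (y - of_rat r)"
      by (simp add: N_mult mult_right_mono)
    also have "\<dots> < e"
      using r by (simp only: pos_less_divide_eq[OF pos] mult.commute)
    finally have "N (x * (y - of_rat r) + (of_rat r * x - of_rat q)) < e"
      using q by (rule N_add_less)
    then show "\<exists>q. N (x * y - of_rat q) < e"
      by (intro exI[of _ q]) (simp add: algebra_simps)
  qed
qed

text \<open>\<open>y\<close> is algebraic over \<open>K\<close>, and \<open>K\<close> is finite over
  \<open>rat_hull\<close>, so all powers of \<open>y\<close> lie in one finitely generated span over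
  \<open>rat_hull\<close> and satisfy a relation there.\<close>

lemma residue_teich_all:
  assumes y: "N y \<le> 1"
  shows "\<exists>t\<in>teich. N (y - t) < 1"
proof -
  have Kr: "is_subring K"
    by (rule is_subfield_imp_subring[OF K_field])
  obtain q where "q \<noteq> 0" "\<forall>i. coeff q i \<in> K" "poly q y = 0"
    using K_algebraic unfolding algebraic_over_def by blast
  then obtain n where n: "0 < n" "y ^ n \<in> lspan K ((\<lambda>i. y ^ i) ` {..<n})"
    using algebraic_power_in_lspan[OF K_field] by metis
  obtain C where C: "finite C" "K = lspan rat_hull C"
    by (rule finite_extensionE[OF K_finite])
  define D where "D = (\<lambda>(b, c). b * c) ` (((\<lambda>i. y ^ i) ` {..<n}) \<times> C)"
  have D: "finite D" "lspan K ((\<lambda>i. y ^ i) ` {..<n}) \<subseteq> lspan rat_hull D"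
    unfolding D_def using C
    by (simp, intro lspan_trans[OF is_subring_rat_hull _ C(1) subset_refl]) auto
  have yD: "y ^ i \<in> lspan rat_hull D" for i
    using power_in_lspan_powers[OF Kr n(2,1)] D(2) by (rule subsetD[rotated])
  obtain w where w: "\<And>i. i \<in> {..card D} \<Longrightarrow> w i \<in> rat_hull" "\<exists>i\<in>{..card D}. w i \<noteq> 0"
      "(\<Sum>i\<in>{..card D}. w i * y ^ i) = 0"
    by (rule lspan_dependent[OF is_subring_rat_hull D(1) finite_atMost[of "card D"], of "\<lambda>i. y ^ i"])
      (use yD in auto)
  show ?thesis
  proof (rule residue_teich[OF y])
    show "w i \<in> rat_hull" if "i \<le> card D" for i
      using w(1) that by simp
    show "\<exists>i\<le>card D. w i \<noteq> 0"
      using w(2) by auto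
    show "(\<Sum>i\<le>card D. w i * y ^ i) = 0"
      using w(3) by simp
  qed
qed

lemma N_galois_K: "\<sigma> \<in> galois_group K \<Longrightarrow> N (\<sigma> x) = N x"
  by (rule N_galois[OF K_field K_complete K_algebraic])

text \<open>The largest absolute value is attained by exactly one term, which therefore dominates
  the sum.\<close>

lemma N_sum_distinct:
  assumes "finite I" "\<exists>i\<in>I. f i \<noteq> 0"
    and "\<And>i j. i \<in> I \<Longrightarrow> j \<in> I \<Longrightarrow> i \<noteq> j \<Longrightarrow> f i \<noteq> 0 \<Longrightarrow> f j \<noteq> 0 \<Longrightarrow> N (f i) \<noteq> N (f j)"
  shows "sum f I \<noteq> 0"
proof -
  have "Max ((\<lambda>i. N (f i)) ` I) \<in> (\<lambda>i. N (f i)) ` I"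
    using assms(1,2) by (intro Max_in) auto
  then obtain j where j: "Max ((\<lambda>i. N (f i)) ` I) = N (f j)" "j \<in> I"
    by (rule imageE)
  have max: "N (f i) \<le> N (f j)" if "i \<in> I" for i
    unfolding j(1)[symmetric] using that assms(1) by (intro Max_ge) auto
  have nz: "f j \<noteq> 0"
    using assms(2) max by (metis N_0 N_pos not_less)
  have "N (f i) < N (f j)" if "i \<in> I - {j}" for i
    using max[of i] assms(3)[of i j] that j(2) nz N_pos[OF nz] by (cases "f i = 0") force+
  then have "N (sum f (I - {j})) < N (f j)"
    using N_pos[OF nz] by (intro N_sum_less)
  then have "N (f j + sum f (I - {j})) = N (f j)"
    by (rule N_dominant)
  then have "N (sum f I) = N (f j)"
    using assms(1) j(2) by (simp add: sum.remove)
  then show ?thesis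
    using nz by auto
qed

text \<open>With \<open>r = card D\<close>, the \<open>r + 1\<close> monomials of degree
  \<open>r\<close> in \<open>m\<close> and \<open>n\<close> are dependent. Two nonzero terms of the
  relation have equal absolute value, so \<open>N (m / n) ^ (j - i)\<close> is a value of
  \<open>witt_frac\<close>; the exponent is at most \<open>r\<close> and divides
  \<open>fact r\<close>.\<close>

lemma value_of_quotient:
  assumes D: "finite D" and ring: "is_subring (lspan witt_frac D)"
    and mn: "m \<in> lspan witt_frac D" "n \<in> lspan witt_frac D" "m \<noteq> 0" "n \<noteq> 0"
  shows "\<exists>k. N (m / n) ^ fact (card D) = N (of_nat p) powi k"
proof -
  define r where "r = card D"
  \<comment> \<open>Homogeneous monomials are used instead of powers of \<open>m / n\<close>, which
    may lie outside the span.\<close>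
  define z where "z = (\<lambda>i. m ^ i * n ^ (r - i))"
  have "z i \<in> lspan witt_frac D" for i
    unfolding z_def by (intro is_subringD(4)[OF ring] is_subring_power ring mn)
  then obtain w where w: "\<And>i. i \<in> {..r} \<Longrightarrow> w i \<in> witt_frac" "\<exists>i\<in>{..r}. w i \<noteq> 0"
      "(\<Sum>i\<in>{..r}. w i * z i) = 0"
    using lspan_dependent[OF is_subring_witt_frac D, of "{..r}" z]
    by (metis card_atMost finite_atMost lessI r_def)
  have "\<exists>i\<in>{..r}. w i * z i \<noteq> 0"
    using w(2) mn by (auto simp: z_def)
  then obtain i0 j0 where "i0 \<in> {..r}" "j0 \<in> {..r}" "i0 \<noteq> j0" "w i0 \<noteq> 0" "w j0 \<noteq> 0"
      "N (w i0 * z i0) = N (w j0 * z j0)"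
    using N_sum_distinct[of "{..r}" "\<lambda>i. w i * z i"] w(3) by auto
  then obtain i j where ij: "i < j" "j \<le> r" "w i \<noteq> 0" "w j \<noteq> 0" "N (w i * z i) = N (w j * z j)"
    by (metis atMost_iff linorder_neqE_nat)
  obtain a where a: "N (w i) = N (of_nat p) powi a"
    using N_witt_frac_value[of "w i"] w(1)[of i] ij by auto
  obtain b where b: "N (w j) = N (of_nat p) powi b"
    using N_witt_frac_value[of "w j"] w(1)[of j] ij by auto
  have pos: "0 < N m" "0 < N n" "0 < N (w j)"
    using mn ij by (auto intro: N_pos)
  have "n ^ (r - i) = n ^ (j - i) * n ^ (r - j)" "m ^ j = m ^ i * m ^ (j - i)"
    using ij by (simp_all flip: power_add)
  then have "N (w i) * (N m ^ i * (N n ^ (j - i) * N n ^ (r - j)))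
      = N (w j) * ((N m ^ i * N m ^ (j - i)) * N n ^ (r - j))"
    using ij(5) by (simp add: z_def N_mult N_power)
  then have "(N (w i) * N n ^ (j - i)) * (N m ^ i * N n ^ (r - j))
      = (N (w j) * N m ^ (j - i)) * (N m ^ i * N n ^ (r - j))"
    by (simp only: mult_ac)
  then have "N (w i) * N n ^ (j - i) = N (w j) * N m ^ (j - i)"
    using pos by (subst (asm) mult_right_cancel) auto
  then have "N (m / n) ^ (j - i) = N (w i) / N (w j)"
    using mn(3,4) ij(4) by (simp add: N_divide power_divide field_simps)
  also have "\<dots> = N (of_nat p) powi (a - b)"
    using Np_pos by (simp add: a b power_int_diff)
  finally have *: "N (m / n) ^ (j - i) = N (of_nat p) powi (a - b)" .
  have "j - i dvd fact r"
    by (rule dvd_fact) (use ij in auto)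
  then obtain c where c: "fact r = (j - i) * c"
    by (rule dvdE)
  then have "N (m / n) ^ fact r = (N (of_nat p) powi (a - b)) ^ c"
    by (simp only: c power_mult *)
  also have "\<dots> = N (of_nat p) powi ((a - b) * int c)"
    by (simp add: power_int_mult)
  finally show ?thesis
    unfolding r_def by blast
qed

text \<open>An automorphism over a ring containing the Teichmueller representatives lies in inertia;
  so an element fixed by the inertia over \<open>L\<close> is a quotient of elements of the span of \<open>L\<close>
  over the maximal unramified ring.\<close>

lemma fixed_value_group_discrete:
  assumes L: "finite_extension K L"
  shows "\<exists>e>0. \<forall>x. x \<noteq> 0 \<longrightarrow> (\<forall>\<sigma>\<in>galois_group L \<inter> inert. \<sigma> x = x) \<longrightarrow>
    (\<exists>k. N x ^ e = N (of_nat p) powi k)"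
proof -
  note R = is_subring_witt_frac and H = is_subring_rat_hull
  have Kr: "is_subring K"
    by (rule is_subfield_imp_subring[OF K_field])
  obtain B where B: "finite B" "L = lspan K B" "K \<subseteq> L" "is_subfield L"
    by (rule finite_extensionE[OF L])
  obtain C where C: "finite C" "K = lspan rat_hull C"
    by (rule finite_extensionE[OF K_finite])
  have Lr: "is_subring L"
    by (rule is_subfield_imp_subring[OF B(4)])
  define D where "D = (\<lambda>(b, c). b * c) ` (B \<times> C)"
  \<comment> \<open>The ring generated by \<open>L\<close> and \<open>witt_frac\<close>. It is
    closed under products because \<open>D \<subseteq> L\<close> and
    \<open>L \<subseteq> M\<close>.\<close>
  define M where "M = lspan witt_frac D"
  have D: "finite D"
    using B(1) C(1) by (simp add: D_def)
  have "L \<subseteq> lspan rat_hull D"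
    unfolding D_def by (rule lspan_trans[OF H B(1) C(1)]) (use B(2) C(2) in auto)
  also have "\<dots> \<subseteq> M"
    unfolding M_def by (rule lspan_mono[OF rat_hull_subset_witt_frac])
  finally have LM: "L \<subseteq> M" .
  have "B \<subseteq> L"
    using lspan_base[OF Kr B(1)] B(2) by auto
  moreover have "C \<subseteq> L"
    using lspan_base[OF H C(1)] C(2) B(3) by auto
  ultimately have "D \<subseteq> L"
    unfolding D_def using is_subringD(4)[OF Lr] by auto
  then have DD: "b * c \<in> M" if "b \<in> D" "c \<in> D" for b c
    using that is_subringD(4)[OF Lr] LM by blast
  have one: "1 \<in> M"
    using is_subringD(2)[OF Lr] LM by blast
  have Mr: "is_subring M"
    unfolding M_def by (rule is_subring_lspan[OF R]) (use one DD in \<open>auto simp: M_def\<close>)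
  have teichM: "teich \<subseteq> M"
    using lspan_scale[OF R _ one[unfolded M_def]] teich_subset_witt_frac by (auto simp: M_def)
  have "\<exists>k. N x ^ fact (card D) = N (of_nat p) powi k"
    if x: "x \<noteq> 0" "\<forall>\<sigma>\<in>galois_group L \<inter> inert. \<sigma> x = x" for x
  proof (cases "\<exists>m\<in>M. \<exists>n\<in>M. n \<noteq> 0 \<and> x = m / n")
    case True
    then obtain m n where "m \<in> M" "n \<in> M" "n \<noteq> 0" "x = m / n"
      by blast
    then show ?thesis
      using value_of_quotient[OF D Mr[unfolded M_def], of m n] x(1) by (auto simp: M_def)
  next
    case False
    then obtain \<sigma> where s: "\<sigma> \<in> galois_group M" "\<sigma> x \<noteq> x"
      using exists_automorphism_moving[OF ac K_algebraic order_trans[OF B(3) LM] Mr, of x] by metis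
    have sL: "\<sigma> \<in> galois_group L"
      using s(1) galois_group_antimono[OF LM] by blast
    then have sK: "\<sigma> \<in> galois_group K"
      using galois_group_antimono[OF B(3)] by blast
    \<comment> \<open>\<open>y\<close> shares its residue with a Teichmueller representative, which
      \<open>\<sigma>\<close> fixes; as \<open>\<sigma>\<close> preserves \<open>N\<close>, the
      image of \<open>y\<close> has that residue too.\<close>
    have "N (\<sigma> y - y) < 1" if "N y \<le> 1" for y
    proof -
      obtain t where t: "t \<in> teich" "N (y - t) < 1"
        using residue_teich_all[OF \<open>N y \<le> 1\<close>] by blast
      have "\<sigma> (y - t) = \<sigma> y - t"
        using galois_groupD(4)[OF s(1)] teichM t(1) by (auto simp: galois_diff[OF s(1)])
      then have "N (\<sigma> y - t) < 1"
        using N_galois_K[OF sK, of "y - t"] t(2) by simp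
      then show ?thesis
        using N_diff_less[of "\<sigma> y - t" 1 "y - t"] t(2) by simp
    qed
    then have "\<sigma> \<in> inert"
      by (simp add: inert_def)
    then show ?thesis
      using x(2) sL s(2) by blast
  qed
  then show ?thesis
    by (intro exI[of _ "fact (card D)"]) auto
qed

end

section \<open>Reduction of the projective line\<close>

definition hform :: "nat \<Rightarrow> 'a::comm_ring_1 poly \<Rightarrow> 'a \<Rightarrow> 'a \<Rightarrow> 'a" where
  "hform d w x y = (\<Sum>i\<le>d. coeff w i * x ^ i * y ^ (d - i))"

text \<open>A row of the Sylvester matrix lists the coefficients of the form multiplied by the
  monomial \<open>x ^ (d - 1 - k) * y ^ k\<close>.\<close>

lemma sylvester_row:
  fixes w :: "'a::comm_ring_1 poly"
  assumes "k < d"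
  shows "(\<Sum>c<2*d. (if k \<le> c \<and> c - k \<le> d then coeff w (d - (c - k)) else 0)
      * (x ^ (2 * d - 1 - c) * y ^ c)) = x ^ (d - 1 - k) * y ^ k * hform d w x y"
proof -
  let ?g = "\<lambda>c. coeff w (d - (c - k)) * (x ^ (2 * d - 1 - c) * y ^ c)"
  have "(\<Sum>c<2*d. (if k \<le> c \<and> c - k \<le> d then coeff w (d - (c - k)) else 0)
      * (x ^ (2 * d - 1 - c) * y ^ c)) = (\<Sum>c<2*d. if k \<le> c \<and> c - k \<le> d then ?g c else 0)"
    by (intro sum.cong) auto
  also have "\<dots> = sum ?g ({..<2*d} \<inter> {c. k \<le> c \<and> c - k \<le> d})"
    by (subst sum.inter_restrict) (simp, simp only: mem_Collect_eq)
  also have "{..<2*d} \<inter> {c. k \<le> c \<and> c - k \<le> d} = {k..k+d}"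
    using assms by auto
  also have "sum ?g {k..k+d} = (\<Sum>i\<le>d. x ^ (d - 1 - k) * y ^ k * (coeff w i * x ^ i * y ^ (d - i)))"
  proof (rule sum.reindex_bij_witness[of _ "\<lambda>i. k + d - i" "\<lambda>c. d - (c - k)"])
    fix c assume c: "c \<in> {k..k+d}"
    have "2 * d - 1 - c = (d - 1 - k) + (d - (c - k))" "c = k + (d - (d - (c - k)))"
      using c assms by auto
    then have "x ^ (2 * d - 1 - c) = x ^ (d - 1 - k) * x ^ (d - (c - k))"
      "y ^ c = y ^ k * y ^ (d - (d - (c - k)))"
      by (metis power_add)+
    then show "x ^ (d - 1 - k) * y ^ k * (coeff w (d - (c - k)) * x ^ (d - (c - k)) *
        y ^ (d - (d - (c - k)))) = ?g c"
      by (simp only: mult_ac)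
  qed auto
  finally show ?thesis
    by (simp add: hform_def sum_distrib_left)
qed

context nonarch
begin

lemma N_det_le1:
  assumes A: "A \<in> carrier_mat n n" and le: "\<And>i j. i < n \<Longrightarrow> j < n \<Longrightarrow> N (A $$ (i, j)) \<le> 1"
  shows "N (det A) \<le> 1"
proof -
  have "N (signof \<pi> * (\<Prod>i = 0..<n. A $$ (i, \<pi> i))) \<le> 1" if "\<pi> permutes {0..<n}" for \<pi>
  proof (rule N_mult_le1[OF N_of_int])
    have "\<pi> i < n" if "i < n" for i
      using permutes_in_image[OF \<open>\<pi> permutes {0..<n}\<close>, of i] that by simp
    then show "N (\<Prod>i = 0..<n. A $$ (i, \<pi> i)) \<le> 1"
      unfolding N_prod by (intro prod_le_1) (auto intro: le)
  qed
  then show ?thesis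
    unfolding det_def'[OF A] by (intro N_sum_le) auto
qed

text \<open>The vector of monomials of degree \<open>2d-1\<close> is mapped by the Sylvester matrix to multiples
  of the two forms, so multiplying with the adjugate expresses \<open>Res * x^(2d-1)\<close> and
  \<open>Res * y^(2d-1)\<close> through the values of the forms.\<close>

lemma N_hom_resultant_less:
  assumes d: "0 < d" and PQ: "intpoly P" "intpoly Q" and xy: "max (N x) (N y) = 1"
    and less: "N (hform d P x y) < 1" "N (hform d Q x y) < 1"
  shows "N (hom_resultant d P Q) < 1"
proof -
  define A where "A = mat (2 * d) (2 * d) (\<lambda>(r, c). sylvester_hom d P Q r c)"
  define v where "v = (\<lambda>c. x ^ (2 * d - 1 - c) * y ^ c)"
  have A: "A \<in> carrier_mat (2 * d) (2 * d)"
    by (simp add: A_def)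
  have Aij: "A $$ (i, j) = sylvester_hom d P Q i j" if "i < 2 * d" "j < 2 * d" for i j
    using that by (simp add: A_def)
  have NA: "N (A $$ (i, j)) \<le> 1" if "i < 2 * d" "j < 2 * d" for i j
    unfolding Aij[OF that] sylvester_hom_def using intpolyD[OF PQ(1)] intpolyD[OF PQ(2)] by auto
  have det: "hom_resultant d P Q = det A"
  proof -
    have "(\<Prod>i<2*d. sylvester_hom d P Q i (\<pi> i)) = (\<Prod>i = 0..<2*d. A $$ (i, \<pi> i))"
      if "\<pi> permutes {0..<2 * d}" for \<pi>
    proof (intro prod.cong)
      fix i assume "i \<in> {0..<2 * d}"
      then show "sylvester_hom d P Q i (\<pi> i) = A $$ (i, \<pi> i)"
        using permutes_in_image[OF that, of i] by (simp add: Aij)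
    qed auto
    then show ?thesis
      unfolding hom_resultant_def det_def'[OF A] by (intro sum.cong) (auto simp: atLeast0LessThan)
  qed
  have Nx: "N x \<le> 1" "N y \<le> 1"
    using xy by auto
  have row: "N (\<Sum>c<2*d. A $$ (k, c) * v c) < 1" if k: "k < 2 * d" for k
  proof (cases "k < d")
    case True
    have "(\<Sum>c<2*d. A $$ (k, c) * v c) = x ^ (d - 1 - k) * y ^ k * hform d P x y"
      unfolding sylvester_row[OF True, symmetric] v_def
      by (intro sum.cong) (auto simp: Aij[OF k] sylvester_hom_def True)
    then show ?thesis
      using less(1) by (auto intro!: N_mult_less1 N_mult_le1 N_power_le1 Nx)
  next
    case False
    then have kd: "k - d < d"
      using k by simp
    have "(\<Sum>c<2*d. A $$ (k, c) * v c) = x ^ (d - 1 - (k - d)) * y ^ (k - d) * hform d Q x y"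
      unfolding sylvester_row[OF kd, symmetric] v_def
      by (intro sum.cong) (auto simp: Aij[OF k] sylvester_hom_def False)
    then show ?thesis
      using less(2) by (auto intro!: N_mult_less1 N_mult_le1 N_power_le1 Nx)
  qed
  \<comment> \<open>Entries of the adjugate are signed minors of an integral matrix.\<close>
  have adj: "N (adj_mat A $$ (j, k)) \<le> 1" if "j < 2 * d" "k < 2 * d" for j k
  proof -
    have "N (det (mat_delete A k j)) \<le> 1"
      by (rule N_det_le1[OF mat_delete_carrier[OF A]])
        (auto simp: mat_delete_def A_def[symmetric] carrier_matD[OF A] intro!: NA)
    then show ?thesis
      using that A by (auto simp: adj_mat_def cofactor_def intro!: N_mult_le1 N_power_le1)
  qed
  have main: "N (det A * v j) < 1" if j: "j < 2 * d" for j
  proof -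
    have "(\<Sum>k<2*d. adj_mat A $$ (j, k) * A $$ (k, c)) = (if j = c then det A else 0)"
      if c: "c < 2 * d" for c
    proof -
      have "(adj_mat A * A) $$ (j, c) = (\<Sum>k<2*d. adj_mat A $$ (j, k) * A $$ (k, c))"
        using j c A adj_mat(1)[OF A] by (simp add: scalar_prod_def atLeast0LessThan)
      then show ?thesis
        unfolding adj_mat(3)[OF A] using j c by (cases "j = c") simp_all
    qed
    then have "det A * v j = (\<Sum>c<2*d. (\<Sum>k<2*d. adj_mat A $$ (j, k) * A $$ (k, c)) * v c)"
      using j by (simp add: if_distrib[of "\<lambda>x. x * _"] cong: if_cong)
    also have "\<dots> = (\<Sum>k<2*d. adj_mat A $$ (j, k) * (\<Sum>c<2*d. A $$ (k, c) * v c))"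
      by (simp add: sum_distrib_left sum_distrib_right mult.assoc) (rule sum.swap)
    finally have eq: "det A * v j = (\<Sum>k<2*d. adj_mat A $$ (j, k) * (\<Sum>c<2*d. A $$ (k, c) * v c))" .
    have "N (adj_mat A $$ (j, k) * (\<Sum>c<2*d. A $$ (k, c) * v c)) < 1" if "k < 2 * d" for k
      by (rule N_mult_less1[OF adj[OF j that] row[OF that]])
    then show ?thesis
      unfolding eq by (intro N_sum_less) simp_all
  qed
  \<comment> \<open>Index 0 belongs to \<open>x ^ (2 * d - 1)\<close> and index
    \<open>2 * d - 1\<close> to \<open>y ^ (2 * d - 1)\<close>; one of these monomials is a
    unit.\<close>
  have "N x = 1 \<or> N y = 1"
    using xy by (auto simp: max_def split: if_splits)
  then show ?thesis
  proof
    assume "N x = 1"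
    then show ?thesis
      using main[of 0] d by (simp add: det v_def N_mult N_power)
  next
    assume "N y = 1"
    then show ?thesis
      using main[of "2 * d - 1"] d by (simp add: det v_def N_mult N_power)
  qed
qed

lemma N_hform_le1: "intpoly w \<Longrightarrow> N x \<le> 1 \<Longrightarrow> N y \<le> 1 \<Longrightarrow> N (hform d w x y) \<le> 1"
  unfolding hform_def by (intro N_sum_le N_mult_le1 N_power_le1) (auto dest: intpolyD)

text \<open>Normalized homogeneous coordinates \<open>[cx z : cy z]\<close> of a point of the projective line;
  \<open>None\<close> is infinity.\<close>

definition cx :: "'a option \<Rightarrow> 'a" where
  "cx z = (case z of None \<Rightarrow> 1 | Some x \<Rightarrow> if N x \<le> 1 then x else 1)"

definition cy :: "'a option \<Rightarrow> 'a" where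
  "cy z = (case z of None \<Rightarrow> 0 | Some x \<Rightarrow> if N x \<le> 1 then 1 else 1 / x)"

definition pt :: "'a \<Rightarrow> 'a \<Rightarrow> 'a option" where
  "pt a b = (if b = 0 then None else Some (a / b))"

text \<open>Separates the points reducing to the affine line from those reducing to infinity;
  \<open>lc\<close> is the local coordinate on either side.\<close>

definition chart :: "'a option \<Rightarrow> bool" where
  "chart z = (case z of None \<Rightarrow> False | Some x \<Rightarrow> N x \<le> 1)"

definition lc :: "'a option \<Rightarrow> 'a" where
  "lc z = (if chart z then cx z else cy z)"

text \<open>The chordal metric: the determinant of two normalized coordinate vectors.\<close>

definition pdist :: "'a option \<Rightarrow> 'a option \<Rightarrow> real" where
  "pdist z w = N (cx z * cy w - cx w * cy z)"

section \<open>The chordal metric and residue classes\<close>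

lemma chart_coords:
  "chart z \<Longrightarrow> cy z = 1" "\<not> chart z \<Longrightarrow> cx z = 1"
  "chart z \<Longrightarrow> N (cx z) \<le> 1" "\<not> chart z \<Longrightarrow> N (cy z) < 1"
  by (auto simp: chart_def cx_def cy_def N_divide split: option.splits if_splits)

lemma coords_norm: "max (N (cx z)) (N (cy z)) = 1"
  using chart_coords[of z] by (cases "chart z") auto

lemma N_cx_le1: "N (cx z) \<le> 1" and N_cy_le1: "N (cy z) \<le> 1"
  using coords_norm[of z] by auto

lemma N_lc_le1: "N (lc z) \<le> 1"
  by (simp add: lc_def N_cx_le1 N_cy_le1)

lemma pt_coords: "pt (cx z) (cy z) = z"
  by (auto simp: pt_def cx_def cy_def split: option.splits)

lemma pt_eqI:
  assumes "a * b' = a' * b" "a \<noteq> 0 \<or> b \<noteq> 0" "a' \<noteq> 0 \<or> b' \<noteq> 0"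
  shows "pt a b = pt a' b'"
  using assms by (auto simp: pt_def frac_eq_eq)

lemma coords_pt:
  assumes "max (N a) (N b) = 1"
  obtains l where "N l = 1" "a = l * cx (pt a b)" "b = l * cy (pt a b)"
proof (cases "b = 0")
  case True
  then show thesis
    using assms that[of a] by (simp add: pt_def cx_def cy_def)
next
  case b: False
  show thesis
  proof (cases "N (a / b) \<le> 1")
    case True
    then have "N b = 1"
      using assms N_pos[OF b] by (auto simp: N_divide max_def split: if_splits)
    then show thesis
      using that[of b] b True by (simp add: pt_def cx_def cy_def)
  next
    case False
    then have "N b < N a"
      using N_pos[OF b] by (simp add: N_divide)
    then have "N a = 1" "a \<noteq> 0"
      using assms N_nonneg[of b] by (auto simp: max_def)
    then show thesis
      using that[of a] b False by (simp add: pt_def cx_def cy_def)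
  qed
qed

lemma pdist_sym: "pdist z w = pdist w z"
  unfolding pdist_def by (rule N_minus_commute)

lemma pdist_self [simp]: "pdist z z = 0"
  by (simp add: pdist_def)

lemma pdist_eq_0: "pdist z w = 0 \<longleftrightarrow> z = w"
proof
  assume "pdist z w = 0"
  then have "pt (cx z) (cy z) = pt (cx w) (cy w)"
    using coords_norm[of z] coords_norm[of w] by (intro pt_eqI) (auto simp: pdist_def)
  then show "z = w"
    by (simp add: pt_coords)
qed simp

lemma pdist_nonneg: "0 \<le> pdist z w"
  by (simp add: pdist_def)

text \<open>The determinant of \<open>z\<close> and \<open>u\<close>, multiplied by either
  coordinate of \<open>w\<close>, is an integral combination of the determinants of
  \<open>z\<close>, \<open>w\<close> and of \<open>w\<close>, \<open>u\<close>; one coordinate of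
  \<open>w\<close> is a unit.\<close>

lemma pdist_ultra:
  assumes "pdist z w < e" "pdist w u < e"
  shows "pdist z u < e"
proof -
  have e: "N (k * (cx w * cy u - cx u * cy w) + l * (cx z * cy w - cx w * cy z)) < e"
    if "N k \<le> 1" "N l \<le> 1" for k l
    using assms that unfolding pdist_def N_mult
    by (intro N_add_less) (auto simp: N_mult intro: order.strict_trans1[OF mult_left_le_one_le])
  have "cx w * (cx z * cy u - cx u * cy z)
      = cx z * (cx w * cy u - cx u * cy w) + cx u * (cx z * cy w - cx w * cy z)"
    "cy w * (cx z * cy u - cx u * cy z)
      = cy z * (cx w * cy u - cx u * cy w) + cy u * (cx z * cy w - cx w * cy z)"
    by (simp_all add: algebra_simps)
  then have "N (cx w) * pdist z u < e" "N (cy w) * pdist z u < e"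
    using e[OF N_cx_le1 N_cx_le1, of z u] e[OF N_cy_le1 N_cy_le1, of z u]
    by (simp_all add: pdist_def flip: N_mult)
  moreover have "N (cx w) = 1 \<or> N (cy w) = 1"
    using coords_norm[of w] by (auto simp: max_def split: if_splits)
  ultimately show ?thesis
    by auto
qed

definition near :: "'a option \<Rightarrow> 'a option \<Rightarrow> bool" where
  "near z w \<longleftrightarrow> pdist z w < 1"

lemma near_refl [simp]: "near z z"
  by (simp add: near_def)

lemma near_sym: "near z w \<Longrightarrow> near w z"
  by (simp add: near_def pdist_sym)

lemma near_trans: "near z w \<Longrightarrow> near w u \<Longrightarrow> near z u"
  unfolding near_def by (rule pdist_ultra)

lemma pdist_same_chart: "chart z = chart w \<Longrightarrow> pdist z w = N (lc z - lc w)"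
  using chart_coords[of z] chart_coords[of w] N_minus_commute[of "lc z" "lc w"]
  by (auto simp: pdist_def lc_def)

lemma near_same_chart:
  assumes "near z w"
  shows "chart z = chart w"
proof -
  have *: "False" if "chart u" "\<not> chart u'" "near u u'" for u u'
  proof -
    have "N (cx u * cy u' - 1) < 1"
      using that chart_coords[of u] chart_coords[of u'] by (simp add: near_def pdist_def)
    moreover have "N (cx u * cy u') < 1"
      using that chart_coords(4) by (intro N_mult_less1 N_cx_le1) auto
    ultimately show False
      using N_diff_less[of "cx u * cy u'" 1 "cx u * cy u' - 1"] by simp
  qed
  show ?thesis
    using *[of z w] *[of w z] assms near_sym by blast
qed

lemma near_pdist: "near z w \<Longrightarrow> pdist z w = N (lc z - lc w)"
  by (intro pdist_same_chart near_same_chart)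

end

section \<open>Dynamics of a map with good reduction on residue classes\<close>

locale good_map = padic_closure N p K for N :: "'a::field_char_0 \<Rightarrow> real" and p K +
  fixes P Q :: "'a poly" and d :: nat
  assumes P_int: "intpoly P" and Q_int: "intpoly Q" and PQ_coprime: "coprime P Q"
    and P_in_K: "coeff P i \<in> K" and Q_in_K: "coeff Q i \<in> K"
    and d_def: "d = max (degree P) (degree Q)" and d_bounds: "2 \<le> d" "d < p"
    and resultant: "N (hom_resultant d P Q) = 1"
begin

abbreviation "f \<equiv> rat_map P Q"

text \<open>Dehomogenization of the form of degree \<open>d\<close> given by \<open>w\<close>, at 0 or (for \<open>\<not> c\<close>) at infinity.\<close>

definition cpoly :: "bool \<Rightarrow> 'a poly \<Rightarrow> 'a poly" where
  "cpoly c w = (if c then w else (\<Sum>i\<le>d. monom (coeff w i) (d - i)))"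

section \<open>Homogeneous description of the map\<close>

lemma coeff_cpoly_False:
  "coeff (cpoly False w) i = (if i \<le> d then coeff w (d - i) else 0)"
proof -
  have "coeff (cpoly False w) i = (\<Sum>j\<le>d. if d - j = i then coeff w j else 0)"
    by (simp add: cpoly_def coeff_sum)
  also have "\<dots> = (\<Sum>j\<le>d. if i \<le> d \<and> j = d - i then coeff w j else 0)"
    by (intro sum.cong) auto
  also have "\<dots> = (if i \<le> d then coeff w (d - i) else 0)"
    by (auto simp: sum.delta)
  finally show ?thesis .
qed

lemma intpoly_cpoly: "intpoly w \<Longrightarrow> intpoly (cpoly c w)"
  by (cases c) (auto simp: intpoly_def coeff_cpoly_False cpoly_def[of True])

lemma hform_combination: "hform d (smult a u - smult b w) x y = a * hform d u x y - b * hform d w x y"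
  by (simp add: hform_def left_diff_distrib sum_subtractf sum_distrib_left mult.assoc)

lemma hform_affine:
  assumes "degree w \<le> d"
  shows "hform d w x 1 = poly w x"
proof -
  have "poly w x = (\<Sum>i\<le>degree w. coeff w i * x ^ i)"
    by (rule poly_altdef)
  also have "\<dots> = (\<Sum>i\<le>d. coeff w i * x ^ i)"
    using assms by (intro sum.mono_neutral_left) (auto simp: coeff_eq_0)
  finally show ?thesis
    by (simp add: hform_def)
qed

lemma hform_infinity: "hform d w 1 t = poly (cpoly False w) t"
  by (simp add: hform_def cpoly_def poly_sum poly_monom)

lemma hform_scale: "hform d w (c * x) (c * y) = c ^ d * hform d w x y"
proof -
  have "coeff w i * (c * x) ^ i * (c * y) ^ (d - i) = c ^ d * (coeff w i * x ^ i * y ^ (d - i))"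
    if "i \<le> d" for i
  proof -
    have "c ^ d = c ^ i * c ^ (d - i)"
      using that by (simp flip: power_add)
    then show ?thesis
      by (simp only: power_mult_distrib mult_ac)
  qed
  then show ?thesis
    by (simp add: hform_def sum_distrib_left)
qed

lemma degree_PQ: "degree P \<le> d" "degree Q \<le> d"
  by (simp_all add: d_def)

lemma hform_coords:
  assumes "degree w \<le> d"
  shows "hform d w (cx z) (cy z) = poly (cpoly (chart z) w) (lc z)"
  using hform_affine[OF assms] hform_infinity chart_coords[of z]
  by (cases "chart z") (simp_all add: lc_def cpoly_def[of True])

lemma hform_at_infinity: "hform d w 1 0 = coeff w d"
proof -
  have "hform d w 1 0 = (\<Sum>i\<le>d. if i = d then coeff w d else 0)"
    unfolding hform_def by (intro sum.cong) (auto simp: power_0_left)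
  then show ?thesis
    by simp
qed

lemma hform_coords_Some:
  "\<exists>c. c \<noteq> 0 \<and> (\<forall>w. degree w \<le> d \<longrightarrow> poly w x = c * hform d w (cx (Some x)) (cy (Some x)))"
proof (cases "N x \<le> 1")
  case True
  then show ?thesis
    by (intro exI[of _ 1]) (simp add: hform_affine cx_def cy_def)
next
  case False
  then have "x \<noteq> 0"
    by auto
  have "poly w x = x ^ d * hform d w 1 (1 / x)" if "degree w \<le> d" for w
    using hform_scale[of w x 1 "1 / x"] hform_affine[OF that, of x] \<open>x \<noteq> 0\<close> by simp
  then show ?thesis
    using False \<open>x \<noteq> 0\<close> by (intro exI[of _ "x ^ d"]) (simp add: cx_def cy_def)
qed

lemma f_eq_pt: "f z = pt (hform d P (cx z) (cy z)) (hform d Q (cx z) (cy z))"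
proof (cases z)
  case None
  then show ?thesis
    by (simp add: rat_map_def Let_def pt_def cx_def cy_def hform_at_infinity flip: d_def)
next
  case (Some x)
  obtain c where "c \<noteq> 0" "\<forall>w. degree w \<le> d \<longrightarrow> poly w x = c * hform d w (cx (Some x)) (cy (Some x))"
    using hform_coords_Some by blast
  then show ?thesis
    by (simp add: Some rat_map_def pt_def degree_PQ)
qed

text \<open>Good reduction in the form used below: the reduced forms have no common zero, since
  otherwise their resultant would not be a unit.\<close>

lemma good_reduction_forms:
  assumes "max (N x) (N y) = 1"
  shows "max (N (hform d P x y)) (N (hform d Q x y)) = 1"
proof (rule ccontr)
  assume neg: "\<not> ?thesis"
  have "N x \<le> 1" "N y \<le> 1"
    using assms by auto
  then have "N (hform d P x y) \<le> 1" "N (hform d Q x y) \<le> 1"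
    using P_int Q_int by (auto intro: N_hform_le1)
  then have "N (hform d P x y) < 1" "N (hform d Q x y) < 1"
    using neg by auto
  then have "N (hom_resultant d P Q) < 1"
    using d_bounds by (intro N_hom_resultant_less[OF _ P_int Q_int assms]) auto
  then show False
    using resultant by simp
qed

lemma f_coords:
  obtains l where "N l = 1" "hform d P (cx z) (cy z) = l * cx (f z)"
    "hform d Q (cx z) (cy z) = l * cy (f z)"
  using coords_pt[OF good_reduction_forms[OF coords_norm[of z]]] unfolding f_eq_pt[of z] by blast

lemma pdist_f:
  "pdist (f z) (f w) = N (hform d P (cx z) (cy z) * hform d Q (cx w) (cy w)
    - hform d P (cx w) (cy w) * hform d Q (cx z) (cy z))"
proof -
  obtain l where l: "N l = 1" "hform d P (cx z) (cy z) = l * cx (f z)"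
      "hform d Q (cx z) (cy z) = l * cy (f z)"
    by (rule f_coords)
  obtain m where m: "N m = 1" "hform d P (cx w) (cy w) = m * cx (f w)"
      "hform d Q (cx w) (cy w) = m * cy (f w)"
    by (rule f_coords)
  have "hform d P (cx z) (cy z) * hform d Q (cx w) (cy w)
      - hform d P (cx w) (cy w) * hform d Q (cx z) (cy z)
      = l * m * (cx (f z) * cy (f w) - cx (f w) * cy (f z))"
    by (simp add: l m algebra_simps)
  then show ?thesis
    by (simp add: pdist_def N_mult l m)
qed

text \<open>The Wronskian: up to sign, the numerator of the derivative of
  \<open>cpoly c P / cpoly c Q\<close>.\<close>

definition wr :: "bool \<Rightarrow> 'a poly" where
  "wr c = cpoly c P * pderiv (cpoly c Q) - pderiv (cpoly c P) * cpoly c Q"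

definition bad :: "'a option \<Rightarrow> bool" where
  "bad z \<longleftrightarrow> N (poly (wr (chart z)) (lc z)) < 1"

lemma intpoly_wr: "intpoly (wr c)"
  unfolding wr_def by (intro intpoly_diff intpoly_mult intpoly_pderiv intpoly_cpoly P_int Q_int)

lemma N_wr_le1: "N (poly (wr (chart z)) (lc z)) \<le> 1"
  by (intro N_poly_le1 intpoly_wr N_lc_le1)

text \<open>By \<open>pdist_f\<close> the distance of the images is a determinant in the values of
  the two forms, so the chart of the images does not matter. Its linear Taylor term is the Wronskian
  times the difference of the local coordinates.\<close>

lemma pdist_f_expansion:
  assumes nr: "near z w"
  obtains D where "pdist (f z) (f w) = N D"
    "N (D - (lc w - lc z) * poly (wr (chart z)) (lc z)) \<le> pdist z w ^ 2"
proof
  define c x y p q where "c = chart z" and "x = lc z" and "y = lc w"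
    and "p = cpoly c P" and "q = cpoly c Q"
  have cw: "chart w = c"
    using near_same_chart[OF nr] by (simp add: c_def)
  have dist: "pdist z w = N (y - x)"
    using near_pdist[OF nr] by (simp add: x_def y_def N_minus_commute)
  let ?D = "poly p x * poly q y - poly p y * poly q x"
  show "pdist (f z) (f w) = N ?D"
    unfolding pdist_f using degree_PQ
    by (simp add: hform_coords cw c_def x_def y_def p_def q_def)
  define \<alpha> where "\<alpha> = poly p y - poly p x - (y - x) * poly (pderiv p) x"
  define \<beta> where "\<beta> = poly q y - poly q x - (y - x) * poly (pderiv q) x"
  have le1: "N x \<le> 1" "N y \<le> 1"
    by (simp_all add: x_def y_def N_lc_le1)
  have int: "intpoly p" "intpoly q"
    by (simp_all add: p_def q_def intpoly_cpoly P_int Q_int)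
  have ab: "N \<alpha> \<le> N (y - x) ^ 2" "N \<beta> \<le> N (y - x) ^ 2"
    unfolding \<alpha>_def \<beta>_def by (intro N_poly_taylor int le1)+
  have "?D - (lc w - lc z) * poly (wr (chart z)) (lc z) = poly p x * \<beta> - poly q x * \<alpha>"
    by (simp add: wr_def \<alpha>_def \<beta>_def algebra_simps flip: c_def x_def y_def p_def q_def)
  moreover have "N (poly p x * \<beta>) \<le> N (y - x) ^ 2" "N (poly q x * \<alpha>) \<le> N (y - x) ^ 2"
    using mult_mono[OF N_poly_le1[OF int(1) le1(1)] ab(2)]
      mult_mono[OF N_poly_le1[OF int(2) le1(1)] ab(1)] by (simp_all add: N_mult)
  ultimately show "N (?D - (lc w - lc z) * poly (wr (chart z)) (lc z)) \<le> pdist z w ^ 2"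
    unfolding dist by (simp add: N_diff_le)
qed

lemma near_power2: "near z w \<Longrightarrow> z \<noteq> w \<Longrightarrow> pdist z w ^ 2 < pdist z w"
  using pdist_eq_0[of z w] pdist_nonneg[of z w]
  by (simp add: near_def power2_eq_square mult_less_cancel_right1)

lemma pdist_f_le:
  assumes "near z w"
  shows "pdist (f z) (f w) \<le> pdist z w"
proof (cases "z = w")
  case False
  obtain D where D: "pdist (f z) (f w) = N D"
    "N (D - (lc w - lc z) * poly (wr (chart z)) (lc z)) \<le> pdist z w ^ 2"
    by (rule pdist_f_expansion[OF assms])
  have "N ((lc w - lc z) * poly (wr (chart z)) (lc z)) \<le> pdist z w"
    using mult_left_mono[OF N_wr_le1[of z], of "pdist z w"] pdist_nonneg[of z w]
    by (simp add: N_mult near_pdist[OF assms] N_minus_commute)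
  moreover have "N (D - (lc w - lc z) * poly (wr (chart z)) (lc z)) \<le> pdist z w"
    using D(2) near_power2[OF assms False] by simp
  ultimately show ?thesis
    using D(1) N_add_le by fastforce
qed simp

text \<open>At a bad point the linear term is smaller than the distance because its coefficient is
  not a unit, and the quadratic term is smaller because the distance is below 1.\<close>

lemma pdist_f_less:
  assumes "near z w" "bad z" "z \<noteq> w"
  shows "pdist (f z) (f w) < pdist z w"
proof -
  obtain D where D: "pdist (f z) (f w) = N D"
    "N (D - (lc w - lc z) * poly (wr (chart z)) (lc z)) \<le> pdist z w ^ 2"
    by (rule pdist_f_expansion[OF assms(1)])
  have "0 < pdist z w"
    using assms(3) pdist_nonneg[of z w] pdist_eq_0[of z w] by simp
  then have "pdist z w * N (poly (wr (chart z)) (lc z)) < pdist z w"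
    using assms(2) by (simp add: bad_def)
  then have "N ((lc w - lc z) * poly (wr (chart z)) (lc z)) < pdist z w"
    by (simp add: N_mult near_pdist[OF assms(1)] N_minus_commute)
  moreover have "N (D - (lc w - lc z) * poly (wr (chart z)) (lc z)) < pdist z w"
    using D(2) near_power2[OF assms(1,3)] by simp
  ultimately show ?thesis
    using D(1) N_add_less by fastforce
qed

text \<open>With a unit Wronskian the linear term dominates the quadratic remainder, so distinct
  points of the class have distinct images.\<close>

lemma f_inj_on_good_class:
  assumes "near z w" "\<not> bad z" "f z = f w"
  shows "z = w"
proof (rule ccontr)
  assume "z \<noteq> w"
  obtain D where D: "pdist (f z) (f w) = N D"
    "N (D - (lc w - lc z) * poly (wr (chart z)) (lc z)) \<le> pdist z w ^ 2"
    by (rule pdist_f_expansion[OF assms(1)])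
  have "D = 0"
    using D(1) assms(3) by simp
  moreover have "N (poly (wr (chart z)) (lc z)) = 1"
    using assms(2) N_wr_le1[of z] by (simp add: bad_def)
  ultimately have "pdist z w \<le> pdist z w ^ 2"
    using D(2) by (simp add: N_mult near_pdist[OF assms(1)] N_minus_commute)
  then show False
    using near_power2[OF assms(1) \<open>z \<noteq> w\<close>] by simp
qed

lemma near_f: "near z w \<Longrightarrow> near (f z) (f w)"
  using pdist_f_le[of z w] by (simp add: near_def)

lemma bad_near:
  assumes "near z w" "bad z"
  shows "bad w"
proof -
  have "N (poly (wr (chart z)) (lc w) - poly (wr (chart z)) (lc z)) \<le> N (lc w - lc z)"
    by (intro N_poly_diff intpoly_wr N_lc_le1)
  also have "\<dots> < 1"
    using assms(1) near_pdist[OF assms(1)] by (simp add: near_def N_minus_commute)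
  finally have "N ((poly (wr (chart z)) (lc w) - poly (wr (chart z)) (lc z))
      + poly (wr (chart z)) (lc z)) < 1"
    using assms(2) by (intro N_add_less) (simp_all add: bad_def)
  then show ?thesis
    using near_same_chart[OF assms(1)] by (simp add: bad_def)
qed

section \<open>Nonvanishing of the reduced Wronskian, bad classes and preimages\<close>

lemma hform_zero_exists:
  assumes w: "degree w \<le> d"
  obtains x y where "max (N x) (N y) = 1" "hform d w x y = 0"
proof (cases "coeff w d = 0")
  case True
  then show thesis
    using that[of 1 0] by (simp add: hform_at_infinity)
next
  case False
  then have "degree w = d"
    using w by (meson le_antisym le_degree)
  then obtain r where "poly w r = 0"
    using ac d_bounds unfolding algebraically_closed_type_def by (metis One_nat_def Suc_1 Suc_leD)
  moreover obtain c where "c \<noteq> 0"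
    "\<forall>w. degree w \<le> d \<longrightarrow> poly w r = c * hform d w (cx (Some r)) (cy (Some r))"
    using hform_coords_Some by blast
  ultimately show thesis
    using that[OF coords_norm[of "Some r"]] w by simp
qed

text \<open>If the combination vanished modulo the maximal ideal, then at a zero of one form the
  other would be small as well, against \<open>good_reduction_forms\<close>.\<close>

lemma combination_unit_coeff:
  assumes ab: "max (N a) (N b) = 1"
  obtains i where "N (coeff (smult b P - smult a Q) i) = 1"
proof -
  define w where "w = smult b P - smult a Q"
  have ab1: "N a \<le> 1" "N b \<le> 1"
    using ab by auto
  have w_le: "N (coeff w i) \<le> 1" for i
    using intpoly_diff[OF intpoly_smult[OF ab1(2) P_int] intpoly_smult[OF ab1(1) Q_int]]
    unfolding w_def by (rule intpolyD)
  have False if all: "\<And>i. N (coeff w i) < 1"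
  proof -
    have small: "N (b * hform d P x y - a * hform d Q x y) < 1" if "max (N x) (N y) = 1" for x y
    proof -
      have "N x \<le> 1" "N y \<le> 1"
        using that by auto
      then have "N (hform d w x y) < 1"
        unfolding hform_def by (intro N_sum_less N_mult_less1' N_power_le1 all) auto
      then show ?thesis
        by (simp add: w_def hform_combination)
    qed
    have "N b = 1 \<or> N a = 1"
      using ab by (auto simp: max_def split: if_splits)
    then show False
    proof
      assume b: "N b = 1"
      obtain x y where xy: "max (N x) (N y) = 1" "hform d Q x y = 0"
        by (rule hform_zero_exists[OF degree_PQ(2)])
      then have "N (hform d P x y) < 1"
        using small[OF xy(1)] b by (simp add: N_mult)
      then show False
        using good_reduction_forms[OF xy(1)] xy(2) by simp
    next
      assume a: "N a = 1"
      obtain x y where xy: "max (N x) (N y) = 1" "hform d P x y = 0"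
        by (rule hform_zero_exists[OF degree_PQ(1)])
      then have "N (hform d Q x y) < 1"
        using small[OF xy(1)] a by (simp add: N_mult)
      then show False
        using good_reduction_forms[OF xy(1)] xy(2) by simp
    qed
  qed
  then show thesis
    using that w_le unfolding w_def by (metis order_le_less)
qed

lemma top_unit_coeff:
  assumes "intpoly w" "N (coeff w i) = 1" "degree w \<le> d"
  obtains a where "a \<le> d" "N (coeff w a) = 1" "\<And>i. a < i \<Longrightarrow> N (coeff w i) < 1"
proof -
  define S where "S = {i. N (coeff w i) = 1}"
  have "S \<subseteq> {..d}"
  proof
    fix i assume "i \<in> S"
    then have "coeff w i \<noteq> 0"
      by (auto simp: S_def)
    then show "i \<in> {..d}"
      using le_degree[of w i] assms(3) by auto
  qed
  then have S: "finite S" "S \<noteq> {}"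
    using assms(2) finite_subset by (auto simp: S_def)
  have "N (coeff w i) < 1" if "Max S < i" for i
  proof -
    have "i \<notin> S"
      using that Max_ge[OF S(1), of i] by auto
    then show ?thesis
      using intpolyD[OF assms(1), of i] by (simp add: S_def)
  qed
  moreover have "N (coeff w (Max S)) = 1" "Max S \<le> d"
    using Max_in[OF S] \<open>S \<subseteq> {..d}\<close> by (auto simp: S_def)
  ultimately show thesis
    using that by blast
qed

text \<open>\<open>a\<close> and \<open>b\<close> are the degrees of the reductions. Modulo the
  maximal ideal the coefficient is \<open>(b - a)\<close> times the two leading units, and
  \<open>b - a\<close> is prime to \<open>p\<close> because both degrees are at most
  \<open>d < p\<close>.\<close>

lemma wronskian_unit_coeff:
  assumes u: "intpoly u" "N (coeff u a) = 1" "\<And>i. a < i \<Longrightarrow> N (coeff u i) < 1" "a \<le> d"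
    and w: "intpoly w" "N (coeff w b) = 1" "\<And>i. b < i \<Longrightarrow> N (coeff w i) < 1" "b \<le> d"
    and ab: "a \<noteq> b"
  shows "N (coeff (u * pderiv w - pderiv u * w) (a + b - 1)) = 1"
proof -
  \<comment> \<open>Multiplying the derivative by the variable turns the index shift into the factor
    \<open>i\<close>, so the Wronskian coefficient becomes a single sum over
    \<open>i \<le> a + b\<close>.\<close>
  have shift: "coeff (pCons 0 (pderiv q)) i = of_nat i * coeff q i" for q :: "'a poly" and i
    by (cases i) (simp_all add: coeff_pderiv)
  define g where "g = (\<lambda>i. coeff u i * (of_nat (a + b - i) * coeff w (a + b - i))
      - of_nat i * coeff u i * coeff w (a + b - i))"
  have "coeff (u * pderiv w - pderiv u * w) (a + b - 1)
      = coeff (u * pCons 0 (pderiv w) - pCons 0 (pderiv u) * w) (a + b)"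
    using ab by (cases "a + b") (simp_all add: coeff_pCons)
  also have "\<dots> = (\<Sum>i\<le>a + b. g i)"
    unfolding coeff_diff coeff_mult shift by (simp add: g_def sum_subtractf)
  also have "\<dots> = g a + (\<Sum>i\<in>{..a + b} - {a}. g i)"
    by (intro sum.remove) auto
  finally have eq: "coeff (u * pderiv w - pderiv u * w) (a + b - 1)
      = g a + (\<Sum>i\<in>{..a + b} - {a}. g i)" .
  have "g a = of_int (int b - int a) * (coeff u a * coeff w b)"
    by (simp add: g_def algebra_simps)
  moreover have "\<not> int p dvd int b - int a"
  proof
    assume "int p dvd int b - int a"
    then have "int p \<le> \<bar>int b - int a\<bar>"
      using ab dvd_imp_le_int[of "int b - int a" "int p"] by simp
    then show False
      using u(4) w(4) d_bounds by auto
  qed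
  ultimately have ga: "N (g a) = 1"
    by (simp only: N_mult N_of_int_unit u(2) w(2) mult_1_right not_False_eq_True)
  have "N (\<Sum>i\<in>{..a + b} - {a}. g i) < 1"
  proof (rule N_sum_less)
    fix i assume i: "i \<in> {..a + b} - {a}"
    have small: "N (coeff u i * coeff w (a + b - i)) < 1"
    proof (cases "a < i")
      case True
      show ?thesis
        by (rule N_mult_less1'[OF u(3)[OF True] intpolyD[OF w(1)]])
    next
      case False
      then have "b < a + b - i"
        using i by auto
      then show ?thesis
        by (rule N_mult_less1[OF intpolyD[OF u(1)] w(3)])
    qed
    have "N ((of_nat (a + b - i)) * (coeff u i * coeff w (a + b - i))
        - of_nat i * (coeff u i * coeff w (a + b - i))) < 1"
      by (rule N_diff_less[OF N_mult_less1[OF N_of_nat small] N_mult_less1[OF N_of_nat small]])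
    then show "N (g i) < 1"
      by (simp add: g_def mult_ac)
  qed simp
  then show ?thesis
    unfolding eq using N_dominant[of _ "g a"] ga by simp
qed

text \<open>If the reduced degrees of \<open>P\<close> and \<open>Q\<close> agree, subtracting a
  multiple of \<open>Q\<close> from \<open>P\<close> separates them without changing the
  Wronskian.\<close>

lemma wr_unit_coeff:
  obtains i where "N (coeff (wr True) i) = 1"
proof -
  have wr: "wr True = P * pderiv Q - pderiv P * Q"
    by (simp add: wr_def cpoly_def)
  obtain i where "N (coeff (smult 1 P - smult 0 Q) i) = 1"
    by (rule combination_unit_coeff[of 0 1]) auto
  then obtain a where a: "a \<le> d" "N (coeff P a) = 1" "\<And>i. a < i \<Longrightarrow> N (coeff P i) < 1"
    using top_unit_coeff[OF P_int _ degree_PQ(1), of i] by auto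
  obtain j where "N (coeff (smult 0 P - smult 1 Q) j) = 1"
    by (rule combination_unit_coeff[of 1 0]) auto
  then obtain b where b: "b \<le> d" "N (coeff Q b) = 1" "\<And>i. b < i \<Longrightarrow> N (coeff Q i) < 1"
    using top_unit_coeff[OF Q_int _ degree_PQ(2), of j] by auto
  show thesis
  proof (cases "a = b")
    case False
    then show ?thesis
      using that wronskian_unit_coeff[OF P_int a(2,3,1) Q_int b(2,3,1)] by (simp add: wr)
  next
    case True
    \<comment> \<open>This ratio kills the coefficient of index \<open>b\<close> in
      \<open>R\<close>, so the reduced degree \<open>e\<close> of \<open>R\<close> differs from
      \<open>b\<close>.\<close>
    define c where "c = coeff P b / coeff Q b"
    define R where "R = P - smult c Q"
    have Nc: "N c = 1"
      using a(2) b(2) True by (simp add: c_def N_divide)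
    have R_int: "intpoly R"
      unfolding R_def using Nc by (intro intpoly_diff intpoly_smult P_int Q_int) simp
    have "degree R \<le> d"
      unfolding R_def using degree_PQ degree_smult_le[of c Q] by (intro degree_diff_le) auto
    obtain k where "N (coeff (smult 1 P - smult c Q) k) = 1"
      by (rule combination_unit_coeff[of c 1]) (use Nc in auto)
    then obtain e where e: "e \<le> d" "N (coeff R e) = 1" "\<And>i. e < i \<Longrightarrow> N (coeff R i) < 1"
      using top_unit_coeff[OF R_int _ \<open>degree R \<le> d\<close>, of k] by (auto simp: R_def)
    have "coeff Q b \<noteq> 0"
      using b(2) by auto
    then have "coeff R b = 0"
      by (simp add: R_def c_def)
    then have "e \<noteq> b"
      using e(2) by auto
    then have "N (coeff (R * pderiv Q - pderiv R * Q) (e + b - 1)) = 1"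
      by (intro wronskian_unit_coeff R_int Q_int e b)
    moreover have "R * pderiv Q - pderiv R * Q = wr True"
      by (simp add: wr R_def pderiv_diff pderiv_smult algebra_simps)
    ultimately show ?thesis
      using that by simp
  qed
qed

text \<open>A bad class in the affine chart contains a root of the Wronskian. All points reducing to
  infinity form one class, which is added without asking whether it is bad.\<close>

lemma finite_bad_classes:
  obtains S where "finite S" "\<And>z. bad z \<Longrightarrow> \<exists>s\<in>S. near z s"
proof
  obtain i where i: "N (coeff (wr True) i) = 1"
    by (rule wr_unit_coeff)
  then have "wr True \<noteq> 0"
    by auto
  then show "finite (insert None (Some ` {r. poly (wr True) r = 0}))"
    by (simp add: poly_roots_finite)
  fix z assume "bad z"
  show "\<exists>s\<in>insert None (Some ` {r. poly (wr True) r = 0}). near z s"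
  proof (cases "chart z")
    case True
    then obtain r where r: "poly (wr True) r = 0" "N (lc z - r) < 1"
      using root_near[OF ac N_lc_le1[of z], of "wr True" i] \<open>bad z\<close> i by (auto simp: bad_def)
    then have "N r \<le> 1"
      using N_diff_le[OF N_lc_le1[of z], of "lc z - r"] by simp
    then have "near z (Some r)"
      using r(2) True chart_coords[of z] by (simp add: near_def pdist_def lc_def cx_def cy_def)
    then show ?thesis
      using r(1) by blast
  next
    case False
    then have "near z None"
      using chart_coords(4)[OF False] by (simp add: near_def pdist_def cx_def cy_def)
    then show ?thesis
      by blast
  qed
qed

text \<open>Preimages of \<open>w\<close> are the zeros of the form \<open>\<phi>\<close>, which is
  nonzero modulo the maximal ideal and vanishes there at \<open>z\<close>; \<open>root_near\<close>
  provides a zero in the class of \<open>z\<close>, bad or not.\<close>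

lemma near_class_surj:
  assumes "near w (f z)"
  obtains z' where "near z' z" "f z' = w"
proof -
  define c where "c = chart z"
  define \<phi> where "\<phi> = smult (cy w) P - smult (cx w) Q"
  have deg: "degree \<phi> \<le> d"
    unfolding \<phi>_def using degree_PQ by (intro degree_diff_le order_trans[OF degree_smult_le])
  obtain l where l: "N l = 1" "hform d P (cx z) (cy z) = l * cx (f z)"
      "hform d Q (cx z) (cy z) = l * cy (f z)"
    by (rule f_coords)
  have "hform d \<phi> (cx z) (cy z) = l * (cx (f z) * cy w - cx w * cy (f z))"
    by (simp add: \<phi>_def hform_combination l algebra_simps)
  then have "N (hform d \<phi> (cx z) (cy z)) < 1"
    using near_sym[OF assms] l(1) by (simp add: N_mult near_def pdist_def)
  then have small: "N (poly (cpoly c \<phi>) (lc z)) < 1"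
    by (simp add: hform_coords[OF deg] c_def)
  obtain i where i: "N (coeff \<phi> i) = 1"
    unfolding \<phi>_def by (rule combination_unit_coeff[OF coords_norm[of w]])
  then have "coeff \<phi> i \<noteq> 0"
    by auto
  then have "i \<le> d"
    using deg le_degree[of \<phi> i] by simp
  have "\<exists>j. N (coeff (cpoly c \<phi>) j) = 1"
  proof (cases c)
    case True
    then show ?thesis
      using i by (auto simp: cpoly_def)
  next
    case False
    then show ?thesis
      using i \<open>i \<le> d\<close> by (intro exI[of _ "d - i"]) (simp add: coeff_cpoly_False)
  qed
  then obtain r where r: "poly (cpoly c \<phi>) r = 0" "N (lc z - r) < 1"
    using root_near[OF ac N_lc_le1 _ small] by (metis order_refl)
  \<comment> \<open>In the chart at infinity the local coordinate \<open>r\<close> belongs to the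
    point with coordinates 1 and \<open>r\<close>.\<close>
  define z' where "z' = (if c then Some r else pt 1 r)"
  have z': "chart z' = c \<and> lc z' = r"
  proof (cases c)
    case True
    have "N r \<le> 1"
      using N_diff_le[OF N_lc_le1[of z], of "lc z - r"] r(2) by simp
    then show ?thesis
      using True by (simp add: z'_def chart_def lc_def cx_def)
  next
    case False
    have "N (lc z) < 1"
      using False chart_coords(4)[of z] by (simp add: c_def lc_def)
    then have "N r < 1"
      using N_diff_less[of "lc z" 1 "lc z - r"] r(2) by simp
    then show ?thesis
      using False N_pos[of r] by (simp add: z'_def pt_def chart_def lc_def cy_def N_divide)
  qed
  have "near z' z"
    using pdist_same_chart[of z' z] z' r(2) by (simp add: c_def near_def N_minus_commute)
  moreover have "f z' = w"
  proof -
    have "hform d \<phi> (cx z') (cy z') = 0"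
      using hform_coords[OF deg, of z'] z' r(1) by simp
    moreover obtain m where m: "N m = 1" "hform d P (cx z') (cy z') = m * cx (f z')"
      "hform d Q (cx z') (cy z') = m * cy (f z')"
      by (rule f_coords)
    ultimately have "m * (cx (f z') * cy w - cx w * cy (f z')) = 0"
      by (simp add: \<phi>_def hform_combination algebra_simps)
    then have "pdist (f z') w = 0"
      using m(1) by (auto simp: pdist_def)
    then show ?thesis
      by (simp add: pdist_eq_0)
  qed
  ultimately show thesis
    by (rule that)
qed

text \<open>Only finite points are counted; the point at infinity is rational and never enters a
  ramified step.\<close>

lemma finite_fiber:
  "finite {y. f (Some y) = b}" "card {y. f (Some y) = b} \<le> d"
proof -
  define w where "w = (case b of None \<Rightarrow> Q | Some c \<Rightarrow> P - smult c Q)"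
  have deg: "degree w \<le> d"
    unfolding w_def using degree_PQ order_trans[OF degree_smult_le degree_PQ(2)]
    by (auto split: option.splits intro: degree_diff_le)
  have "w \<noteq> 0"
  proof
    assume w0: "w = 0"
    \<comment> \<open>Proportional coprime polynomials are constant, which contradicts
      \<open>2 \<le> d\<close>.\<close>
    have "degree P = 0 \<and> degree Q = 0"
    proof (cases b)
      case None
      then have "Q = 0"
        using w0 by (simp add: w_def)
      then show ?thesis
        using PQ_coprime by (auto simp: is_unit_poly_iff)
    next
      case (Some c)
      then have "P = smult c Q"
        using w0 by (simp add: w_def)
      then have "Q dvd P"
        by (simp add: dvd_smult)
      then have "is_unit Q"
        using PQ_coprime by (meson coprime_common_divisor dvd_refl)
      then show ?thesis
        using \<open>P = smult c Q\<close> by (auto simp: is_unit_poly_iff)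
    qed
    then show False
      using d_bounds d_def by simp
  qed
  have sub: "{y. f (Some y) = b} \<subseteq> {y. poly w y = 0}"
    by (auto simp: w_def rat_map_def split: if_splits option.splits)
  show "finite {y. f (Some y) = b}"
    by (rule finite_subset[OF sub poly_roots_finite[OF \<open>w \<noteq> 0\<close>]])
  have "card {y. f (Some y) = b} \<le> card {y. poly w y = 0}"
    by (rule card_mono[OF poly_roots_finite[OF \<open>w \<noteq> 0\<close>] sub])
  also have "\<dots> \<le> degree w"
    by (rule card_poly_roots_bound[OF \<open>w \<noteq> 0\<close>])
  finally show "card {y. f (Some y) = b} \<le> d"
    using deg by simp
qed

section \<open>Galois equivariance\<close>

context
  fixes \<sigma> assumes \<sigma>: "\<sigma> \<in> galois_group K"
begin

lemma galois_f: "map_option \<sigma> (f z) = f (map_option \<sigma> z)"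
proof (cases z)
  case None
  then show ?thesis
    using galois_groupD(4)[OF \<sigma>] P_in_K Q_in_K
    by (simp add: rat_map_def Let_def galois_divide[OF \<sigma>])
next
  case (Some x)
  have "\<sigma> (poly P x) = poly P (\<sigma> x)" "\<sigma> (poly Q x) = poly Q (\<sigma> x)"
    by (rule galois_poly[OF \<sigma>], rule P_in_K Q_in_K)+
  moreover have "poly Q (\<sigma> x) = 0 \<longleftrightarrow> poly Q x = 0"
    using galois_eq_0[OF \<sigma>, of "poly Q x"] calculation(2) by simp
  ultimately show ?thesis
    by (simp add: Some rat_map_def galois_divide[OF \<sigma>])
qed

lemma galois_f_iterate: "map_option \<sigma> ((f ^^ n) z) = (f ^^ n) (map_option \<sigma> z)"
  by (induction n) (simp_all add: galois_f)

lemma galois_coords: "cx (map_option \<sigma> z) = \<sigma> (cx z)" "cy (map_option \<sigma> z) = \<sigma> (cy z)"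
  using galois_1[OF \<sigma>] galois_0[OF \<sigma>] galois_divide[OF \<sigma>]
  by (auto simp: cx_def cy_def N_galois_K[OF \<sigma>] split: option.splits)

lemma inert_near:
  assumes "\<sigma> \<in> inert"
  shows "near (map_option \<sigma> z) z"
proof -
  have "chart (map_option \<sigma> z) = chart z"
    by (cases z) (simp_all add: chart_def N_galois_K[OF \<sigma>])
  moreover have "lc (map_option \<sigma> z) = \<sigma> (lc z)"
    using calculation by (simp add: lc_def galois_coords)
  ultimately show ?thesis
    using assms N_lc_le1[of z] by (simp add: near_def pdist_same_chart inert_def)
qed

end

end

section \<open>Ramification in the tree\<close>

lemma galois_power_int:
  "\<sigma> \<in> galois_group K \<Longrightarrow> \<sigma> (x powi k) = \<sigma> x powi k"
  by (simp add: power_int_def galois_power galois_inverse)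

lemma (in nonarch) N_power_int: "N (x powi k) = N x powi k"
  by (simp add: power_int_def N_power N_inverse)

section \<open>Subgroups of inertia, growth of value groups and tameness\<close>

context padic_closure
begin

lemma inert_comp:
  assumes "\<sigma> \<in> galois_group K \<inter> inert" "\<tau> \<in> galois_group K \<inter> inert"
  shows "\<sigma> \<circ> \<tau> \<in> galois_group K \<inter> inert"
proof -
  have \<sigma>: "\<sigma> \<in> galois_group K" and \<tau>: "\<tau> \<in> galois_group K"
    using assms by auto
  have "N (\<sigma> (\<tau> x) - x) < 1" if "N x \<le> 1" for x
  proof -
    have "N (\<sigma> (\<tau> x) - \<tau> x) < 1" "N (\<tau> x - x) < 1"
      using assms that N_galois_K[OF \<tau>, of x] by (auto simp: inert_def)
    then have "N ((\<sigma> (\<tau> x) - \<tau> x) + (\<tau> x - x)) < 1"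
      by (rule N_add_less)
    then show ?thesis
      by simp
  qed
  then show ?thesis
    using galois_comp[OF \<sigma> \<tau>] by (simp add: inert_def)
qed

lemma inert_inv:
  assumes "\<sigma> \<in> galois_group K \<inter> inert"
  shows "inv_into UNIV \<sigma> \<in> galois_group K \<inter> inert"
proof -
  let ?i = "inv_into UNIV \<sigma>"
  have \<sigma>: "\<sigma> \<in> galois_group K"
    using assms by auto
  have "\<sigma> (?i x) = x" for x
    using galois_groupD(1)[OF \<sigma>] by (simp add: bij_is_surj surj_f_inv_f)
  moreover have "N (?i x) = N x" for x
    by (rule N_galois_K[OF galois_inv[OF \<sigma>]])
  moreover have "N (\<sigma> (?i x) - ?i x) < 1" if "N (?i x) \<le> 1" for x
    using assms that by (auto simp: inert_def)
  ultimately have "N (?i x - x) < 1" if "N x \<le> 1" for x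
    using that N_minus_commute[of "?i x" x] by simp
  then show ?thesis
    using galois_inv[OF \<sigma>] by (simp add: inert_def)
qed

text \<open>Such a \<open>J\<close> stands for its fixed field; values of this field are described
  through elements fixed by all of \<open>J\<close>.\<close>

definition inert_subgroup :: "('a \<Rightarrow> 'a) set \<Rightarrow> bool" where
  "inert_subgroup J \<longleftrightarrow> J \<subseteq> galois_group K \<inter> inert \<and> id \<in> J \<and>
     (\<forall>\<sigma>\<in>J. \<forall>\<tau>\<in>J. \<sigma> \<circ> \<tau> \<in> J) \<and> (\<forall>\<sigma>\<in>J. inv_into UNIV \<sigma> \<in> J)"

lemma inert_subgroupD:
  assumes "inert_subgroup J"
  shows "id \<in> J" "\<sigma> \<in> J \<Longrightarrow> \<tau> \<in> J \<Longrightarrow> \<sigma> \<circ> \<tau> \<in> J" "\<sigma> \<in> J \<Longrightarrow> inv_into UNIV \<sigma> \<in> J"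
    "\<sigma> \<in> J \<Longrightarrow> \<sigma> \<in> galois_group K" "\<sigma> \<in> J \<Longrightarrow> \<sigma> \<in> inert"
  using assms unfolding inert_subgroup_def by blast+

lemma inert_subgroup_full: "inert_subgroup (galois_group K \<inter> inert)"
proof -
  have "id \<in> galois_group K \<inter> inert"
    by (simp add: galois_group_def inert_def)
  then show ?thesis
    unfolding inert_subgroup_def using inert_comp inert_inv by blast
qed

lemma inv_galois_eq:
  assumes "\<sigma> \<in> galois_group K"
  shows "inv_into UNIV \<sigma> y = x \<longleftrightarrow> y = \<sigma> x"
  using galois_groupD(1)[OF assms] by (metis bij_inv_eq_iff)

lemma inert_subgroup_pointwise_stabilizer:
  assumes J: "inert_subgroup J"
  shows "inert_subgroup {\<sigma>\<in>J. \<forall>y\<in>Y. \<sigma> y = y}"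
proof -
  have "inv_into UNIV \<sigma> y = y" if "\<sigma> \<in> J" "\<sigma> y = y" for \<sigma> y
    using inv_galois_eq[OF inert_subgroupD(4)[OF J that(1)]] that(2) by simp
  then show ?thesis
    unfolding inert_subgroup_def using J inert_subgroupD[OF J] by (auto simp: inert_subgroup_def)
qed

text \<open>The conjugates of \<open>x\<close> under \<open>J\<close> have equal absolute value and their product is fixed by
  \<open>J\<close>; their number is bounded since they are determined by the permutation of \<open>Y\<close>.\<close>

lemma value_group_pointwise_stabilizer:
  assumes J: "inert_subgroup J" and Y: "finite Y" "card Y \<le> d" "0 < d"
    and stable: "\<And>\<sigma> y. \<sigma> \<in> J \<Longrightarrow> y \<in> Y \<Longrightarrow> \<sigma> y \<in> Y"
    and val: "\<And>x. x \<noteq> 0 \<Longrightarrow> (\<And>\<sigma>. \<sigma> \<in> J \<Longrightarrow> \<sigma> x = x) \<Longrightarrow> \<exists>k. N x ^ e = N (of_nat p) powi k"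
    and x: "x \<noteq> 0" "\<And>\<sigma>. \<sigma> \<in> J \<Longrightarrow> (\<And>y. y \<in> Y \<Longrightarrow> \<sigma> y = y) \<Longrightarrow> \<sigma> x = x"
  shows "\<exists>k. N x ^ (e * fact (d ^ d)) = N (of_nat p) powi k"
proof -
  define Orb where "Orb = (\<lambda>\<sigma>. \<sigma> x) ` J"
  have "\<forall>z\<in>Orb. \<exists>\<sigma>. \<sigma> \<in> J \<and> z = \<sigma> x"
    by (auto simp: Orb_def)
  then obtain \<tau> where \<tau>: "\<And>z. z \<in> Orb \<Longrightarrow> \<tau> z \<in> J" "\<And>z. z \<in> Orb \<Longrightarrow> z = \<tau> z x"
    by metis
  \<comment> \<open>If two conjugates are reached by elements agreeing on \<open>Y\<close>, the
    quotient of these elements fixes \<open>Y\<close> pointwise and hence \<open>x\<close>. So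
    \<open>g\<close> embeds the orbit into the self-maps of \<open>Y\<close>.\<close>
  define g where "g = (\<lambda>z. restrict (\<tau> z) Y)"
  have inj: "inj_on g Orb"
  proof (rule inj_onI)
    fix z w assume zw: "z \<in> Orb" "w \<in> Orb" "g z = g w"
    let ?i = "inv_into UNIV (\<tau> z)"
    have tz: "\<tau> z \<in> galois_group K"
      using \<tau>(1)[OF zw(1)] inert_subgroupD(4)[OF J] by blast
    have "\<tau> z y = \<tau> w y" if "y \<in> Y" for y
      using fun_cong[OF zw(3), of y] that by (simp add: g_def)
    then have "(?i \<circ> \<tau> w) y = y" if "y \<in> Y" for y
      using that by (simp add: inv_galois_eq[OF tz])
    moreover have "?i \<circ> \<tau> w \<in> J"
      using inert_subgroupD(2,3)[OF J] \<tau>(1) zw by blast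
    ultimately have "(?i \<circ> \<tau> w) x = x"
      using x(2) by blast
    then have "\<tau> w x = \<tau> z x"
      by (simp add: inv_galois_eq[OF tz])
    then show "z = w"
      using \<tau>(2) zw by metis
  qed
  have "g ` Orb \<subseteq> PiE Y (\<lambda>_. Y)"
    using stable \<tau>(1) by (auto simp: g_def split: if_splits)
  moreover have "finite (PiE Y (\<lambda>_. Y))"
    using Y(1) by (intro finite_PiE)
  ultimately have fin: "finite Orb" and "card Orb \<le> card (PiE Y (\<lambda>_. Y))"
    using inj_on_finite[OF inj] card_inj_on_le[OF inj] by blast+
  then have "card Orb \<le> card Y ^ card Y"
    using Y(1) by (simp add: card_PiE)
  also have "\<dots> \<le> d ^ card Y"
    by (intro power_mono Y(2)) simp
  also have "\<dots> \<le> d ^ d"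
    using Y(2,3) by (intro power_increasing) auto
  finally have card_le: "card Orb \<le> d ^ d" .
  have "x \<in> Orb"
    unfolding Orb_def using inert_subgroupD(1)[OF J] by (intro image_eqI[of _ _ id]) auto
  then have "1 \<le> card Orb"
    using fin by (metis One_nat_def Suc_leI card_gt_0_iff empty_iff)
  have NO: "N z = N x" if "z \<in> Orb" for z
    using that N_galois_K inert_subgroupD(4)[OF J] by (auto simp: Orb_def)
  define y where "y = (\<Prod>z\<in>Orb. z)"
  have "N y = N x ^ card Orb"
    by (simp add: y_def N_prod NO)
  then have "y \<noteq> 0"
    using N_pos[OF x(1)] by auto
  have "\<sigma> y = y" if s: "\<sigma> \<in> J" for \<sigma>
  proof -
    have sK: "\<sigma> \<in> galois_group K"
      using inert_subgroupD(4)[OF J s] .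
    have "\<sigma> ` Orb \<subseteq> Orb"
    proof
      fix w assume "w \<in> \<sigma> ` Orb"
      then obtain t where "t \<in> J" "w = (\<sigma> \<circ> t) x"
        by (auto simp: Orb_def)
      then show "w \<in> Orb"
        unfolding Orb_def using inert_subgroupD(2)[OF J s] by blast
    qed
    moreover have "inj_on \<sigma> Orb"
      using galois_inj[OF sK] by (auto intro: inj_onI)
    ultimately have im: "\<sigma> ` Orb = Orb"
      using endo_inj_surj[OF fin] by blast
    have "\<sigma> y = (\<Prod>z\<in>Orb. \<sigma> z)"
      by (simp add: y_def galois_prod[OF sK])
    also have "\<dots> = (\<Prod>z\<in>\<sigma> ` Orb. z)"
      using \<open>inj_on \<sigma> Orb\<close> by (simp add: prod.reindex)
    finally show ?thesis
      by (simp add: im y_def)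
  qed
  then obtain k where k: "N y ^ e = N (of_nat p) powi k"
    using val[OF \<open>y \<noteq> 0\<close>] by blast
  \<comment> \<open>The factorial replaces the unknown orbit length by an exponent depending only on
    \<open>d\<close>.\<close>
  have "card Orb dvd fact (d ^ d)"
    by (rule dvd_fact[OF \<open>1 \<le> card Orb\<close> card_le])
  then obtain c where c: "fact (d ^ d) = card Orb * c"
    by (rule dvdE)
  have "N x ^ (e * fact (d ^ d)) = (N y ^ e) ^ c"
    unfolding c \<open>N y = N x ^ card Orb\<close> power_mult[symmetric] by (simp only: mult_ac)
  also have "\<dots> = N (of_nat p) powi (k * int c)"
    by (simp add: k power_int_mult)
  finally show ?thesis
    by blast
qed

text \<open>Tameness: with \<open>\<delta>\<close> the difference of \<open>\<gamma>\<close> and the mean of its \<open>\<sigma>\<close>-orbit, all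
  \<open>\<sigma>^i \<delta>\<close> are close to \<open>\<delta>\<close> while they sum to 0 and their number is prime to \<open>p\<close>.\<close>

lemma tame_inertia_fixes:
  assumes \<sigma>: "\<sigma> \<in> galois_group K" "\<sigma> \<in> inert" and \<rho>: "\<sigma> \<rho> = \<rho>" "\<rho> ^ E = of_nat p" "0 < E"
    and Y: "finite Y" "card Y < p" "\<gamma> \<in> Y" and stable: "\<And>y. y \<in> Y \<Longrightarrow> \<sigma> y \<in> Y"
    and J: "J \<subseteq> galois_group K" "\<And>\<tau> y. \<tau> \<in> J \<Longrightarrow> y \<in> Y \<Longrightarrow> \<tau> y = y"
    and val: "\<And>x. x \<noteq> 0 \<Longrightarrow> (\<And>\<tau>. \<tau> \<in> J \<Longrightarrow> \<tau> x = x) \<Longrightarrow> \<exists>k. N x ^ E = N (of_nat p) powi k"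
  shows "\<sigma> \<gamma> = \<gamma>"
proof -
  define s where "s = (\<lambda>i. (\<sigma> ^^ i) \<gamma>)"
  have sY: "s i \<in> Y" for i
    by (induction i) (auto simp: s_def Y stable)
  have s_Suc: "\<sigma> (s i) = s (Suc i)" for i
    by (simp add: s_def)
  have "\<not> inj_on s {..card Y}"
  proof
    assume "inj_on s {..card Y}"
    then have "card {..card Y} \<le> card Y"
      using sY by (intro card_inj_on_le[OF _ _ Y(1)]) auto
    then show False
      by simp
  qed
  then obtain i j where ij: "i < j" "j \<le> card Y" "s i = s j"
    unfolding inj_on_def by (metis atMost_iff linorder_neqE_nat)
  \<comment> \<open>Injectivity of \<open>\<sigma>\<close> turns a repetition somewhere in the orbit
    into a return to \<open>\<gamma>\<close> itself.\<close>
  have down: "s 0 = s l" if "s i = s (i + l)" for i l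
    using that by (induction i) (auto simp: galois_inj[OF \<sigma>(1)] simp flip: s_Suc)
  define M where "M = j - i"
  have M: "0 < M" "M < p" "s M = s 0"
    using ij Y(2) down[of i M] by (auto simp: M_def)
  define a where "a = (\<Sum>i<M. s i) / of_nat M"
  have "(\<Sum>i<M. s (Suc i)) = (\<Sum>i<M. s i)"
    using sum.lessThan_Suc_shift[of s M] sum.lessThan_Suc[of s M] M(3) by simp
  then have \<sigma>a: "\<sigma> a = a"
    by (simp add: a_def galois_divide[OF \<sigma>(1)] galois_sum[OF \<sigma>(1)] galois_of_nat[OF \<sigma>(1)] s_Suc)
  have M0: "(of_nat M :: 'a) \<noteq> 0"
    using M(1) by simp
  define \<delta> where "\<delta> = \<gamma> - a"
  have "\<delta> = 0"
  proof (rule ccontr)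
    assume \<delta>0: "\<delta> \<noteq> 0"
    have "\<tau> \<delta> = \<delta>" if "\<tau> \<in> J" for \<tau>
    proof -
      have t: "\<tau> \<in> galois_group K"
        using J(1) that by blast
      have "\<tau> (s i) = s i" for i
        using J(2)[OF that sY] .
      moreover have "\<tau> \<gamma> = \<gamma>"
        using J(2)[OF that Y(3)] .
      ultimately show ?thesis
        by (simp add: \<delta>_def a_def galois_diff[OF t] galois_divide[OF t] galois_sum[OF t] galois_of_nat[OF t])
    qed
    then obtain k where k: "N \<delta> ^ E = N (of_nat p) powi k"
      using val[OF \<delta>0] by blast
    \<comment> \<open>\<open>r\<close> is fixed by \<open>\<sigma>\<close> and has the absolute
      value of \<open>\<delta>\<close>. Hence \<open>\<delta> / r\<close> is a unit, whose residue
      inertia preserves.\<close>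
    define r where "r = \<rho> powi k"
    have "\<rho> \<noteq> 0"
      using \<rho>(2,3) p(2) by (auto simp: power_0_left)
    then have "r \<noteq> 0"
      by (simp add: r_def)
    have "N r ^ E = (N \<rho> ^ E) powi k"
      by (simp add: r_def N_power_int power_int_power power_int_power' mult.commute)
    also have "N \<rho> ^ E = N (of_nat p)"
      by (simp add: \<rho>(2) flip: N_power)
    also have "N (of_nat p) powi k = N \<delta> ^ E"
      by (simp only: k)
    finally have Nr: "N r = N \<delta>"
      using \<rho>(3) by (metis N_nonneg power_eq_imp_eq_base)
    define u where "u = \<delta> / r"
    have "N u \<le> 1"
      using N_pos[OF \<delta>0] by (simp add: u_def N_divide Nr)
    then have "N (\<sigma> u - u) < 1"
      using \<sigma>(2) by (simp add: inert_def)
    moreover have "\<sigma> r = r"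
      by (simp add: r_def galois_power_int[OF \<sigma>(1)] \<rho>(1))
    then have "\<sigma> \<delta> - \<delta> = (\<sigma> u - u) * r"
      using \<open>r \<noteq> 0\<close> by (simp add: u_def galois_divide[OF \<sigma>(1)] left_diff_distrib)
    ultimately have close: "N (\<sigma> \<delta> - \<delta>) < N \<delta>"
      using N_pos[OF \<open>r \<noteq> 0\<close>] by (simp add: N_mult Nr)
    have "N ((\<sigma> ^^ i) \<delta> - \<delta>) < N \<delta>" for i
    proof (induction i)
      case (Suc i)
      have "N (\<sigma> ((\<sigma> ^^ i) \<delta> - \<delta>)) < N \<delta>"
        using Suc by (simp add: N_galois_K[OF \<sigma>(1)])
      then have "N (\<sigma> ((\<sigma> ^^ i) \<delta> - \<delta>) + (\<sigma> \<delta> - \<delta>)) < N \<delta>"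
        using close by (rule N_add_less)
      then show ?case
        by (simp add: galois_diff[OF \<sigma>(1)])
    qed (use N_pos[OF \<delta>0] in simp)
    then have "N (\<Sum>i<M. (\<sigma> ^^ i) \<delta> - \<delta>) < N \<delta>"
      using N_pos[OF \<delta>0] by (intro N_sum_less)
    moreover have "(\<sigma> ^^ i) \<delta> = s i - a" for i
      by (induction i) (simp_all add: \<delta>_def s_def galois_diff[OF \<sigma>(1)] \<sigma>a)
    then have "(\<Sum>i<M. (\<sigma> ^^ i) \<delta> - \<delta>) = - (of_nat M * \<delta>)"
      using M0 by (simp add: sum_subtractf a_def)
    ultimately have "N (of_nat M * \<delta>) < N \<delta>"
      by simp
    then show False
      using M by (simp add: N_mult N_of_nat_unit)
  qed
  then show ?thesis
    using \<sigma>a by (simp add: \<delta>_def)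
qed

lemma finite_extension_refl: "finite_extension K K"
proof -
  have "K = lspan K {1}"
    by (auto simp: lspan_def)
  then show ?thesis
    using K_field unfolding finite_extension_def finite_dim_over_def lspan_def
    by (auto simp: is_subfield_def intro!: exI[of _ "{1}"])
qed

lemma exists_root_of_p:
  assumes "0 < E"
  obtains L r where "finite_extension K L" "r \<in> L" "r ^ E = of_nat p"
proof -
  have Kr: "is_subring K"
    by (rule is_subfield_imp_subring[OF K_field])
  have "degree (monom 1 E + [:- of_nat p :: 'a:]) = E"
    using assms by (subst degree_add_eq_left) (auto simp: degree_monom_eq)
  then obtain r where "poly (monom 1 E + [:- of_nat p :: 'a:]) r = 0"
    using ac assms unfolding algebraically_closed_type_def by (metis One_nat_def Suc_leI)
  then have r: "r ^ E = of_nat p"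
    by (simp add: poly_monom)
  have "1 \<in> lspan K ((\<lambda>i. r ^ i) ` {..<E})"
    using assms by (intro lspan_base[OF Kr]) (auto intro!: image_eqI[of _ _ 0])
  then have in_span: "r ^ E \<in> lspan K ((\<lambda>i. r ^ i) ` {..<E})"
    unfolding r using lspan_scale[OF Kr is_subring_of_nat[OF Kr, of p]] by fastforce
  have "r ^ 1 \<in> lspan K ((\<lambda>i. r ^ i) ` {..<E})"
    by (rule power_in_lspan_powers[OF Kr in_span assms])
  then show thesis
    using that finite_extension_adjoin[OF K_field in_span assms] r by simp
qed

end

section \<open>Branches and paths through bad classes\<close>

context good_map
begin

text \<open>Infinite descent: a power of each distance is \<open>N p ^ k m\<close> with a natural
  exponent, distances never decrease along the branch, and each bad passage strictly lowers the
  exponent.\<close>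

lemma periodic_bad_branch_ramified:
  assumes \<alpha>: "\<And>m. f (\<alpha> (Suc m)) = \<alpha> m" and per: "\<And>m. near (\<alpha> m) (\<alpha> (m + n))"
    and bad: "\<And>m. \<exists>m'\<ge>m. bad (\<alpha> m')"
    and L: "finite_extension K L"
    and fixed: "\<And>\<sigma> m. \<sigma> \<in> galois_group L \<inter> inert \<Longrightarrow> map_option \<sigma> (\<alpha> m) = \<alpha> m"
  shows "\<alpha> i = \<alpha> (i + n)"
proof (rule ccontr)
  assume neq: "\<alpha> i \<noteq> \<alpha> (i + n)"
  have "K \<subseteq> L"
    by (rule finite_extensionE[OF L])
  \<comment> \<open>Since \<open>f\<close> maps each level to the one below it, distinct points at
    level \<open>i\<close> have distinct points above them; every level from \<open>i\<close> on
    keeps a positive distance.\<close>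
  have ne: "\<alpha> m \<noteq> \<alpha> (m + n)" if "i \<le> m" for m
    using that
  proof (induction m rule: dec_induct)
    case (step m)
    then show ?case
      using \<alpha>[of m] \<alpha>[of "m + n"] by auto
  qed (rule neq)
  obtain e where e: "0 < e" "\<forall>x. x \<noteq> 0 \<longrightarrow> (\<forall>\<sigma>\<in>galois_group L \<inter> inert. \<sigma> x = x) \<longrightarrow>
    (\<exists>k. N x ^ e = N (of_nat p) powi k)"
    using fixed_value_group_discrete[OF L] by blast
  define u where "u = (\<lambda>m. pdist (\<alpha> m) (\<alpha> (m + n)))"
  have u_step: "u m \<le> u (Suc m)" for m
    using pdist_f_le[OF per[of "Suc m"]] by (simp add: u_def \<alpha>)
  have u_mono: "u m \<le> u m'" if "m \<le> m'" for m m'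
    by (rule lift_Suc_mono_le[of u, OF u_step that])
  have u_strict: "u m < u (Suc m)" if "bad (\<alpha> (Suc m))" "i \<le> m" for m
    using pdist_f_less[OF per[of "Suc m"] that(1)] ne[of "Suc m"] that(2) by (simp add: u_def \<alpha>)
  have "\<exists>k. u m ^ e = N (of_nat p) ^ k" if "i \<le> m" for m
  proof -
    define x where "x = cx (\<alpha> m) * cy (\<alpha> (m + n)) - cx (\<alpha> (m + n)) * cy (\<alpha> m)"
    have Nx: "N x = u m"
      by (simp add: x_def u_def pdist_def)
    have u: "0 < u m" "u m < 1"
      using ne[OF that] per[of m] pdist_nonneg[of "\<alpha> m" "\<alpha> (m + n)"]
        pdist_eq_0[of "\<alpha> m" "\<alpha> (m + n)"] by (auto simp: u_def near_def)
    have "\<sigma> x = x" if s: "\<sigma> \<in> galois_group L \<inter> inert" for \<sigma>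
    proof -
      have sK: "\<sigma> \<in> galois_group K"
        using s galois_group_antimono[OF \<open>K \<subseteq> L\<close>] by blast
      have "\<sigma> (cx (\<alpha> l)) = cx (\<alpha> l)" "\<sigma> (cy (\<alpha> l)) = cy (\<alpha> l)" for l
        using galois_coords[OF sK, of "\<alpha> l"] fixed[OF s, of l] by simp_all
      then show ?thesis
        by (simp add: x_def galois_diff[OF sK] galois_groupD(3)[OF sK])
    qed
    moreover have "x \<noteq> 0"
      using Nx u(1) by auto
    ultimately obtain k where k: "u m ^ e = N (of_nat p) powi k"
      using e(2) Nx by metis
    \<comment> \<open>Distances are below 1, so the exponents are natural numbers and descent is
      possible.\<close>
    have "0 \<le> k"
    proof (rule ccontr)
      assume "\<not> 0 \<le> k"
      then have "1 \<le> N (of_nat p) powi k"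
        using Np Np_pos by (simp add: power_int_def one_le_inverse power_le_one)
      moreover have "u m ^ e < 1"
        using u e(1) by (simp add: power_Suc_less_one power_less_one_iff)
      ultimately show False
        using k by simp
    qed
    then show ?thesis
      using k by (intro exI[of _ "nat k"]) (simp add: power_int_def)
  qed
  then obtain k where k: "\<And>m. i \<le> m \<Longrightarrow> u m ^ e = N (of_nat p) ^ k m"
    by metis
  \<comment> \<open>A level with least exponent; the next bad passage above it would give a smaller
    one.\<close>
  obtain m where m: "i \<le> m" "\<And>m'. i \<le> m' \<Longrightarrow> k m \<le> k m'"
    using ex_has_least_nat[of "\<lambda>m. i \<le> m" i k] by auto
  obtain m' where m': "Suc m \<le> m'" "bad (\<alpha> m')"
    using bad by blast
  then obtain l where l: "m' = Suc l" "m \<le> l"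
    by (cases m') auto
  have "u m < u m'"
    using u_mono[OF l(2)] u_strict[of l] m'(2) l m(1) by simp
  then have "u m ^ e < u m' ^ e"
    using e(1) by (intro power_strict_mono) (simp_all add: u_def pdist_nonneg)
  then have "N (of_nat p) ^ k m < N (of_nat p) ^ k m'"
    using k m(1) l by simp
  then have "k m' < k m"
    using Np Np_pos by (simp add: power_strict_decreasing_iff)
  then show False
    using m(2)[of m'] m(1) l by simp
qed

text \<open>Beyond level \<open>j\<close> a preimage is chosen in the residue class met
  \<open>n\<close> levels earlier. The clause \<open>n = 0\<close> guards termination.\<close>

fun periodic_extension :: "(nat \<Rightarrow> 'a option) \<Rightarrow> nat \<Rightarrow> nat \<Rightarrow> nat \<Rightarrow> 'a option" where
  "periodic_extension z j n m = (if m \<le> j \<or> n = 0 then z m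
     else SOME w. near w (periodic_extension z j n (m - n)) \<and>
       f w = periodic_extension z j n (m - 1))"

declare periodic_extension.simps [simp del]

lemma periodic_branch_exists:
  assumes z: "\<And>m. m < j \<Longrightarrow> f (z (Suc m)) = z m" and ij: "i < j" "near (z i) (z j)"
  obtains \<alpha> where "\<And>m. m \<le> j \<Longrightarrow> \<alpha> m = z m" "\<And>m. f (\<alpha> (Suc m)) = \<alpha> m"
    "\<And>m. near (\<alpha> m) (\<alpha> (m + (j - i)))"
proof -
  define n where "n = j - i"
  define \<alpha> where "\<alpha> = periodic_extension z j n"
  have n: "0 < n" "n \<le> j"
    using ij by (auto simp: n_def)
  have start: "\<alpha> m = z m" if "m \<le> j" for m
    using that by (simp add: \<alpha>_def periodic_extension.simps)
  \<comment> \<open>Closeness at levels \<open>i\<close> and \<open>j\<close> descends along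
    \<open>f\<close>, so the whole given path already repeats its classes with period
    \<open>n\<close>.\<close>
  have down: "near (z (i - t)) (z (j - t))" if "t \<le> i" for t
    using that
  proof (induction t)
    case (Suc t)
    then have "near (f (z (i - t))) (f (z (j - t)))"
      by (intro near_f) simp
    moreover have "i - t = Suc (i - Suc t)" "j - t = Suc (j - Suc t)"
      using Suc.prems ij by auto
    ultimately show ?case
      using z[of "i - Suc t"] z[of "j - Suc t"] Suc.prems ij by simp
  qed (use ij in simp)
  \<comment> \<open>Both claims go through one induction: the chosen preimage exists because of the
    closeness one level below.\<close>
  have "(m \<ge> 1 \<longrightarrow> f (\<alpha> m) = \<alpha> (m - 1)) \<and> (m \<ge> n \<longrightarrow> near (\<alpha> m) (\<alpha> (m - n)))" for m
  proof (induction m rule: less_induct)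
    case (less m)
    show ?case
    proof (cases "m \<le> j")
      case True
      have "f (\<alpha> m) = \<alpha> (m - 1)" if "m \<ge> 1"
        using z[of "m - 1"] True that by (simp add: start)
      moreover have "near (\<alpha> m) (\<alpha> (m - n))" if "m \<ge> n"
      proof -
        have "j - m \<le> i" "i - (j - m) = m - n" "j - (j - m) = m"
          using True that ij by (auto simp: n_def)
        then have "near (z (m - n)) (z m)"
          using down[of "j - m"] by simp
        then show ?thesis
          using True near_sym by (simp add: start)
      qed
      ultimately show ?thesis
        by blast
    next
      case False
      have "near (\<alpha> (m - 1)) (\<alpha> (m - 1 - n))" "f (\<alpha> (m - n)) = \<alpha> (m - n - 1)"
        using less[of "m - 1"] less[of "m - n"] False n by auto
      then have "near (\<alpha> (m - 1)) (f (\<alpha> (m - n)))"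
        by (simp add: add.commute)
      then have "\<exists>w. near w (\<alpha> (m - n)) \<and> f w = \<alpha> (m - 1)"
        by (rule near_class_surj) blast
      moreover have "\<alpha> m = (SOME w. near w (\<alpha> (m - n)) \<and> f w = \<alpha> (m - 1))"
        using False n(1) unfolding \<alpha>_def by (subst periodic_extension.simps) simp
      ultimately have "near (\<alpha> m) (\<alpha> (m - n)) \<and> f (\<alpha> m) = \<alpha> (m - 1)"
        by (simp only:) (rule someI_ex)
      then show ?thesis
        by blast
    qed
  qed
  then have "f (\<alpha> (Suc m)) = \<alpha> m" "near (\<alpha> (m + n)) (\<alpha> m)" for m
    by (metis diff_Suc_1 le_add1 plus_1_eq_Suc, metis add_diff_cancel_right' le_add2)
  then show thesis
    using start near_sym by (intro that[of \<alpha>]) (auto simp: n_def)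
qed

text \<open>Rationality is expressed by Galois invariance because equivariance of \<open>f\<close>
  carries it to forward images.\<close>

definition rational_pt :: "'a option \<Rightarrow> bool" where
  "rational_pt z \<longleftrightarrow> (\<forall>\<sigma>\<in>galois_group K. map_option \<sigma> z = z)"

text \<open>Levels count preimages above \<open>a0\<close>; values of \<open>z\<close> beyond
  \<open>n\<close> are arbitrary.\<close>

definition tree_path :: "'a \<Rightarrow> (nat \<Rightarrow> 'a option) \<Rightarrow> nat \<Rightarrow> bool" where
  "tree_path a0 z n \<longleftrightarrow> z 0 = Some a0 \<and> (\<forall>m<n. f (z (Suc m)) = z m)"

lemma rational_pt_None: "rational_pt None"
  by (simp add: rational_pt_def)

lemma branch_iterate:
  assumes "\<And>m. f (\<alpha> (Suc m)) = \<alpha> m"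
  shows "(f ^^ t) (\<alpha> (m + t)) = \<alpha> m"
  by (induction t) (simp_all add: assms funpow_swap1)

section \<open>The tree when every branch is finitely ramified\<close>

context
  fixes a0
  assumes a0: "a0 \<in> K"
    and branches: "\<And>\<alpha>. is_branch f a0 \<alpha> \<Longrightarrow> \<exists>L. finite_extension K L \<and>
      (\<forall>\<sigma>\<in>galois_group L \<inter> inert. \<forall>m. map_option \<sigma> (\<alpha> m) = \<alpha> m)"
begin

lemma rational_pt_a0: "rational_pt (Some a0)"
  using a0 by (simp add: rational_pt_def galois_groupD(4))

text \<open>The recurrent class yields a branch that repeats its classes and meets a bad one
  infinitely often. Finite ramification makes it truly periodic, so it returns to \<open>a0\<close>,
  and \<open>z i\<close> is a forward iterate of \<open>a0\<close>.\<close>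

lemma recurrent_bad_rational:
  assumes z: "tree_path a0 z n" and ij: "i < j" "j \<le> n" "near (z i) (z j)" "bad (z i)"
  shows "rational_pt (z i)"
proof -
  have "f (z (Suc m)) = z m" if "m < j" for m
    using z ij(2) that by (simp add: tree_path_def)
  then obtain \<alpha> where \<alpha>: "\<And>m. m \<le> j \<Longrightarrow> \<alpha> m = z m" "\<And>m. f (\<alpha> (Suc m)) = \<alpha> m"
    and per: "\<And>m. near (\<alpha> m) (\<alpha> (m + (j - i)))"
    using periodic_branch_exists[of j z i] ij by metis
  define l where "l = j - i"
  have l: "0 < l"
    using ij by (simp add: l_def)
  have "near (\<alpha> i) (\<alpha> (i + t * l))" for t
  proof (induction t)
    case (Suc t)
    then show ?case
      using near_trans[OF Suc per[of "i + t * l"]] by (simp add: l_def add_ac)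
  qed simp
  then have bad: "bad (\<alpha> (i + t * l))" for t
    using bad_near ij(4) \<alpha>(1)[of i] ij(1) by (metis less_imp_le)
  have io: "\<exists>m'\<ge>m. bad (\<alpha> m')" for m
  proof -
    have "m \<le> m * l"
      using l by simp
    then show ?thesis
      using bad[of m] by (intro exI[of _ "i + m * l"] conjI trans_le_add2)
  qed
  have "is_branch f a0 \<alpha>"
    using \<alpha> z by (simp add: is_branch_def tree_path_def)
  then obtain L where L: "finite_extension K L"
      "\<forall>\<sigma>\<in>galois_group L \<inter> inert. \<forall>m. map_option \<sigma> (\<alpha> m) = \<alpha> m"
    using branches by blast
  have eq: "\<alpha> m = \<alpha> (m + l)" for m
    unfolding l_def by (rule periodic_bad_branch_ramified[OF \<alpha>(2) per io L(1)]) (use L(2) in blast)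
  have "\<alpha> 0 = \<alpha> (t * l)" for t
  proof (induction t)
    case (Suc t)
    then show ?case
      using eq[of "t * l"] by (simp add: add_ac)
  qed simp
  \<comment> \<open>The branch is at \<open>a0\<close> again at level \<open>i * l\<close>, which is
    not below level \<open>i\<close>; iterating \<open>f\<close> from there reaches
    \<open>z i\<close>.\<close>
  moreover have "i \<le> i * l"
    using l by simp
  then have "(f ^^ (i * l - i)) (\<alpha> (i * l)) = \<alpha> i"
    using branch_iterate[of \<alpha> "i * l - i" i, OF \<alpha>(2)] by simp
  ultimately have "z i = (f ^^ (i * l - i)) (Some a0)"
    using \<alpha>(1)[of i] \<alpha>(1)[of 0] ij(1) z by (metis less_imp_le tree_path_def zero_le)
  then show ?thesis
    using rational_pt_a0 by (auto simp: rational_pt_def galois_f_iterate)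
qed

text \<open>The levels at which the stabilizer may have to shrink; at all others inertia fixing the
  point below also fixes the point itself.\<close>

definition ram_steps :: "(nat \<Rightarrow> 'a option) \<Rightarrow> nat \<Rightarrow> nat set" where
  "ram_steps z n = {i. i \<le> n \<and> bad (z i) \<and> \<not> rational_pt (z i)}"

lemma finite_ram_steps: "finite (ram_steps z n)"
  by (simp add: ram_steps_def)

text \<open>Two such levels in one residue class would make the lower point recurrent and hence
  rational, so they lie in distinct bad classes.\<close>

lemma card_ram_steps_le:
  assumes S: "finite S" "\<And>z. bad z \<Longrightarrow> \<exists>s\<in>S. near z s" and z: "tree_path a0 z n"
  shows "card (ram_steps z n) \<le> card S"
proof -
  have "\<forall>i\<in>ram_steps z n. \<exists>s\<in>S. near (z i) s"
    using S(2) by (simp add: ram_steps_def)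
  then obtain g where g: "\<And>i. i \<in> ram_steps z n \<Longrightarrow> g i \<in> S \<and> near (z i) (g i)"
    by metis
  have neq: "g i \<noteq> g j" if "i \<in> ram_steps z n" "j \<in> ram_steps z n" "i < j" for i j
  proof
    assume "g i = g j"
    then have "near (z i) (z j)"
      using g[OF that(1)] g[OF that(2)] near_trans near_sym by metis
    then have "rational_pt (z i)"
      using recurrent_bad_rational[OF z that(3)] that by (simp add: ram_steps_def)
    then show False
      using that(1) by (simp add: ram_steps_def)
  qed
  have "inj_on g (ram_steps z n)"
    using neq by (intro inj_onI) (metis linorder_neqE_nat)
  then show ?thesis
    using g by (intro card_inj_on_le[OF _ _ S(1)]) auto
qed

text \<open>Inertia keeps \<open>z\<close> in its residue class and its image unchanged; on a good
  class \<open>f\<close> is injective.\<close>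

lemma non_ram_step_fixed:
  assumes \<sigma>: "\<sigma> \<in> galois_group K" "\<sigma> \<in> inert" and "map_option \<sigma> (f z) = f z"
    and "\<not> bad z \<or> rational_pt z"
  shows "map_option \<sigma> z = z"
  using assms(4)
proof
  assume "\<not> bad z"
  moreover have "f z = f (map_option \<sigma> z)"
    using assms(3) galois_f[OF \<sigma>(1), of z] by simp
  ultimately show ?thesis
    using f_inj_on_good_class[OF near_sym[OF inert_near[OF \<sigma>, of z]]] by simp
next
  assume "rational_pt z"
  then show ?thesis
    using \<sigma>(1) by (simp add: rational_pt_def)
qed

lemma fiber_stable:
  assumes "\<sigma> \<in> galois_group K" "map_option \<sigma> b = b" "f (Some y) = b"
  shows "f (Some (\<sigma> y)) = b"
  using galois_f[OF assms(1), of "Some y"] assms(2,3) by simp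

text \<open>\<open>J\<close> is kept at unramified levels and replaced by a pointwise stabilizer at
  ramified ones. The whole fibre is fixed, not just the point on the path, because the tameness
  argument averages over siblings.\<close>

lemma path_stabilizer:
  assumes e: "\<forall>x. x \<noteq> 0 \<longrightarrow> (\<forall>\<sigma>\<in>galois_group K \<inter> inert. \<sigma> x = x) \<longrightarrow>
      (\<exists>k. N x ^ e = N (of_nat p) powi k)"
    and z: "tree_path a0 z n"
  shows "\<exists>J. inert_subgroup J \<and> (\<forall>\<sigma>\<in>J. map_option \<sigma> (z n) = z n) \<and>
    (\<forall>\<sigma>\<in>J. \<forall>i\<in>ram_steps z n. \<forall>y. f (Some y) = f (z i) \<longrightarrow> \<sigma> y = y) \<and>
    (\<forall>x. x \<noteq> 0 \<longrightarrow> (\<forall>\<sigma>\<in>J. \<sigma> x = x) \<longrightarrow>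
      (\<exists>k. N x ^ (e * fact (d ^ d) ^ card (ram_steps z n)) = N (of_nat p) powi k))"
  using z
proof (induction n)
  case 0
  then have z0: "z 0 = Some a0"
    by (simp add: tree_path_def)
  then have "ram_steps z 0 = {}"
    using rational_pt_a0 by (auto simp: ram_steps_def) (metis gr0I)
  then show ?case
    using inert_subgroup_full e rational_pt_a0 z0
    by (intro exI[of _ "galois_group K \<inter> inert"]) (auto simp: rational_pt_def)
next
  case (Suc n)
  then have zn: "f (z (Suc n)) = z n" and "tree_path a0 z n"
    by (auto simp: tree_path_def)
  then obtain J where J: "inert_subgroup J" "\<forall>\<sigma>\<in>J. map_option \<sigma> (z n) = z n"
    "\<forall>\<sigma>\<in>J. \<forall>i\<in>ram_steps z n. \<forall>y. f (Some y) = f (z i) \<longrightarrow> \<sigma> y = y"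
    "\<forall>x. x \<noteq> 0 \<longrightarrow> (\<forall>\<sigma>\<in>J. \<sigma> x = x) \<longrightarrow>
      (\<exists>k. N x ^ (e * fact (d ^ d) ^ card (ram_steps z n)) = N (of_nat p) powi k)"
    using Suc.IH by blast
  note JK = inert_subgroupD(4)[OF J(1)] and JI = inert_subgroupD(5)[OF J(1)]
  show ?case
  proof (cases "bad (z (Suc n)) \<and> \<not> rational_pt (z (Suc n))")
    case False
    then have "ram_steps z (Suc n) = ram_steps z n"
      by (auto simp: ram_steps_def le_Suc_eq)
    moreover have "map_option \<sigma> (z (Suc n)) = z (Suc n)" if "\<sigma> \<in> J" for \<sigma>
      by (rule non_ram_step_fixed[OF JK[OF that] JI[OF that]]) (use False J(2) that in \<open>auto simp: zn\<close>)
    ultimately show ?thesis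
      using J by (intro exI[of _ J]) simp
  next
    case True
    define Y where "Y = {y. f (Some y) = z n}"
    define J' where "J' = {\<sigma>\<in>J. \<forall>y\<in>Y. \<sigma> y = y}"
    have steps: "ram_steps z (Suc n) = insert (Suc n) (ram_steps z n)" "Suc n \<notin> ram_steps z n"
      using True by (auto simp: ram_steps_def le_Suc_eq)
    then have card: "card (ram_steps z (Suc n)) = Suc (card (ram_steps z n))"
      using finite_ram_steps by simp
    \<comment> \<open>The point is finite, because infinity is rational.\<close>
    obtain y where y: "z (Suc n) = Some y" "y \<in> Y"
      using True rational_pt_None zn by (cases "z (Suc n)") (auto simp: Y_def)
    have "\<exists>k. N x ^ (e * fact (d ^ d) ^ card (ram_steps z (Suc n))) = N (of_nat p) powi k"
      if x: "x \<noteq> 0" "\<forall>\<sigma>\<in>J'. \<sigma> x = x" for x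
    proof -
      have "\<exists>k. N x ^ ((e * fact (d ^ d) ^ card (ram_steps z n)) * fact (d ^ d)) = N (of_nat p) powi k"
      proof (rule value_group_pointwise_stabilizer[OF J(1), of Y])
        show "finite Y" "card Y \<le> d"
          unfolding Y_def by (rule finite_fiber)+
        show "0 < d"
          using d_bounds by simp
        show "\<sigma> y \<in> Y" if "\<sigma> \<in> J" "y \<in> Y" for \<sigma> y
          using fiber_stable[OF JK[OF that(1)]] J(2) that by (simp add: Y_def)
      qed (use J(4) x in \<open>auto simp: J'_def\<close>)
      then show ?thesis
        by (simp add: card mult_ac)
    qed
    moreover have "\<sigma> y' = y'" if "\<sigma> \<in> J'" "i \<in> ram_steps z (Suc n)" "f (Some y') = f (z i)" for \<sigma> i y'
      using that J(3) zn by (auto simp: steps J'_def Y_def)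
    moreover have "map_option \<sigma> (z (Suc n)) = z (Suc n)" if "\<sigma> \<in> J'" for \<sigma>
      using that y by (simp add: J'_def)
    moreover have "inert_subgroup J'"
      unfolding J'_def by (rule inert_subgroup_pointwise_stabilizer[OF J(1)])
    ultimately show ?thesis
      by (intro exI[of _ J']) blast
  qed
qed

text \<open>Climbing a path level by level, ramified levels are handled by tameness; a root of
  \<open>p\<close> of order \<open>E\<close> supplies elements of \<open>L\<close> with every value
  occurring among the means of siblings.\<close>

lemma tree_finitely_ramified:
  shows "\<exists>L. finite_extension K L \<and>
    (\<forall>\<sigma>\<in>galois_group L \<inter> inert. \<forall>z n. tree_path a0 z n \<longrightarrow> map_option \<sigma> (z n) = z n)"
proof -
  obtain S where S: "finite S" "\<And>z. bad z \<Longrightarrow> \<exists>s\<in>S. near z s"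
    by (rule finite_bad_classes) blast
  obtain e where e: "0 < e" "\<forall>x. x \<noteq> 0 \<longrightarrow> (\<forall>\<sigma>\<in>galois_group K \<inter> inert. \<sigma> x = x) \<longrightarrow>
    (\<exists>k. N x ^ e = N (of_nat p) powi k)"
    using fixed_value_group_discrete[OF finite_extension_refl] by blast
  define E where "E = e * fact (d ^ d) ^ card S"
  have E: "0 < E"
    using e(1) by (simp add: E_def)
  obtain L \<rho> where L: "finite_extension K L" "\<rho> \<in> L" "\<rho> ^ E = of_nat p"
    by (rule exists_root_of_p[OF E])
  have "K \<subseteq> L"
    by (rule finite_extensionE[OF L(1)])
  have "map_option \<sigma> (z n) = z n" if s: "\<sigma> \<in> galois_group L \<inter> inert" and z: "tree_path a0 z n" for \<sigma> z n
    using z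
  proof (induction n)
    case 0
    then show ?case
      using rational_pt_a0 s galois_group_antimono[OF \<open>K \<subseteq> L\<close>]
      by (auto simp: tree_path_def rational_pt_def)
  next
    case (Suc n)
    have sK: "\<sigma> \<in> galois_group K" and sI: "\<sigma> \<in> inert"
      using s galois_group_antimono[OF \<open>K \<subseteq> L\<close>] by auto
    have zn: "f (z (Suc n)) = z n" and fixn: "map_option \<sigma> (z n) = z n"
      using Suc by (auto simp: tree_path_def)
    show ?case
    proof (cases "bad (z (Suc n)) \<and> \<not> rational_pt (z (Suc n))")
      case False
      show ?thesis
        by (rule non_ram_step_fixed[OF sK sI]) (use fixn False in \<open>auto simp: zn\<close>)
    next
      case True
      define Y where "Y = {y. f (Some y) = z n}"
      obtain y where y: "z (Suc n) = Some y" "y \<in> Y"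
        using True rational_pt_None zn by (cases "z (Suc n)") (auto simp: Y_def)
      \<comment> \<open>Taken one level up, so that \<open>J\<close> fixes every finite point of the
        fibre \<open>Y\<close> containing \<open>y\<close>.\<close>
      obtain J where J: "inert_subgroup J" "\<forall>\<sigma>\<in>J. map_option \<sigma> (z (Suc n)) = z (Suc n)"
        "\<forall>\<sigma>\<in>J. \<forall>i\<in>ram_steps z (Suc n). \<forall>y. f (Some y) = f (z i) \<longrightarrow> \<sigma> y = y"
        "\<forall>x. x \<noteq> 0 \<longrightarrow> (\<forall>\<sigma>\<in>J. \<sigma> x = x) \<longrightarrow>
          (\<exists>k. N x ^ (e * fact (d ^ d) ^ card (ram_steps z (Suc n))) = N (of_nat p) powi k)"
        using path_stabilizer[OF e(2) Suc.prems] by (elim exE conjE) (rule that)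
      have "card (ram_steps z (Suc n)) \<le> card S"
        by (rule card_ram_steps_le[OF S Suc.prems])
      \<comment> \<open>\<open>E\<close> is a multiple of the exponent attached to this path, so one
        root of \<open>p\<close> serves all paths.\<close>
      then have split: "E = e * fact (d ^ d) ^ card (ram_steps z (Suc n))
          * fact (d ^ d) ^ (card S - card (ram_steps z (Suc n)))"
        by (simp add: E_def mult.assoc flip: power_add)
      have "Suc n \<in> ram_steps z (Suc n)"
        using True by (simp add: ram_steps_def)
      have "\<sigma> y = y"
      proof (rule tame_inertia_fixes[OF sK sI _ L(3) E, of Y y J])
        show "\<sigma> \<rho> = \<rho>"
          using s L(2) galois_groupD(4) by blast
        show "finite Y" "card Y < p"
          using finite_fiber[of "z n"] d_bounds by (simp_all add: Y_def)
        show "y \<in> Y"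
          by (rule y)
        show "\<sigma> y \<in> Y" if "y \<in> Y" for y
          using fiber_stable[OF sK fixn] that by (simp add: Y_def)
        show "J \<subseteq> galois_group K"
          using inert_subgroupD(4)[OF J(1)] by blast
        show "\<tau> y = y" if "\<tau> \<in> J" "y \<in> Y" for \<tau> y
          using J(3) that \<open>Suc n \<in> ram_steps z (Suc n)\<close> zn by (auto simp: Y_def)
        show "\<exists>k. N x ^ E = N (of_nat p) powi k" if x: "x \<noteq> 0" "\<And>\<tau>. \<tau> \<in> J \<Longrightarrow> \<tau> x = x" for x
        proof -
          have "\<forall>\<tau>\<in>J. \<tau> x = x"
            using x(2) by (rule ballI)
          then obtain k where k: "N x ^ (e * fact (d ^ d) ^ card (ram_steps z (Suc n))) = N (of_nat p) powi k"
            using J(4)[THEN spec[of _ x], THEN mp, OF x(1)] by blast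
          then have "N x ^ E
              = N (of_nat p) powi (k * int (fact (d ^ d) ^ (card S - card (ram_steps z (Suc n)))))"
            by (subst split, subst power_mult, subst k) (simp only: power_int_mult power_int_of_nat)
          then show ?thesis
            by blast
        qed
      qed
      then show ?thesis
        by (simp add: y)
    qed
  qed
  then show ?thesis
    using L(1) by blast
qed

end

end

section \<open>From the valuation to an absolute value\<close>

text \<open>The case \<open>x = 0\<close> is separate because \<open>real_of_ereal\<close> sends
  infinity to 0, which would give the value 1.\<close>

definition vabs :: "('a::field \<Rightarrow> ereal) \<Rightarrow> 'a \<Rightarrow> real" where
  "vabs v x = (if x = 0 then 0 else exp (- real_of_ereal (v x)))"

context
  fixes v :: "'a::field_char_0 \<Rightarrow> ereal"
  assumes v: "is_valuation v"
begin

lemma valuation_real: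
  assumes "x \<noteq> 0"
  obtains r where "v x = ereal r" "vabs v x = exp (- r)"
proof -
  have "v x \<noteq> \<infinity>" "v x \<noteq> - \<infinity>"
    using v assms by (simp_all add: is_valuation_def)
  then obtain r where "v x = ereal r"
    by (cases "v x") auto
  then show thesis
    using that assms by (simp add: vabs_def)
qed

lemma valuation_0: "v 0 = \<infinity>"
  using v by (simp add: is_valuation_def)

lemma vabs_less_iff:
  assumes "0 < e"
  shows "vabs v x < e \<longleftrightarrow> ereal (- ln e) < v x"
proof (cases "x = 0")
  case False
  then obtain r where r: "v x = ereal r" "vabs v x = exp (- r)"
    by (rule valuation_real)
  have "vabs v x < e \<longleftrightarrow> exp (- r) < exp (ln e)"
    using assms by (simp add: r)
  then show ?thesis
    by (auto simp: r(1))
qed (use assms in \<open>simp add: vabs_def valuation_0\<close>)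

lemma vabs_less_1_iff: "vabs v x < 1 \<longleftrightarrow> 0 < v x"
  using vabs_less_iff[of 1 x] by (simp add: zero_ereal_def)

lemma vabs_le_1_iff: "vabs v x \<le> 1 \<longleftrightarrow> 0 \<le> v x"
proof (cases "x = 0")
  case False
  then obtain r where "v x = ereal r" "vabs v x = exp (- r)"
    by (rule valuation_real)
  then show ?thesis
    by simp
qed (simp add: vabs_def valuation_0)

lemma vabs_eq_1: "v x = 0 \<Longrightarrow> vabs v x = 1"
  using valuation_0 by (auto simp: vabs_def)

lemma nonarch_vabs: "nonarch (vabs v)"
proof
  show "vabs v 0 = 0"
    by (simp add: vabs_def)
  show "0 < vabs v x" if "x \<noteq> 0" for x
    using that by (simp add: vabs_def)
  show "vabs v (x * y) = vabs v x * vabs v y" for x y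
  proof (cases "x = 0 \<or> y = 0")
    case False
    then obtain r s where rs: "v x = ereal r" "vabs v x = exp (- r)" "v y = ereal s" "vabs v y = exp (- s)"
      using valuation_real by metis
    have "v (x * y) = v x + v y"
      using v by (simp add: is_valuation_def)
    then show ?thesis
      using False by (simp add: vabs_def rs(1,3) exp_add exp_diff exp_minus field_simps)
  qed (auto simp: vabs_def)
  show "vabs v (x + y) \<le> max (vabs v x) (vabs v y)" for x y
  proof (cases "x = 0 \<or> y = 0 \<or> x + y = 0")
    case False
    then obtain r s t where rs: "v x = ereal r" "vabs v x = exp (- r)" "v y = ereal s"
      "vabs v y = exp (- s)" "v (x + y) = ereal t" "vabs v (x + y) = exp (- t)"
      using valuation_real by metis
    have "min (v x) (v y) \<le> v (x + y)"
      using v by (simp add: is_valuation_def)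
    then have "r \<le> t \<or> s \<le> t"
      unfolding rs(1,3,5) by (auto simp: min_le_iff_disj)
    then show ?thesis
      by (auto simp: rs le_max_iff_disj)
  qed (auto simp: vabs_def le_max_iff_disj)
qed

lemma valuation_greater_iff: "ereal M < v x \<longleftrightarrow> vabs v x < exp (- M)"
  using vabs_less_iff[of "exp (- M)" x] by simp

lemma complete_abs_vabs:
  assumes "complete_wrt v K"
  shows "nonarch.complete_abs (vabs v) K"
proof -
  interpret nonarch "vabs v"
    by (rule nonarch_vabs)
  show ?thesis
    unfolding complete_abs_def
  proof (intro allI impI)
    fix x :: "nat \<Rightarrow> 'a"
    assume x: "\<forall>n. x n \<in> K" and cauchy: "\<forall>e>0. \<exists>M. \<forall>m\<ge>M. \<forall>n\<ge>M. vabs v (x m - x n) < e"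
    have "\<forall>M. \<exists>k. \<forall>m\<ge>k. \<forall>n\<ge>k. v (x m - x n) > ereal M"
      unfolding valuation_greater_iff using cauchy by simp
    then obtain y where y: "y \<in> K" "\<forall>M. \<exists>k. \<forall>n\<ge>k. v (x n - y) > ereal M"
      using assms x unfolding complete_wrt_def by blast
    have "(\<lambda>n. vabs v (x n - y)) \<longlonglongrightarrow> 0"
    proof (rule LIMSEQ_I)
      fix r :: real assume "0 < r"
      then obtain k where "\<forall>n\<ge>k. vabs v (x n - y) < r"
        using y(2)[rule_format, of "- ln r"] by (auto simp: vabs_less_iff)
      then show "\<exists>k. \<forall>n\<ge>k. norm (vabs v (x n - y) - 0) < r"
        by auto
    qed
    then show "\<exists>y\<in>K. (\<lambda>n. vabs v (x n - y)) \<longlonglongrightarrow> 0"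
      using y(1) by blast
  qed
qed

end

theorem theorem4p5:
  fixes v :: "'a::field_char_0 \<Rightarrow> ereal" and p d :: nat and K :: "'a set"
    and P Q :: "'a poly" and a0 :: 'a
  assumes "algebraically_closed_type TYPE('a)"
    and "algebraic_over K"
    and "finite_ext_Qp v p K"
    and "\<forall>i. coeff P i \<in> ring_of_integers v K"
    and "\<forall>i. coeff Q i \<in> ring_of_integers v K"
    and "coprime P Q"
    and "d = max (degree P) (degree Q)"
    and "2 \<le> d" and "d < p"
    and "good_reduction v P Q"
    and "a0 \<in> K"
    and "infinitely_ramified v K (arboreal_tree (rat_map P Q) a0)"
  shows "\<exists>\<alpha>. is_branch (rat_map P Q) a0 \<alpha> \<and>
               infinitely_ramified v K (branch_orbit_tree K \<alpha>)"
proof (rule ccontr)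
  assume neg: "\<not> ?thesis"
  have v: "is_valuation v" and Kp: "prime p" "0 < v (of_nat p)" "is_subfield K" "complete_wrt v K"
      "finite_extension (rat_closure v) K"
    using assms(3) by (auto simp: finite_ext_Qp_def)
  interpret nonarch "vabs v"
    by (rule nonarch_vabs[OF v])
  interpret nonarch_p "vabs v" p
    by unfold_locales (use Kp assms(1,8,9) vabs_less_1_iff[OF v] in auto)
  have hull: "rat_hull = rat_closure v"
  proof -
    have "(\<forall>e>0. \<exists>q. vabs v (y - of_rat q) < e) \<longleftrightarrow> (\<forall>M. \<exists>q. ereal M < v (y - of_rat q))" for y
      unfolding valuation_greater_iff[OF v] by (metis exp_gt_zero exp_ln minus_minus)
    then show ?thesis
      by (simp add: rat_hull_def rat_closure_def)
  qed
  interpret good_map "vabs v" p K P Q d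
  proof unfold_locales
    show "is_subfield K" "complete_abs K" "finite_extension rat_hull K" "algebraic_over K"
      using Kp complete_abs_vabs[OF v] assms(2) by (auto simp: hull)
    show "intpoly P" "intpoly Q"
      using assms(4,5) by (auto simp: intpoly_def ring_of_integers_def vabs_le_1_iff[OF v])
    show "coeff P i \<in> K" "coeff Q i \<in> K" for i
      using assms(4,5) by (auto simp: ring_of_integers_def)
    show "vabs v (hom_resultant d P Q) = 1"
      using assms(7,10) by (intro vabs_eq_1[OF v]) (simp add: good_reduction_def)
  qed (use assms in auto)
  have inert: "inert = inertia v"
    by (simp add: inert_def inertia_def vabs_le_1_iff[OF v] vabs_less_1_iff[OF v])
  have "\<exists>L. finite_extension K L \<and> (\<forall>\<sigma>\<in>galois_group L \<inter> inert. \<forall>m. map_option \<sigma> (\<alpha> m) = \<alpha> m)"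
    if br: "is_branch f a0 \<alpha>" for \<alpha>
  proof -
    obtain L where L: "finite_extension K L"
      "\<forall>\<sigma>\<in>galois_group L \<inter> inert. \<forall>\<beta>\<in>branch_orbit_tree K \<alpha>. map_option \<sigma> \<beta> = \<beta>"
      using neg br by (auto simp: infinitely_ramified_def inert)
    \<comment> \<open>The identity places the branch inside its own orbit tree, so triviality on the
      orbit tree gives triviality on the branch.\<close>
    have "id \<in> galois_group K"
      by (simp add: galois_group_def)
    then have "map_option id (\<alpha> m) \<in> branch_orbit_tree K \<alpha>" for m
      unfolding branch_orbit_tree_def by blast
    then have "\<alpha> m \<in> branch_orbit_tree K \<alpha>" for m
      by (simp add: option.map_id)
    then show ?thesis
      using L by blast
  qed
  then obtain L where L: "finite_extension K L"
    "\<forall>\<sigma>\<in>galois_group L \<inter> inert. \<forall>z n. tree_path a0 z n \<longrightarrow> map_option \<sigma> (z n) = z n"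
    using tree_finitely_ramified[OF assms(11)] by blast
  have "map_option \<sigma> \<beta> = \<beta>" if s: "\<sigma> \<in> galois_group L \<inter> inert" and b: "\<beta> \<in> arboreal_tree f a0" for \<sigma> \<beta>
  proof -
    obtain n where n: "(f ^^ n) \<beta> = Some a0"
      using b by (auto simp: arboreal_tree_def)
    \<comment> \<open>The forward orbit of \<open>\<beta>\<close> read backwards is a path from
      \<open>a0\<close> up to \<open>\<beta>\<close>.\<close>
    define z where "z = (\<lambda>m. (f ^^ (n - m)) \<beta>)"
    have "f (z (Suc m)) = z m" if "m < n" for m
    proof -
      have "n - m = Suc (n - Suc m)"
        using that by simp
      then show ?thesis
        by (simp add: z_def)
    qed
    then have "tree_path a0 z n"
      using n by (simp add: tree_path_def z_def)
    then have "map_option \<sigma> (z n) = z n"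
      using L(2) s by blast
    then show ?thesis
      by (simp add: z_def)
  qed
  then show False
    using assms(12) L(1) unfolding infinitely_ramified_def inert by blast
qed

end
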